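(* Let $V = (V_x)_{x \in X}$ be a Borel field of separable reflexive Banach spaces (i.e. a Borel field of separable Banach spaces in which every $V_x$ is reflexive). Let $W \subset V$ be a Borel set such that for every $x \in X$, $W_x := W \cap V_x$ is a closed linear subspace of $V_x$. Then $W = (W_x)_{x\in X}$, with the restricted Borel structure, is a Borel field of Banach spaces: there exists a dense sequence of Borel sections $\psi_n : X \to W$.
   Context: Conventions. A standard Borel space is a measurable space isomorphic to a Borel subset of a Polish space. Product spaces carry the product $\sigma$-algebra and subsets the restricted $\sigma$-algebra. For a family of sets $V = (V_x)_{x\in X}$, the symbol $V$ also denotes the disjoint union of the $V_x$, and $\pi : V \to X$ is the map with $\pi(v) = x$ for $v \in V_x$. $V \times_\pi V = \{(v,w) \in V \times V \mid \pi(v)=\pi(w)\}$. A section is a map $\varphi : X \to V$ with $\varphi(x)\in V_x$ for all $x$. A sequence of Borel sections $\varphi_n : X \to V$ is dense if $\{\varphi_n(x) \mid n\in\mathbb{N}\}$ is dense in $V_x$ for every $x\in X$. A Borel field of separable Banach spaces (complex scalars) consists of a standard Borel space $X$, a family $V=(V_x)_{x\in X}$ of separable Banach spaces and a standard Borel structure on $V$ such that $\pi : V\to X$, the norm $V\to[0,+\infty)$, the addition $V\times_\pi V\to V$ and the scalar multiplication $\mathbb{C}\times V\to V$ are Borel, and there is a (norm) dense sequence of Borel sections $X\to V$. *)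

theory Defs
  imports "HOL-Analysis.Analysis" "HOL-Algebra.Module"
begin

section \<open>Standard Borel spaces\<close>

text \<open>As usual, a \<^typ>\<open>'a measure\<close> serves as a measurable space: only \<^const>\<open>space\<close> and
  \<^const>\<open>sets\<close> matter below.\<close>

definition polish_topology :: "'a topology \<Rightarrow> bool" where
  "polish_topology T \<longleftrightarrow> completely_metrizable_space T \<and> separable_space T"

definition borel_sigma :: "'a topology \<Rightarrow> 'a measure" where
  "borel_sigma T = sigma (topspace T) {U. openin T U}"

definition measurable_isomorphic :: "'a measure \<Rightarrow> 'b measure \<Rightarrow> bool" where
  "measurable_isomorphic M N \<longleftrightarrow>
     (\<exists>f g. f \<in> M \<rightarrow>\<^sub>M N \<and> g \<in> N \<rightarrow>\<^sub>M M \<and>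
       (\<forall>x\<in>space M. g (f x) = x) \<and> (\<forall>y\<in>space N. f (g y) = y))"

text \<open>Quantifying over topologies on subsets of \<^typ>\<open>real\<close> loses no generality: a Polish space has
  at most the cardinality of the continuum, so its topology can be transported to a set of reals.
  The topology \<^term>\<open>T\<close> is arbitrary, in particular unrelated to the usual one.\<close>

definition standard_borel :: "'a measure \<Rightarrow> bool" where
  "standard_borel M \<longleftrightarrow>
     (\<exists>(T :: real topology) B. polish_topology T \<and> B \<in> sets (borel_sigma T) \<and>
       measurable_isomorphic M (restrict_space (borel_sigma T) B))"


section \<open>Complex Banach spaces on a carrier set\<close>

definition complex_ring :: "complex ring" where
  "complex_ring = \<lparr>carrier = UNIV, mult = (*), one = 1, zero = 0, add = (+)\<rparr>"

text \<open>The fields \<^const>\<open>mult\<close> and \<^const>\<open>one\<close> inherited from \<^typ>\<open>('c, 'a) module\<close> are never used.\<close>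

record 'a normed_vs = "(complex, 'a) module" +
  nrm :: "'a \<Rightarrow> real" (\<open>\<parallel>_\<parallel>\<index>\<close>)

locale complex_normed_vs = module complex_ring V for V :: "('a, 'm) normed_vs_scheme" (structure) +
  assumes nrm_nonneg: "v \<in> carrier V \<Longrightarrow> 0 \<le> \<parallel>v\<parallel>"
    and nrm_eq_0_iff: "v \<in> carrier V \<Longrightarrow> \<parallel>v\<parallel> = 0 \<longleftrightarrow> v = \<zero>"
    and nrm_smult: "v \<in> carrier V \<Longrightarrow> \<parallel>c \<odot> v\<parallel> = cmod c * \<parallel>v\<parallel>"
    and nrm_triangle: "v \<in> carrier V \<Longrightarrow> w \<in> carrier V \<Longrightarrow> \<parallel>v \<oplus> w\<parallel> \<le> \<parallel>v\<parallel> + \<parallel>w\<parallel>"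

text \<open>The value 0 off the carrier is forced by \<^locale>\<open>Metric_space\<close>, which demands
  nonnegativity and symmetry on the whole type.\<close>

definition nrm_dist :: "('a, 'm) normed_vs_scheme \<Rightarrow> 'a \<Rightarrow> 'a \<Rightarrow> real" where
  "nrm_dist V v w =
     (if v \<in> carrier V \<and> w \<in> carrier V then \<parallel>v \<ominus>\<^bsub>V\<^esub> w\<parallel>\<^bsub>V\<^esub> else 0)"

definition nrm_topology :: "('a, 'm) normed_vs_scheme \<Rightarrow> 'a topology" where
  "nrm_topology V = Metric_space.mtopology (carrier V) (nrm_dist V)"

locale complex_banach = complex_normed_vs +
  assumes complete: "Metric_space.mcomplete (carrier V) (nrm_dist V)"

lemma cring_complex_ring: "cring complex_ring"
proof -
  have "\<exists>y. x + y = 0" for x :: complex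
    using add.right_inverse by blast
  then show ?thesis
    unfolding complex_ring_def using add.right_inverse
    by unfold_locales (auto simp: algebra_simps Units_def)
qed

lemma (in complex_normed_vs) Metric_space_nrm_dist: "Metric_space (carrier V) (nrm_dist V)"
proof
  fix x y
  show "0 \<le> nrm_dist V x y"
    by (simp add: nrm_dist_def nrm_nonneg)
  have neg: "\<parallel>\<ominus> v\<parallel> = \<parallel>v\<parallel>" if v: "v \<in> carrier V" for v
  proof -
    have one: "\<one>\<^bsub>complex_ring\<^esub> = 1" by (simp add: complex_ring_def)
    have m1: "\<ominus>\<^bsub>complex_ring\<^esub> \<one>\<^bsub>complex_ring\<^esub> = -1"
      by (rule R.minus_equality) (auto simp: complex_ring_def)
    have "\<ominus> v = (\<ominus>\<^bsub>complex_ring\<^esub> \<one>\<^bsub>complex_ring\<^esub>) \<odot> v"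
      using v by (simp add: smult_l_minus)
    then show ?thesis using nrm_smult[OF v, of "-1"] m1 by simp
  qed
  show "nrm_dist V x y = nrm_dist V y x"
  proof (cases "x \<in> carrier V \<and> y \<in> carrier V")
    case True
    then have "\<ominus> (x \<ominus> y) = y \<ominus> x"
      by (simp add: a_minus_def M.minus_add M.a_comm)
    then show ?thesis using True neg[of "x \<ominus> y"] by (simp add: nrm_dist_def)
  qed (auto simp: nrm_dist_def)
next
  fix x y assume xy: "x \<in> carrier V" "y \<in> carrier V"
  have "x \<ominus> y = \<zero> \<longleftrightarrow> x = y"
    using xy by (metis M.r_neg M.minus_equality M.minus_minus a_minus_def M.a_inv_closed)
  then show "nrm_dist V x y = 0 \<longleftrightarrow> x = y"
    using xy by (simp add: nrm_dist_def nrm_eq_0_iff)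
next
  fix x y z assume c: "x \<in> carrier V" "y \<in> carrier V" "z \<in> carrier V"
  have "x \<ominus> z = (x \<ominus> y) \<oplus> (y \<ominus> z)"
    using c by (simp add: a_minus_def M.a_assoc M.r_neg1 M.r_neg2)
  then show "nrm_dist V x z \<le> nrm_dist V x y + nrm_dist V y z"
    using c nrm_triangle[of "x \<ominus> y" "y \<ominus> z"] by (simp add: nrm_dist_def)
qed


section \<open>Dual space and reflexivity\<close>

definition bounded_functionals :: "('a, 'm) normed_vs_scheme \<Rightarrow> ('a \<Rightarrow> complex) set" where
  "bounded_functionals V =
     {f \<in> extensional (carrier V).
        (\<forall>v\<in>carrier V. \<forall>w\<in>carrier V. f (v \<oplus>\<^bsub>V\<^esub> w) = f v + f w) \<and>
        (\<forall>c. \<forall>v\<in>carrier V. f (c \<odot>\<^bsub>V\<^esub> v) = c * f v) \<and>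
        (\<exists>C. \<forall>v\<in>carrier V. cmod (f v) \<le> C * \<parallel>v\<parallel>\<^bsub>V\<^esub>)}"

definition dual :: "('a, 'm) normed_vs_scheme \<Rightarrow> ('a \<Rightarrow> complex) normed_vs" where
  "dual V =
     \<lparr>carrier = bounded_functionals V,
      mult = undefined,
      one = undefined,
      zero = (\<lambda>v\<in>carrier V. 0),
      add = (\<lambda>f g. \<lambda>v\<in>carrier V. f v + g v),
      smult = (\<lambda>c f. \<lambda>v\<in>carrier V. c * f v),
      nrm = (\<lambda>f. SUP v\<in>{v \<in> carrier V. \<parallel>v\<parallel>\<^bsub>V\<^esub> \<le> 1}. cmod (f v))\<rparr>"

definition reflexive :: "('a, 'm) normed_vs_scheme \<Rightarrow> bool" where
  "reflexive V \<longleftrightarrow>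
     (\<lambda>v. \<lambda>f\<in>carrier (dual V). f v) ` carrier V = carrier (dual (dual V))"


section \<open>Borel fields of separable Banach spaces\<close>

text \<open>A family \<^term>\<open>V\<close> is given by its members \<^term>\<open>V x\<close> for \<^term>\<open>x \<in> space X\<close>.  Its disjoint union is
  the set of pairs \<^term>\<open>(x, v)\<close> with \<^term>\<open>v \<in> carrier (V x)\<close>, the projection is \<^const>\<open>fst\<close>, and the
  measurable space \<^term>\<open>M\<close> is the Borel structure on the disjoint union.  A section
  is represented by its second component.\<close>

definition dense_borel_sections ::
  "'x measure \<Rightarrow> ('x \<Rightarrow> ('a, 'm) normed_vs_scheme) \<Rightarrow> ('x \<times> 'a) measure \<Rightarrow> (nat \<Rightarrow> 'x \<Rightarrow> 'a) \<Rightarrow> bool" where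
  "dense_borel_sections X V M \<phi> \<longleftrightarrow>
     (\<forall>n. (\<lambda>x. (x, \<phi> n x)) \<in> X \<rightarrow>\<^sub>M M) \<and>
     (\<forall>x\<in>space X. nrm_topology (V x) closure_of range (\<lambda>n. \<phi> n x) = carrier (V x))"

locale borel_field =
  fixes X :: "'x measure"
    and V :: "'x \<Rightarrow> ('a, 'm) normed_vs_scheme"
    and M :: "('x \<times> 'a) measure"
  assumes base: "standard_borel X"
    and banach: "x \<in> space X \<Longrightarrow> complex_banach (V x)"
    and separable: "x \<in> space X \<Longrightarrow> separable_space (nrm_topology (V x))"
    and space_total: "space M = (SIGMA x:space X. carrier (V x))"
    and total: "standard_borel M"
    and measurable_proj: "fst \<in> M \<rightarrow>\<^sub>M X"
    and measurable_nrm: "(\<lambda>(x, v). \<parallel>v\<parallel>\<^bsub>V x\<^esub>) \<in> M \<rightarrow>\<^sub>M restrict_space borel {0..}"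
    and measurable_add:
      "(\<lambda>((x, v), (y, w)). (x, v \<oplus>\<^bsub>V x\<^esub> w))
         \<in> restrict_space (M \<Otimes>\<^sub>M M) {(p, q) \<in> space M \<times> space M. fst p = fst q} \<rightarrow>\<^sub>M M"
    and measurable_smult:
      "(\<lambda>(c, (x, v)). (x, c \<odot>\<^bsub>V x\<^esub> v)) \<in> (borel :: complex measure) \<Otimes>\<^sub>M M \<rightarrow>\<^sub>M M"
    and dense_sections: "\<exists>\<phi>. dense_borel_sections X V M \<phi>"

definition fiber :: "('x \<times> 'a) set \<Rightarrow> 'x \<Rightarrow> 'a set" where
  "fiber W x = {v. (x, v) \<in> W}"

definition subfamily ::
  "('x \<Rightarrow> ('a, 'm) normed_vs_scheme) \<Rightarrow> ('x \<times> 'a) set \<Rightarrow> 'x \<Rightarrow> ('a, 'm) normed_vs_scheme" where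
  "subfamily V W x = (V x)\<lparr>carrier := fiber W x\<rparr>"

end

theory Submission
  imports Defs
begin

text \<open>
  On a Borel field the Hahn-Banach construction can be carried out by explicit limits, so there are
  Borel functions \<open>g m\<close> on the total space that are real-linear of norm at most 1 on every fibre, with
  \<open>g m (\<phi> m x) = \<parallel>\<phi> m x\<parallel>\<close>.  Together they embed every fibre into the space of real sequences, and by
  reflexivity the intersection of \<open>W x\<close> with a closed ball becomes a compact set there.  The
  Kunugui-Novikov theorem on Borel sets with open fibres (a consequence of Novikov's separation
  theorem for analytic sets) then shows that the set of all \<open>x\<close> whose fibre \<open>W x\<close> misses the ball
  of radius \<open>r\<close> around \<open>\<phi> n x\<close> is Borel.  Hence the distance of \<open>\<phi> n x\<close> to \<open>W x\<close> is a Borel function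
  of \<open>x\<close>, and dense sections of \<open>W\<close> arise as limits of sections that equal some \<open>\<phi> i\<close> on each piece of
  a countable Borel partition.
\<close>

subsection \<open>The Baire space\<close>

text \<open>The obstacle is that the projection of a Borel set is in general only analytic, so that
  the set of \<open>x\<close> at which \<open>W x\<close> meets a ball has no reason to be Borel.
  Compact fibres cure this: if the fibre of a compact set is empty, finitely many rectangles from a
  countable list show it, and there are only countably many finite choices. Balls of
  \<open>W x\<close> are rarely norm compact; reflexivity makes them weakly compact. The weak
  topologies of all fibres must then be seen in one metrizable space, through functionals that vary
  in a Borel way with \<open>x\<close>. The dual spaces come without a Borel structure and a choice
  by Zorn's lemma would destroy measurability, hence the explicit limits. A second difficulty is
  that the Borel structure of the total space is tied to the norm topologies of the fibres only
  through the operations, so that a pointwise limit of Borel sections is not obviously Borel. The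
  distances to the sections \<open>\<phi> j\<close> form an injective Borel map, and on a standard
  Borel space every such map generates the whole Borel structure; measurability can therefore be
  tested on these distances, which do pass to the limit.\<close>

lemma open_vimage_coordinate:
  fixes A :: "'b::discrete_topology set"
  shows "open ((\<lambda>\<beta>::'i \<Rightarrow> 'b. \<beta> i) -` A)"
  by (intro open_vimage) (auto intro: open_discrete continuous_on_product_coordinates)

lemma open_cylinder: "open {\<beta>::nat \<Rightarrow> nat. \<forall>i\<le>k. \<beta> i = \<alpha> i}"
proof -
  have "open (\<Inter>i\<in>{..k}. (\<lambda>\<beta>::nat \<Rightarrow> nat. \<beta> i) -` {\<alpha> i})"
    by (intro open_INT ballI open_vimage_coordinate) auto
  also have "(\<Inter>i\<in>{..k}. (\<lambda>\<beta>::nat \<Rightarrow> nat. \<beta> i) -` {\<alpha> i}) = {\<beta>. \<forall>i\<le>k. \<beta> i = \<alpha> i}"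
    by auto
  finally show ?thesis .
qed

text \<open>The factor 2 is the sum of the geometric series. This explicit rate serves twice: for
  coding Polish spaces by digits and for the approximating sections of \<open>W\<close>.\<close>

lemma (in Metric_space) geometric_limit:
  assumes comp: mcomplete and s: "\<And>k. s k \<in> M" and step: "\<And>k. d (s (Suc k)) (s k) \<le> B * (1/2)^k"
  shows "\<exists>l\<in>M. \<forall>k. d l (s k) \<le> 2 * B * (1/2)^k"
proof -
  have "0 \<le> B" using step[of 0] nonneg[of "s (Suc 0)" "s 0"] by (metis mult.right_neutral order_trans power_0)
  \<comment> \<open>The exact partial sum of the series is carried along, since the bound
    \<open>2 * B * (1/2)^k\<close> alone would not pass through the induction.\<close>
  have tail: "d (s (k + j)) (s k) \<le> 2 * B * (1/2)^k - 2 * B * (1/2)^(k+j)" for k j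
  proof (induction j)
    case (Suc j)
    have "d (s (Suc (k + j))) (s k) \<le> d (s (Suc (k+j))) (s (k + j)) + d (s (k + j)) (s k)"
      by (rule triangle) (rule s)+
    also have "\<dots> \<le> B * (1/2)^(k+j) + (2 * B * (1/2)^k - 2 * B * (1/2)^(k+j))"
      by (intro add_mono step Suc)
    finally show ?case by (simp add: field_simps)
  qed (simp add: s)
  have tail': "d (s m) (s k) \<le> 2 * B * (1/2)^k" if "k \<le> m" for k m
  proof -
    have "0 \<le> 2 * B * (1/2)^m" using \<open>0 \<le> B\<close> by simp
    then show ?thesis using tail[of k "m - k"] that by simp
  qed
  have small: "\<exists>k. 2 * B * (1/2)^k < \<epsilon>" if "\<epsilon> > 0" for \<epsilon> :: real
  proof -
    have "(\<lambda>k. 2 * B * (1/2)^k) \<longlonglongrightarrow> 2 * B * 0"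
      by (intro tendsto_mult tendsto_const LIMSEQ_realpow_zero) auto
    then have "eventually (\<lambda>k. 2 * B * (1/2)^k < \<epsilon>) sequentially"
      using that by (intro order_tendstoD(2)) auto
    then show ?thesis by (auto simp: eventually_sequentially)
  qed
  have "MCauchy s"
    unfolding MCauchy_def
  proof (intro conjI allI impI)
    show "range s \<subseteq> M" using s by blast
    fix \<epsilon> :: real assume "\<epsilon> > 0"
    then obtain k where k: "2 * B * (1/2)^k < \<epsilon>/2" using small[of "\<epsilon>/2"] by auto
    have "d (s n) (s n') < \<epsilon>" if "k \<le> n" "k \<le> n'" for n n'
    proof -
      have "d (s n) (s n') \<le> d (s n) (s k) + d (s n') (s k)"
        using triangle[of "s n" "s k" "s n'"] s commute[of "s k" "s n'"] by simp
      then show ?thesis using tail'[OF that(1)] tail'[OF that(2)] k by linarith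
    qed
    then show "\<exists>N. \<forall>n n'. N \<le> n \<longrightarrow> N \<le> n' \<longrightarrow> d (s n) (s n') < \<epsilon>" by blast
  qed
  then obtain l where l: "limitin mtopology s l sequentially"
    using comp unfolding mcomplete_def by blast
  have lM: "l \<in> M" using l limitin_mspace by blast
  have "d l (s k) \<le> 2 * B * (1/2)^k" for k
  proof (rule field_le_epsilon)
    fix \<epsilon> :: real assume "\<epsilon> > 0"
    then have "eventually (\<lambda>n. s n \<in> M \<and> d (s n) l < \<epsilon>) sequentially"
      using l by (auto simp: limitin_metric)
    then obtain N where N: "\<And>n. n \<ge> N \<Longrightarrow> d (s n) l < \<epsilon>"
      by (auto simp: eventually_sequentially)
    let ?m = "max N k"
    have "d l (s k) \<le> d (s ?m) l + d (s ?m) (s k)"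
      using triangle[of l "s ?m" "s k"] lM s commute[of l "s ?m"] by simp
    then show "d l (s k) \<le> 2 * B * (1/2)^k + \<epsilon>"
      using N[of ?m] tail'[of k ?m] by simp
  qed
  then show ?thesis using lM by blast
qed

text \<open>A sequence of indices is read as a sequence of points of a countable dense set; an instruction
  to jump further than \<open>(1/2)^k\<close> at step \<open>k\<close> is ignored, so the walk always converges.\<close>

primrec guided :: "('a \<Rightarrow> 'a \<Rightarrow> real) \<Rightarrow> (nat \<Rightarrow> 'a) \<Rightarrow> (nat \<Rightarrow> nat) \<Rightarrow> nat \<Rightarrow> 'a" where
  "guided d a \<alpha> 0 = a (\<alpha> 0)"
| "guided d a \<alpha> (Suc k) =
     (if d (a (\<alpha> (Suc k))) (guided d a \<alpha> k) < (1/2)^k then a (\<alpha> (Suc k)) else guided d a \<alpha> k)"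

lemma guided_cong: "(\<And>i. i \<le> k \<Longrightarrow> \<alpha> i = \<beta> i) \<Longrightarrow> guided d a \<alpha> k = guided d a \<beta> k"
  by (induction k) auto

text \<open>Continuity: the digits up to \<open>k\<close> fix step \<open>k\<close> of the walk, and
  every limit lies within \<open>2 * (1/2)^k\<close> of it. Surjectivity: digits that approximate a
  given point fast enough never prescribe a jump that is ignored.\<close>

lemma polish_continuous_image_baire:
  assumes "completely_metrizable_space T" "separable_space T" "topspace T \<noteq> {}"
  obtains h :: "(nat \<Rightarrow> nat) \<Rightarrow> 'a" where "continuous_map euclidean T h" "range h = topspace T"
proof -
  obtain M d where "Metric_space M d" and comp: "Metric_space.mcomplete M d"
    and T: "T = Metric_space.mtopology M d"
    using assms(1) unfolding completely_metrizable_space_def by blast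
  interpret Metric_space M d by fact
  have top: "topspace T = M" by (simp add: T)
  obtain C where C: "countable C" "C \<subseteq> M" "mtopology closure_of C = M"
    using assms(2) unfolding separable_space_def T by auto
  then have "C \<noteq> {}" using assms(3) top by auto
  define a where "a = from_nat_into C"
  have a: "a i \<in> M" for i using C(2) from_nat_into[OF \<open>C \<noteq> {}\<close>] by (auto simp: a_def)
  have dense: "\<exists>i. d (a i) x < \<epsilon>" if x: "x \<in> M" and "\<epsilon> > 0" for x \<epsilon>
  proof -
    obtain y where y: "y \<in> C" "d x y < \<epsilon>"
      using C(3) x \<open>\<epsilon> > 0\<close> by (force simp: metric_closure_of)
    obtain i where "a i = y" using from_nat_into_surj[OF C(1) y(1)] by (auto simp: a_def)
    then show ?thesis using y(2) by (auto simp: commute)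
  qed
  let ?c = "guided d a"
  have c: "?c \<alpha> k \<in> M" for \<alpha> k by (induction k) (auto simp: a)
  have step: "d (?c \<alpha> (Suc k)) (?c \<alpha> k) \<le> (1/2)^k" for \<alpha> k
    using c[of \<alpha> k] by (auto simp: less_imp_le)
  have "\<exists>l\<in>M. \<forall>k. d l (?c \<alpha> k) \<le> 2 * 1 * (1/2)^k" for \<alpha>
    by (rule geometric_limit[OF comp]) (use c step in auto)
  then obtain h where hM: "\<And>\<alpha>. h \<alpha> \<in> M" and hd: "\<And>\<alpha> k. d (h \<alpha>) (?c \<alpha> k) \<le> 2 * (1/2)^k"
    by (metis mult.right_neutral)
  have small: "\<exists>k. 2 * (1/2)^k < \<epsilon>" if "\<epsilon> > 0" for \<epsilon> :: real
    using real_arch_pow_inv[of "\<epsilon>/2" "1/2"] that by (auto simp: field_simps)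
  have "continuous_map euclidean T h"
    unfolding T
  proof (subst continuous_map_to_metric, intro ballI allI impI)
    fix \<alpha> and \<epsilon> :: real assume "\<epsilon> > 0"
    then obtain k where k: "2 * (1/2)^k < \<epsilon>/2" using small[of "\<epsilon>/2"] by auto
    have "h \<beta> \<in> mball (h \<alpha>) \<epsilon>" if "\<forall>i\<le>k. \<beta> i = \<alpha> i" for \<beta>
    proof -
      have eq: "?c \<beta> k = ?c \<alpha> k" using that by (intro guided_cong) auto
      have "d (h \<alpha>) (h \<beta>) \<le> d (h \<alpha>) (?c \<alpha> k) + d (h \<beta>) (?c \<beta> k)"
        using triangle[of "h \<alpha>" "?c \<alpha> k" "h \<beta>"] c hM commute eq by metis
      then show ?thesis using hd[of \<alpha> k] hd[of \<beta> k] k hM by (simp add: mball_def)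
    qed
    then show "\<exists>U. openin euclidean U \<and> \<alpha> \<in> U \<and> (\<forall>y\<in>U. h y \<in> mball (h \<alpha>) \<epsilon>)"
      by (intro exI[of _ "{\<beta>. \<forall>i\<le>k. \<beta> i = \<alpha> i}"]) (auto simp: open_cylinder)
  qed
  moreover have "x \<in> range h" if x: "x \<in> M" for x
  proof -
    \<comment> \<open>With the factor 1/4 two consecutive errors add up to less than
      \<open>(1/2)^k\<close>, the length up to which step \<open>k\<close> obeys the code.\<close>
    have "\<forall>k. \<exists>i. d (a i) x < (1/2)^k / 4" by (intro allI dense x) simp
    then obtain \<alpha> where \<alpha>: "\<And>k. d (a (\<alpha> k)) x < (1/2)^k / 4" by metis
    have eq: "?c \<alpha> k = a (\<alpha> k)" for k
    proof (induction k)
      case (Suc k)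
      have "d (a (\<alpha> (Suc k))) (a (\<alpha> k)) \<le> d (a (\<alpha> (Suc k))) x + d (a (\<alpha> k)) x"
        using triangle[of "a (\<alpha> (Suc k))" x "a (\<alpha> k)"] a x commute by metis
      also have "\<dots> < (1/2)^k" using \<alpha>[of k] \<alpha>[of "Suc k"] by (simp add: field_simps)
      finally show ?case using Suc by simp
    qed simp
    have "d (h \<alpha>) x < \<epsilon>" if "\<epsilon> > 0" for \<epsilon>
    proof -
      obtain k where k: "2 * (1/2)^k < \<epsilon>/2" using small[of "\<epsilon>/2"] \<open>\<epsilon> > 0\<close> by auto
      have "d (h \<alpha>) x \<le> d (h \<alpha>) (?c \<alpha> k) + d (?c \<alpha> k) x"
        using triangle[of "h \<alpha>" "?c \<alpha> k" x] c hM x by metis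
      then show ?thesis
        using hd[of \<alpha> k] \<alpha>[of k, folded eq] k zero_le_power[of "1/2::real" k] by linarith
    qed
    then have "d (h \<alpha>) x = 0" using nonneg[of "h \<alpha>" x] by (metis less_irrefl order_le_less)
    then show ?thesis using hM x by (metis zero rangeI)
  qed
  ultimately show ?thesis using that[of h] hM top by blast
qed

lemma completely_metrizable_space_baire: "completely_metrizable_space (euclidean :: (nat \<Rightarrow> nat) topology)"
proof -
  have "completely_metrizable_space (euclidean :: nat topology)"
  proof -
    have "discrete_topology UNIV = (euclidean :: nat topology)"
      by (simp add: discrete_topology_unique open_discrete)
    then show ?thesis using completely_metrizable_space_discrete_topology[of "UNIV::nat set"] by simp
  qed
  then show ?thesis
    by (simp add: completely_metrizable_space_product_topology flip: euclidean_product_topology)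
qed

text \<open>A closed set of codes is itself Polish. Each later construction can thus single out its
  codes by closed conditions and return to the full Baire space as domain.\<close>

lemma closed_continuous_image_baire:
  fixes Z :: "(nat \<Rightarrow> nat) set"
  assumes "closed Z" "Z \<noteq> {}"
  obtains h :: "(nat \<Rightarrow> nat) \<Rightarrow> (nat \<Rightarrow> nat)" where "continuous_on UNIV h" "range h = Z"
proof -
  have 1: "completely_metrizable_space (top_of_set Z)"
    by (intro completely_metrizable_space_closedin completely_metrizable_space_baire)
       (use assms in auto)
  have "second_countable (euclidean :: (nat \<Rightarrow> nat) topology)"
  proof -
    obtain \<B> :: "(nat \<Rightarrow> nat) set set" where "countable \<B>" "\<And>C. C \<in> \<B> \<Longrightarrow> open C"
      "\<And>S. open S \<Longrightarrow> \<exists>U. U \<subseteq> \<B> \<and> S = \<Union>U"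
      by (rule univ_second_countable) blast
    then show ?thesis unfolding second_countable_def open_openin[symmetric]
      by (intro exI[of _ \<B>]) blast
  qed
  then have "separable_space (top_of_set Z)"
    by (intro second_countable_imp_separable_space second_countable_subtopology)
  moreover have "topspace (top_of_set Z) \<noteq> {}" using assms(2) by simp
  ultimately obtain h :: "(nat \<Rightarrow> nat) \<Rightarrow> (nat \<Rightarrow> nat)"
    where "continuous_map euclidean (top_of_set Z) h" "range h = topspace (top_of_set Z)"
    by (rule polish_continuous_image_baire[OF 1])
  then show ?thesis using that[of h] by (auto simp: continuous_map_in_subtopology)
qed

text \<open>Digit 0 belongs to no row: the shift by \<open>Suc\<close> reserves it as a tag beside
  the countably many sequences stored in one.\<close>

definition row :: "nat \<Rightarrow> (nat \<Rightarrow> nat) \<Rightarrow> nat \<Rightarrow> nat" where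
  "row k \<beta> = (\<lambda>n. \<beta> (Suc (prod_encode (k, n))))"

lemma continuous_on_row [continuous_intros]: "continuous_on UNIV (row k)"
  unfolding row_def
  by (intro continuous_on_coordinatewise_then_product continuous_on_product_coordinates)

definition with_rows :: "nat \<Rightarrow> (nat \<Rightarrow> nat \<Rightarrow> nat) \<Rightarrow> nat \<Rightarrow> nat" where
  "with_rows i \<gamma> = (\<lambda>m. case m of 0 \<Rightarrow> i | Suc j \<Rightarrow> case_prod \<gamma> (prod_decode j))"

lemma with_rows_simps [simp]: "with_rows i \<gamma> 0 = i" "row k (with_rows i \<gamma>) = \<gamma> k"
  by (simp_all add: with_rows_def row_def)

section \<open>Making Borel sets clopen by a continuous recoding\<close>

definition clopen :: "'a::topological_space set \<Rightarrow> bool" where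
  "clopen A \<longleftrightarrow> open A \<and> closed A"

lemma clopen_intros:
  "clopen A \<Longrightarrow> clopen (- A)"
  "clopen A \<Longrightarrow> clopen B \<Longrightarrow> clopen (A \<inter> B)"
  "clopen A \<Longrightarrow> clopen B \<Longrightarrow> clopen (A \<union> B)"
  by (auto simp: clopen_def)

lemma clopen_vimage: "clopen A \<Longrightarrow> continuous_on UNIV h \<Longrightarrow> clopen (h -` A)"
  by (simp add: clopen_def open_vimage closed_vimage)

lemma clopen_vimage_coordinate: "clopen ((\<lambda>\<beta>::nat \<Rightarrow> nat. \<beta> i) -` A)"
  unfolding clopen_def closed_def vimage_Compl[symmetric] by (intro conjI open_vimage_coordinate)

text \<open>This stands in for the refinement of a Polish topology that turns a Borel set into a
  clopen one: the topology stays, and a continuous surjection of the Baire space onto itself takes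
  over the role of the finer topology.\<close>

definition clopenable :: "(nat \<Rightarrow> nat) set \<Rightarrow> bool" where
  "clopenable C \<longleftrightarrow>
     (\<exists>h :: (nat \<Rightarrow> nat) \<Rightarrow> (nat \<Rightarrow> nat). continuous_on UNIV h \<and> range h = UNIV \<and> clopen (h -` C))"

text \<open>These codes form the fibre product of all the maps \<open>h k\<close>: every row names
  the same point. Equality of two sequences is a closed condition on each coordinate.\<close>

lemma closed_consistent_rows:
  fixes h :: "nat \<Rightarrow> (nat \<Rightarrow> nat) \<Rightarrow> (nat \<Rightarrow> nat)"
  assumes "\<And>k. continuous_on UNIV (h k)"
  shows "closed {\<beta>. \<forall>k. h k (row k \<beta>) = h 0 (row 0 \<beta>)}"
proof -
  have "continuous_on UNIV (\<lambda>\<beta>. h k (row k \<beta>) n)" for k n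
    by (rule continuous_on_product_then_coordinatewise)
       (rule continuous_on_compose2[OF assms continuous_on_row subset_UNIV])
  then have "closed {\<beta>. h k (row k \<beta>) n = h 0 (row 0 \<beta>) n}" for k n
    by (intro closed_Collect_eq)
  then have "closed (\<Inter>k n. {\<beta>. h k (row k \<beta>) n = h 0 (row 0 \<beta>) n})"
    by (intro closed_INT ballI)
  also have "(\<Inter>k n. {\<beta>. h k (row k \<beta>) n = h 0 (row 0 \<beta>) n}) = {\<beta>. \<forall>k. h k (row k \<beta>) = h 0 (row 0 \<beta>)}"
    by (auto simp: fun_eq_iff)
  finally show ?thesis .
qed

text \<open>A point of the union is coded with the index of a set containing it, and a point outside with
  the index 0, so that the code decides membership.\<close>

lemma clopenable_UN:
  assumes "\<And>k::nat. clopenable (C k)"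
  shows "clopenable (\<Union>k. C k)"
proof -
  obtain h :: "nat \<Rightarrow> (nat \<Rightarrow> nat) \<Rightarrow> (nat \<Rightarrow> nat)"
    where cont: "\<And>k. continuous_on UNIV (h k)" and surj: "\<And>k. range (h k) = UNIV"
      and cl: "\<And>k. clopen (h k -` C k)"
    using assms unfolding clopenable_def by metis
  define Z where "Z = {\<beta>. \<forall>k. h k (row k \<beta>) = h 0 (row 0 \<beta>)} \<inter>
     (\<Inter>k. {\<beta>. \<beta> 0 = 0 \<longrightarrow> h k (row k \<beta>) \<notin> C k} \<inter> {\<beta>. \<beta> 0 = Suc k \<longrightarrow> h k (row k \<beta>) \<in> C k})"
  have cr: "clopen {\<beta>. h k (row k \<beta>) \<in> C k}" for k
    using clopen_vimage[OF cl[of k] continuous_on_row[of k]] by (simp add: vimage_def)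
  have ci: "clopen {\<beta>::nat\<Rightarrow>nat. \<beta> 0 = i}" for i
    using clopen_vimage_coordinate[of 0 "{i}"] by (simp add: vimage_def)
  have "{\<beta>. \<beta> 0 = 0 \<longrightarrow> h k (row k \<beta>) \<notin> C k} = - {\<beta>. \<beta> 0 = 0} \<union> - {\<beta>. h k (row k \<beta>) \<in> C k}"
    "{\<beta>. \<beta> 0 = Suc k \<longrightarrow> h k (row k \<beta>) \<in> C k} = - {\<beta>. \<beta> 0 = Suc k} \<union> {\<beta>. h k (row k \<beta>) \<in> C k}" for k
    by auto
  then have "clopen {\<beta>. \<beta> 0 = 0 \<longrightarrow> h k (row k \<beta>) \<notin> C k}"
      "clopen {\<beta>. \<beta> 0 = Suc k \<longrightarrow> h k (row k \<beta>) \<in> C k}" for k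
    using clopen_intros(3)[OF clopen_intros(1)[OF ci[of 0]] clopen_intros(1)[OF cr[of k]]]
      clopen_intros(3)[OF clopen_intros(1)[OF ci[of "Suc k"]] cr[of k]]
    by simp_all
  then have "closed Z" unfolding Z_def
    by (intro closed_Int closed_INT closed_consistent_rows cont ballI) (auto simp: clopen_def)
  have code: "\<exists>\<beta>\<in>Z. h 0 (row 0 \<beta>) = x" for x
  proof -
    have "\<forall>k. \<exists>y. h k y = x"
    proof
      fix k
      have "x \<in> range (h k)" by (simp add: surj)
      then show "\<exists>y. h k y = x" by auto
    qed
    then obtain \<gamma> where \<gamma>: "\<And>k. h k (\<gamma> k) = x" by metis
    obtain i where "(i = 0 \<longrightarrow> (\<forall>k. x \<notin> C k)) \<and> (\<forall>k. i = Suc k \<longrightarrow> x \<in> C k)"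
      by (cases "\<exists>k. x \<in> C k") auto
    then have "with_rows i \<gamma> \<in> Z" by (simp add: Z_def \<gamma>)
    then show ?thesis using \<gamma> by (metis with_rows_simps(2))
  qed
  then have "Z \<noteq> {}" by blast
  then obtain g :: "(nat \<Rightarrow> nat) \<Rightarrow> (nat \<Rightarrow> nat)" where g: "continuous_on UNIV g" "range g = Z"
    by (rule closed_continuous_image_baire[OF \<open>closed Z\<close>])
  let ?f = "\<lambda>\<beta>. h 0 (row 0 (g \<beta>))"
  have "continuous_on UNIV ?f"
    by (intro continuous_on_compose2[OF cont] continuous_on_compose2[OF continuous_on_row] g) auto
  moreover have "range ?f = UNIV"
  proof -
    have "x \<in> range ?f" for x
    proof -
      obtain \<gamma> where "h 0 (row 0 (g \<gamma>)) = x" using code[of x] g(2) by blast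
      then show ?thesis by (intro image_eqI[of _ _ \<gamma>]) auto
    qed
    then show ?thesis by blast
  qed
  moreover have "?f -` (\<Union>k. C k) = g -` (- {\<beta>. \<beta> 0 = 0})"
  proof -
    have "h 0 (row 0 \<beta>) \<in> (\<Union>k. C k) \<longleftrightarrow> \<beta> 0 \<noteq> 0" if "\<beta> \<in> Z" for \<beta>
    proof (cases "\<beta> 0")
      case 0
      have "h 0 (row 0 \<beta>) \<notin> C k" for k
      proof -
        have "h k (row k \<beta>) \<notin> C k" "h k (row k \<beta>) = h 0 (row 0 \<beta>)" using that 0 unfolding Z_def by blast+
        then show ?thesis by simp
      qed
      then show ?thesis using 0 by blast
    next
      case (Suc j)
      have "h j (row j \<beta>) \<in> C j" "h j (row j \<beta>) = h 0 (row 0 \<beta>)" using that Suc unfolding Z_def by blast+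
      then show ?thesis using Suc by auto
    qed
    then show ?thesis using g(2) by blast
  qed
  ultimately show ?thesis
    unfolding clopenable_def using clopen_vimage[OF clopen_intros(1)[OF ci[of 0]] g(1)]
    by (intro exI[of _ ?f]) simp
qed

text \<open>Induction over the generation of the \<sigma>-algebra from conditions on a single
  coordinate, which are clopen from the start. Complements keep their map; only unions require a new
  code.\<close>

lemma clopenable_borel:
  assumes "C \<in> sets (borel :: (nat \<Rightarrow> nat) measure)"
  shows "clopenable C"
proof -
  have clopen: "clopenable C" if "clopen C" for C
    unfolding clopenable_def by (rule exI[of _ id]) (use that in \<open>auto simp: continuous_on_id\<close>)
  have compl: "clopenable (- C)" if C: "clopenable C" for C
    using C clopen_intros(1) unfolding clopenable_def by (metis vimage_Compl)
  have "C \<in> sets (\<Pi>\<^sub>M i\<in>(UNIV::nat set). (borel :: nat measure))"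
    using assms by (simp add: sets_PiM_equal_borel)
  then have "C \<in> sigma_sets UNIV {{f. f i \<in> A} | i A. i \<in> (UNIV::nat set) \<and> A \<in> sets (borel::nat measure)}"
    by (simp add: sets_PiM_single PiE_UNIV_domain)
  then show ?thesis
  proof induction
    case (Basic C)
    then show ?case using clopen_vimage_coordinate by (auto intro!: clopen simp: vimage_def)
  next
    case Empty
    show ?case by (rule clopen) (simp add: clopen_def)
  next
    case (Compl C)
    then show ?case using compl by (simp flip: Compl_eq_Diff_UNIV)
  next
    case (Union C)
    then show ?case by (intro clopenable_UN) auto
  qed
qed

text \<open>Row \<open>k\<close> of a consistent code decides membership in \<open>C k\<close>, so a
  single map treats the whole sequence. Digit 0 is left unconstrained here.\<close>

lemma clopenable_sequence:
  assumes "\<And>k::nat. C k \<in> sets (borel :: (nat \<Rightarrow> nat) measure)"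
  shows "\<exists>h :: (nat \<Rightarrow> nat) \<Rightarrow> (nat \<Rightarrow> nat).
    continuous_on UNIV h \<and> range h = UNIV \<and> (\<forall>k. clopen (h -` C k))"
proof -
  obtain h :: "nat \<Rightarrow> (nat \<Rightarrow> nat) \<Rightarrow> (nat \<Rightarrow> nat)"
    where cont: "\<And>k. continuous_on UNIV (h k)" and surj: "\<And>k. range (h k) = UNIV"
      and cl: "\<And>k. clopen (h k -` C k)"
    using clopenable_borel[OF assms] unfolding clopenable_def by metis
  define Z where "Z = {\<beta>. \<forall>k. h k (row k \<beta>) = h 0 (row 0 \<beta>)}"
  have "closed Z" unfolding Z_def by (intro closed_consistent_rows cont)
  have code: "\<exists>\<beta>\<in>Z. h 0 (row 0 \<beta>) = x" for x
  proof -
    have "\<forall>k. \<exists>y. h k y = x"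
    proof
      fix k
      have "x \<in> range (h k)" by (simp add: surj)
      then show "\<exists>y. h k y = x" by auto
    qed
    then obtain \<gamma> where \<gamma>: "\<And>k. h k (\<gamma> k) = x" by metis
    then have "with_rows 0 \<gamma> \<in> Z" by (simp add: Z_def)
    then show ?thesis using \<gamma> by (metis with_rows_simps(2))
  qed
  then have "Z \<noteq> {}" by blast
  then obtain g :: "(nat \<Rightarrow> nat) \<Rightarrow> (nat \<Rightarrow> nat)" where g: "continuous_on UNIV g" "range g = Z"
    by (rule closed_continuous_image_baire[OF \<open>closed Z\<close>])
  let ?f = "\<lambda>\<beta>. h 0 (row 0 (g \<beta>))"
  have "continuous_on UNIV ?f"
    by (intro continuous_on_compose2[OF cont] continuous_on_compose2[OF continuous_on_row] g) auto
  moreover have "range ?f = UNIV"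
  proof -
    have "x \<in> range ?f" for x
    proof -
      obtain \<gamma> where "h 0 (row 0 (g \<gamma>)) = x" using code[of x] g(2) by blast
      then show ?thesis by (intro image_eqI[of _ _ \<gamma>]) auto
    qed
    then show ?thesis by blast
  qed
  moreover have "clopen (?f -` C k)" for k
  proof -
    have "?f -` C k = (\<lambda>\<beta>. row k (g \<beta>)) -` (h k -` C k)"
    proof -
      have "h k (row k (g \<beta>)) = h 0 (row 0 (g \<beta>))" for \<beta>
      proof -
        have "g \<beta> \<in> Z" using g(2) by blast
        then show ?thesis by (simp add: Z_def)
      qed
      then show ?thesis by auto
    qed
    moreover have "continuous_on UNIV (\<lambda>\<beta>. row k (g \<beta>))"
      by (intro continuous_on_compose2[OF continuous_on_row] g) auto
    ultimately show ?thesis using clopen_vimage[OF cl] by metis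
  qed
  ultimately show ?thesis by (intro exI[of _ ?f]) simp
qed

subsection \<open>Analytic sets and the separation theorems\<close>

text \<open>Instead of continuous images for a fixed Polish topology, analytic sets are images of the Baire
  space under maps for which any prescribed sequence of measurable sets has clopen preimages.
  No topology on the ambient space is needed.\<close>

definition analytic_in :: "'a measure \<Rightarrow> 'a set \<Rightarrow> bool" where
  "analytic_in N A \<longleftrightarrow> A \<subseteq> space N \<and>
     (A \<noteq> {} \<longrightarrow> (\<forall>E :: nat \<Rightarrow> 'a set. (\<forall>k. E k \<in> sets N) \<longrightarrow>
        (\<exists>h :: (nat \<Rightarrow> nat) \<Rightarrow> 'a. range h = A \<and> (\<forall>k. clopen (h -` E k)))))"

lemma analytic_in_empty [simp]: "analytic_in N {}"
  by (simp add: analytic_in_def)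

lemma analytic_in_subset: "analytic_in N A \<Longrightarrow> A \<subseteq> space N"
  by (simp add: analytic_in_def)

lemma analytic_inI:
  assumes "A \<subseteq> space N"
    and "\<And>E :: nat \<Rightarrow> 'a set. A \<noteq> {} \<Longrightarrow> (\<And>k. E k \<in> sets N) \<Longrightarrow>
      \<exists>h :: (nat \<Rightarrow> nat) \<Rightarrow> 'a. range h = A \<and> (\<forall>k. clopen (h -` E k))"
  shows "analytic_in N A"
  using assms by (simp add: analytic_in_def)

lemma analytic_inD:
  fixes E :: "nat \<Rightarrow> 'a set"
  assumes "analytic_in N A" "A \<noteq> {}" "\<And>k. E k \<in> sets N"
  shows "\<exists>h :: (nat \<Rightarrow> nat) \<Rightarrow> 'a. range h = A \<and> (\<forall>k. clopen (h -` E k))"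
  using assms unfolding analytic_in_def by blast

lemma space_borel_sigma [simp]: "space (borel_sigma T) = topspace T"
  by (simp add: borel_sigma_def space_measure_of_conv)

lemma sets_borel_sigma: "sets (borel_sigma T) = sigma_sets (topspace T) {U. openin T U}"
  unfolding borel_sigma_def by (rule sets_measure_of) (auto dest: openin_subset)

lemma measurable_continuous_map_borel_sigma:
  assumes "continuous_map euclidean T q"
  shows "q \<in> borel \<rightarrow>\<^sub>M borel_sigma T"
proof (rule measurable_sigma_sets[OF sets_borel_sigma])
  show "{U. openin T U} \<subseteq> Pow (topspace T)" by (auto dest: openin_subset)
  show "q \<in> space borel \<rightarrow> topspace T" using assms by (auto simp: continuous_map_def)
  fix U assume "U \<in> {U. openin T U}"
  then have "open (q -` U)"
    using openin_continuous_map_preimage[OF assms, of U] by (simp add: vimage_def)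
  then show "q -` U \<inter> space borel \<in> sets borel" by simp
qed

text \<open>A parametrization of the Polish space pulls all sets involved back to Borel sets of
  codes. Once these are made clopen simultaneously, the codes of points of \<open>D\<close> form a
  closed set, and that set can be parametrized again.\<close>

lemma standard_borel_imp_analytic_in:
  assumes "standard_borel S" "D \<in> sets S"
  shows "analytic_in S D"
proof (rule analytic_inI)
  show "D \<subseteq> space S" using assms(2) by (rule sets.sets_into_space)
next
  fix E :: "nat \<Rightarrow> 'a set"
  assume "D \<noteq> {}" and E: "\<And>k. E k \<in> sets S"
  obtain T :: "real topology" and B u w where T: "polish_topology T" and B: "B \<in> sets (borel_sigma T)"
    and u: "u \<in> S \<rightarrow>\<^sub>M restrict_space (borel_sigma T) B"
    and w: "w \<in> restrict_space (borel_sigma T) B \<rightarrow>\<^sub>M S"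
    and wu: "\<And>x. x \<in> space S \<Longrightarrow> w (u x) = x"
    using assms(1) unfolding standard_borel_def measurable_isomorphic_def by metis
  let ?R = "restrict_space (borel_sigma T) B"
  have uD: "u x \<in> space ?R" if "x \<in> D" for x
    using that measurable_space[OF u] sets.sets_into_space[OF assms(2)] by blast
  have "space ?R \<subseteq> topspace T" by (simp add: space_restrict_space)
  then have "topspace T \<noteq> {}" using uD \<open>D \<noteq> {}\<close> by blast
  then obtain q :: "(nat \<Rightarrow> nat) \<Rightarrow> real" where q: "continuous_map euclidean T q" "range q = topspace T"
    by (rule polish_continuous_image_baire[of T, rotated 2]) (use T in \<open>auto simp: polish_topology_def\<close>)
  note qm = measurable_continuous_map_borel_sigma[OF q(1)]
  \<comment> \<open>Index 0 carries \<open>D\<close> and index \<open>Suc j\<close> carries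
    \<open>E j\<close>. Intersecting with \<open>space ?R\<close> builds the Borel set
    \<open>B\<close> into these sets, so \<open>C 0\<close> holds exactly the codes of points of
    \<open>?R\<close> that \<open>w\<close> sends into \<open>D\<close>.\<close>
  define C where "C k = q -` (w -` (case k of 0 \<Rightarrow> D | Suc j \<Rightarrow> E j) \<inter> space ?R)" for k
  have "C k \<in> sets borel" for k
  proof -
    have "w -` (case k of 0 \<Rightarrow> D | Suc j \<Rightarrow> E j) \<inter> space ?R \<in> sets ?R"
      by (rule measurable_sets[OF w]) (auto simp: E assms(2) split: nat.split)
    then have "w -` (case k of 0 \<Rightarrow> D | Suc j \<Rightarrow> E j) \<inter> space ?R \<in> sets (borel_sigma T)"
      using B by (subst (asm) sets_restrict_space_iff) (auto simp: sets.Int_space_eq2 simp del: space_borel_sigma simp flip: space_borel_sigma)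
    from measurable_sets[OF qm this] show ?thesis by (simp add: C_def)
  qed
  from clopenable_sequence[where C = C, OF this]
  obtain f :: "(nat \<Rightarrow> nat) \<Rightarrow> (nat \<Rightarrow> nat)"
    where f: "continuous_on UNIV f" "range f = UNIV" "\<And>k. clopen (f -` C k)"
    by blast
  obtain x where x: "x \<in> D" using \<open>D \<noteq> {}\<close> by blast
  have surj: "\<exists>\<beta>. f \<beta> \<in> C 0 \<and> w (q (f \<beta>)) = x" if "x \<in> D" for x
  proof -
    have "u x \<in> range q" using uD[OF that] q(2) \<open>space ?R \<subseteq> topspace T\<close> by blast
    then obtain \<gamma> where \<gamma>: "q \<gamma> = u x" by auto
    obtain \<beta> where "f \<beta> = \<gamma>" using f(2) by (metis rangeE UNIV_I)
    moreover have "w (u x) = x" using that wu sets.sets_into_space[OF assms(2)] by blast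
    ultimately show ?thesis
      using \<gamma> that uD by (intro exI[of _ \<beta>]) (simp add: C_def)
  qed
  then have ne: "f -` C 0 \<noteq> {}" using x by blast
  have "closed (f -` C 0)" using f(3) by (simp add: clopen_def)
  then obtain r :: "(nat \<Rightarrow> nat) \<Rightarrow> (nat \<Rightarrow> nat)"
    where r: "continuous_on UNIV r" "range r = f -` C 0"
    using ne by (rule closed_continuous_image_baire)
  have rC: "f (r \<beta>) \<in> C 0" for \<beta> using r(2) by blast
  let ?h = "\<lambda>\<beta>. w (q (f (r \<beta>)))"
  have "range ?h = D"
  proof
    show "range ?h \<subseteq> D" using rC by (auto simp: C_def)
    show "D \<subseteq> range ?h"
    proof
      fix x assume "x \<in> D"
      then obtain \<beta> where \<beta>: "\<beta> \<in> range r" "w (q (f \<beta>)) = x" using surj r(2) by blast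
      then show "x \<in> range ?h" by blast
    qed
  qed
  moreover have "clopen (?h -` E k)" for k
  proof -
    have "?h -` E k = r -` (f -` C (Suc k))" using rC by (auto simp: C_def)
    then show ?thesis using clopen_vimage[OF f(3) r(1)] by simp
  qed
  ultimately show "\<exists>h :: (nat \<Rightarrow> nat) \<Rightarrow> _. range h = D \<and> (\<forall>k. clopen (h -` E k))"
    by (intro exI[of _ ?h]) simp
qed

text \<open>A sequence prescribed in \<open>N\<close> is pulled back to one prescribed in
  \<open>M\<close>; here it pays that the definition ranges over all sequences and fixes no
  topology.\<close>

lemma analytic_in_image:
  assumes "analytic_in M A" "f \<in> M \<rightarrow>\<^sub>M N"
  shows "analytic_in N (f ` A)"
proof (rule analytic_inI)
  show "f ` A \<subseteq> space N"
    using analytic_in_subset[OF assms(1)] measurable_space[OF assms(2)] by blast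
next
  fix E :: "nat \<Rightarrow> 'b set"
  assume "f ` A \<noteq> {}" and E: "\<And>k. E k \<in> sets N"
  then have "A \<noteq> {}" by blast
  obtain h :: "(nat \<Rightarrow> nat) \<Rightarrow> 'a"
    where h: "range h = A" "\<And>k. clopen (h -` (f -` E k \<inter> space M))"
    using analytic_inD[where E = "\<lambda>k. f -` E k \<inter> space M",
          OF assms(1) \<open>A \<noteq> {}\<close> measurable_sets[OF assms(2) E]] by blast
  have "h -` (f -` E k \<inter> space M) = (\<lambda>\<beta>. f (h \<beta>)) -` E k" for k
    using h(1) analytic_in_subset[OF assms(1)] by auto
  then have "clopen ((\<lambda>\<beta>. f (h \<beta>)) -` E k)" for k using h(2)[of k] by simp
  moreover have "range (\<lambda>\<beta>. f (h \<beta>)) = f ` A" using h(1) by auto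
  ultimately show "\<exists>h :: (nat \<Rightarrow> nat) \<Rightarrow> _. range h = f ` A \<and> (\<forall>k. clopen (h -` E k))"
    by (intro exI[of _ "\<lambda>\<beta>. f (h \<beta>)"]) simp
qed

text \<open>Digit 0 selects one of the two parametrizations and row 0 is handed to it.\<close>

lemma analytic_in_Un:
  assumes "analytic_in N A" "analytic_in N B"
  shows "analytic_in N (A \<union> B)"
proof (cases "A = {} \<or> B = {}")
  case True
  then show ?thesis using assms by auto
next
  case False
  show ?thesis
  proof (rule analytic_inI)
    show "A \<union> B \<subseteq> space N" using assms by (simp add: analytic_in_subset)
  next
    fix E :: "nat \<Rightarrow> 'a set" assume E: "\<And>k. E k \<in> sets N"
    obtain f :: "(nat \<Rightarrow> nat) \<Rightarrow> 'a" where f: "range f = A" "\<And>k. clopen (f -` E k)"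
      using analytic_inD[where E = E, OF assms(1) _ E] False by blast
    obtain g :: "(nat \<Rightarrow> nat) \<Rightarrow> 'a" where g: "range g = B" "\<And>k. clopen (g -` E k)"
      using analytic_inD[where E = E, OF assms(2) _ E] False by blast
    let ?h = "\<lambda>\<beta>::nat \<Rightarrow> nat. if \<beta> 0 = 0 then f (row 0 \<beta>) else g (row 0 \<beta>)"
    have "f x \<in> range ?h" "g x \<in> range ?h" for x
      by (rule image_eqI[of _ _ "with_rows 0 (\<lambda>_. x)"], simp, simp)
         (rule image_eqI[of _ _ "with_rows 1 (\<lambda>_. x)"], simp, simp)
    then have "range ?h = A \<union> B" using f(1) g(1) by auto
    moreover have "clopen (?h -` E k)" for k
    proof -
      have "?h -` E k = ((\<lambda>\<beta>. \<beta> 0) -` {0} \<inter> row 0 -` (f -` E k))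
          \<union> ((\<lambda>\<beta>. \<beta> 0) -` (- {0}) \<inter> row 0 -` (g -` E k))" by (auto split: if_splits)
      then show ?thesis
        by (simp only:) (intro clopen_intros(2,3) clopen_vimage_coordinate
            clopen_vimage[OF f(2) continuous_on_row] clopen_vimage[OF g(2) continuous_on_row])
    qed
    ultimately show "\<exists>h :: (nat \<Rightarrow> nat) \<Rightarrow> _. range h = A \<union> B \<and> (\<forall>k. clopen (h -` E k))"
    by (intro exI[of _ ?h]) simp
  qed
qed

text \<open>This is the substitute for a Hausdorff topology with a countable base: distinct points
  are told apart by one set of a fixed sequence, and the preimages of such a sequence under a
  parametrization can be demanded clopen.\<close>

definition countably_separated :: "'a measure \<Rightarrow> bool" where
  "countably_separated N \<longleftrightarrow>
     (\<exists>E :: nat \<Rightarrow> 'a set. (\<forall>k. E k \<in> sets N) \<and>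
        (\<forall>x\<in>space N. \<forall>y\<in>space N. (\<forall>k. x \<in> E k \<longleftrightarrow> y \<in> E k) \<longrightarrow> x = y))"

text \<open>The fibre product of the two parametrizations is a closed set of codes, because equality in
  \<open>N\<close> is decided by clopen conditions.\<close>

lemma analytic_in_vimage:
  assumes A: "analytic_in M A" and Q: "analytic_in N Q" and f: "f \<in> M \<rightarrow>\<^sub>M N"
    and N: "countably_separated N"
  shows "analytic_in M {x \<in> A. f x \<in> Q}"
proof (rule analytic_inI)
  show "{x \<in> A. f x \<in> Q} \<subseteq> space M" using analytic_in_subset[OF A] by blast
next
  fix E :: "nat \<Rightarrow> 'a set"
  assume ne: "{x \<in> A. f x \<in> Q} \<noteq> {}" and E: "\<And>k. E k \<in> sets M"
  obtain G :: "nat \<Rightarrow> 'b set" where G: "\<And>k. G k \<in> sets N" and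
    sep: "\<forall>x\<in>space N. \<forall>y\<in>space N. (\<forall>k. x \<in> G k \<longleftrightarrow> y \<in> G k) \<longrightarrow> x = y"
    using N unfolding countably_separated_def by blast
  \<comment> \<open>The parametrization of \<open>A\<close> has to respect two sequences at once,
    the given \<open>E\<close> and the pull-backs of the separating sets \<open>G\<close>; they are
    interleaved over even and odd indices.\<close>
  let ?H = "\<lambda>k. if even k then E (k div 2) else f -` G (k div 2) \<inter> space M"
  have H: "?H k \<in> sets M" for k using E measurable_sets[OF f G] by simp
  obtain a :: "(nat \<Rightarrow> nat) \<Rightarrow> 'a" where a: "range a = A" "\<And>k. clopen (a -` ?H k)"
    using analytic_inD[where E = ?H, OF A _ H] ne by blast
  have aE: "clopen (a -` E k)" for k using a(2)[of "2 * k"] by simp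
  have aG: "clopen (a -` (f -` G k \<inter> space M))" for k using a(2)[of "Suc (2 * k)"] by simp
  obtain b :: "(nat \<Rightarrow> nat) \<Rightarrow> 'b" where b: "range b = Q" "\<And>k. clopen (b -` G k)"
    using analytic_inD[where E = G, OF Q _ G] ne by blast
  have aM: "a \<beta> \<in> space M" for \<beta> using a(1) analytic_in_subset[OF A] by blast
  have bN: "b \<beta> \<in> space N" for \<beta> using b(1) analytic_in_subset[OF Q] by blast
  have fN: "f (a \<beta>) \<in> space N" for \<beta> using aM measurable_space[OF f] by blast
  define Z where "Z = {\<beta>. f (a (row 0 \<beta>)) = b (row 1 \<beta>)}"
  let ?P = "\<lambda>k. row 0 -` (a -` (f -` G k \<inter> space M))" and ?R = "\<lambda>k. row 1 -` (b -` G k)"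
  have "Z = (\<Inter>k. (?P k \<inter> ?R k) \<union> (- ?P k \<inter> - ?R k))"
  proof -
    have "f (a (row 0 \<beta>)) = b (row 1 \<beta>) \<longleftrightarrow> (\<forall>k. f (a (row 0 \<beta>)) \<in> G k \<longleftrightarrow> b (row 1 \<beta>) \<in> G k)" for \<beta>
      using sep fN bN by metis
    then show ?thesis using aM by (auto simp: Z_def)
  qed
  moreover have "clopen ((?P k \<inter> ?R k) \<union> (- ?P k \<inter> - ?R k))" for k
    by (intro clopen_intros clopen_vimage[OF aG continuous_on_row] clopen_vimage[OF b(2) continuous_on_row])
  ultimately have "closed Z" by (simp add: clopen_def closed_INT)
  have code: "\<exists>\<beta>\<in>Z. a (row 0 \<beta>) = x" if x: "x \<in> A" "f x \<in> Q" for x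
  proof -
    obtain \<gamma> \<delta> where "a \<gamma> = x" "b \<delta> = f x" using a(1) b(1) x by (metis imageE)
    then have "with_rows 0 (\<lambda>k. if k = 0 then \<gamma> else \<delta>) \<in> Z"
      "a (row 0 (with_rows 0 (\<lambda>k. if k = 0 then \<gamma> else \<delta>))) = x" by (simp_all add: Z_def)
    then show ?thesis by blast
  qed
  then have "Z \<noteq> {}" using ne by blast
  then obtain r :: "(nat \<Rightarrow> nat) \<Rightarrow> (nat \<Rightarrow> nat)" where r: "continuous_on UNIV r" "range r = Z"
    by (rule closed_continuous_image_baire[OF \<open>closed Z\<close>])
  let ?h = "\<lambda>\<beta>. a (row 0 (r \<beta>))"
  have rZ: "r \<beta> \<in> Z" for \<beta> using r(2) by blast
  have "range ?h = {x \<in> A. f x \<in> Q}"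
  proof
    have "f (?h \<beta>) \<in> Q" for \<beta>
    proof -
      have "f (?h \<beta>) = b (row 1 (r \<beta>))" using rZ[of \<beta>] by (simp add: Z_def)
      then show ?thesis using b(1) by auto
    qed
    then show "range ?h \<subseteq> {x \<in> A. f x \<in> Q}" using a(1) by blast
    show "{x \<in> A. f x \<in> Q} \<subseteq> range ?h"
    proof
      fix x assume "x \<in> {x \<in> A. f x \<in> Q}"
      then obtain \<beta> where "\<beta> \<in> range r" "a (row 0 \<beta>) = x" using code r(2) by blast
      then show "x \<in> range ?h" by blast
    qed
  qed
  moreover have "clopen (?h -` E k)" for k
  proof -
    have "?h -` E k = r -` (row 0 -` (a -` E k))" by auto
    then show ?thesis using clopen_vimage[OF clopen_vimage[OF aE continuous_on_row] r(1)] by simp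
  qed
  ultimately show "\<exists>h :: (nat \<Rightarrow> nat) \<Rightarrow> _. range h = {x \<in> A. f x \<in> Q} \<and> (\<forall>k. clopen (h -` E k))"
    by (intro exI[of _ ?h]) simp
qed

lemma open_baire_contains_cylinder:
  fixes U :: "(nat \<Rightarrow> nat) set"
  assumes "open U" "\<alpha> \<in> U"
  shows "\<exists>L. \<forall>\<gamma>. (\<forall>i<L. \<gamma> i = \<alpha> i) \<longrightarrow> \<gamma> \<in> U"
proof -
  have "openin (product_topology (\<lambda>_::nat. euclidean :: nat topology) UNIV) U"
    using assms(1) by (simp add: euclidean_product_topology)
  from product_topology_open_contains_basis[OF this assms(2)]
  obtain Y where Y: "\<alpha> \<in> (\<Pi>\<^sub>E i\<in>UNIV. Y i)" "finite {i. Y i \<noteq> UNIV}" "(\<Pi>\<^sub>E i\<in>UNIV. Y i) \<subseteq> U"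
    by (metis topspace_euclidean)
  obtain L where L: "\<And>i. Y i \<noteq> UNIV \<Longrightarrow> i < L"
    using finite_nat_set_iff_bounded[of "{i. Y i \<noteq> UNIV}"] Y(2) by auto
  have "\<gamma> \<in> U" if "\<forall>i<L. \<gamma> i = \<alpha> i" for \<gamma>
  proof -
    have "\<gamma> i \<in> Y i" for i
      using L[of i] that Y(1) by (cases "Y i = UNIV") (auto simp: PiE_iff)
    then show ?thesis using Y(3) by (auto simp: PiE_iff)
  qed
  then show ?thesis by blast
qed

section \<open>Novikov and Lusin separation\<close>

definition separated :: "'a measure \<Rightarrow> (nat \<Rightarrow> 'a set) \<Rightarrow> bool" where
  "separated N D \<longleftrightarrow> (\<exists>B. (\<forall>n. B n \<in> sets N) \<and> (\<forall>n. D n \<subseteq> B n) \<and> (\<Inter>n. B n) = {})"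

text \<open>Separating sets for all the pieces are combined by a union in position \<open>k\<close>
  and by intersections elsewhere. Read contrapositively, an inseparable sequence remains inseparable
  when one member is replaced by a suitable piece out of countably many.\<close>

lemma separated_split:
  assumes sep: "\<And>m::nat. separated N (D m)"
    and other: "\<And>m n. n \<noteq> k \<Longrightarrow> D m n = C n"
    and cover: "C k \<subseteq> (\<Union>m. D m k)"
  shows "separated N C"
proof -
  obtain B where B: "\<And>m n. B m n \<in> sets N" "\<And>m n. D m n \<subseteq> B m n" "\<And>m. (\<Inter>n. B m n) = {}"
    using sep unfolding separated_def by metis
  let ?B = "\<lambda>n. if n = k then (\<Union>m. B m k) else (\<Inter>m. B m n)"
  have "(\<Inter>n. ?B n) = {}"
  proof (rule ccontr)
    assume "(\<Inter>n. ?B n) \<noteq> {}"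
    then obtain x where x: "\<And>n. x \<in> ?B n" by blast
    obtain m where "x \<in> B m k" using x[of k] by auto
    moreover have "x \<in> B m n" if "n \<noteq> k" for n using x[of n] that by auto
    ultimately have "x \<in> (\<Inter>n. B m n)" by (metis INT_I)
    then show False using B(3) by blast
  qed
  moreover have "?B n \<in> sets N" for n using B(1) by auto
  moreover have "C n \<subseteq> ?B n" for n
  proof (cases "n = k")
    case True
    then show ?thesis using cover B(2) by fastforce
  next
    case False
    then show ?thesis using other[OF False] B(2)[of _ n] by auto
  qed
  ultimately show ?thesis unfolding separated_def by (intro exI[of _ ?B]) blast
qed

text \<open>Two members on opposite sides of one measurable set settle the whole sequence, since all
  others may be enclosed in the full space.\<close>

lemma separated_pair:
  assumes "E \<in> sets N" "n \<noteq> m" "\<And>i. D i \<subseteq> space N" "D n \<subseteq> E" "D m \<inter> E = {}"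
  shows "separated N D"
  unfolding separated_def
proof (intro exI[of _ "\<lambda>i. if i = n then E else if i = m then space N - E else space N"] conjI allI)
  show "(\<Inter>i. if i = n then E else if i = m then space N - E else space N) = {}"
  proof (rule ccontr)
    assume "(\<Inter>i. if i = n then E else if i = m then space N - E else space N) \<noteq> {}"
    then obtain x where "\<And>i. x \<in> (if i = n then E else if i = m then space N - E else space N)"
      by blast
    from this[of n] this[of m] show False using \<open>n \<noteq> m\<close> by simp
  qed
qed (use assms in auto)

text \<open>If no separation existed, then successively fixing one more digit of one of the codes while
  keeping the sets inseparable would give codes of points that a clopen condition distinguishes
  already at a finite stage.\<close>

theorem novikov_separation:
  assumes N: "countably_separated N" and A: "\<And>n::nat. analytic_in N (A n)"
    and disj: "(\<Inter>n. A n) = {}"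
  shows "separated N A"
proof (cases "\<exists>n. A n = {}")
  case True
  then obtain n where n: "A n = {}" by blast
  \<comment> \<open>An empty member has no parametrization and is treated apart; any second index
    would serve in place of \<open>Suc n\<close>.\<close>
  show ?thesis
    by (rule separated_pair[of "{}" N n "Suc n"]) (use n analytic_in_subset[OF A] in auto)
next
  case False
  obtain G :: "nat \<Rightarrow> 'a set" where G: "\<And>k. G k \<in> sets N" and
    sep: "\<forall>x\<in>space N. \<forall>y\<in>space N. (\<forall>k. x \<in> G k \<longleftrightarrow> y \<in> G k) \<longrightarrow> x = y"
    using N unfolding countably_separated_def by blast
  have "\<forall>n. \<exists>h :: (nat \<Rightarrow> nat) \<Rightarrow> 'a. range h = A n \<and> (\<forall>k. clopen (h -` G k))"
    using analytic_inD[where E = G, OF A _ G] False by blast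
  then obtain h :: "nat \<Rightarrow> (nat \<Rightarrow> nat) \<Rightarrow> 'a"
    where h: "\<And>n. range (h n) = A n" "\<And>n k. clopen (h n -` G k)" by metis
  \<comment> \<open>A single sequence \<open>\<beta>\<close> keeps the digits of all the codes:
    entry \<open>prod_encode (n, i)\<close> is digit \<open>i\<close> of the code for
    \<open>A n\<close>. At stage \<open>t\<close> the entries below \<open>t\<close> are fixed, so
    each stage fixes one more digit of one code.\<close>
  define D where "D \<beta> t n = h n ` {\<gamma>. \<forall>i. prod_encode (n, i) < t \<longrightarrow> \<gamma> i = \<beta> (prod_encode (n, i))}"
    for \<beta> :: "nat \<Rightarrow> nat" and t n
  have D_cong: "D \<beta> t = D \<beta>' t" if "\<And>i. i < t \<Longrightarrow> \<beta> i = \<beta>' i" for \<beta> \<beta>' t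
    using that by (auto simp: D_def fun_eq_iff)
  have D_space: "D \<beta> t n \<subseteq> space N" for \<beta> t n
    using h(1)[of n] analytic_in_subset[OF A, of n] by (auto simp: D_def)
  show ?thesis
  proof (rule ccontr)
    assume contra: "\<not> separated N A"
    have "\<exists>F. \<forall>t. \<not> separated N (D (F t) t) \<and> (\<exists>m. F (Suc t) = (F t)(t := m))"
    proof (rule dependent_nat_choice)
      have "D \<beta> 0 = A" for \<beta> using h(1) by (auto simp: D_def)
      then show "\<exists>\<beta>. \<not> separated N (D \<beta> 0)" using contra by auto
    next
      fix \<beta> t assume *: "\<not> separated N (D \<beta> t)"
      obtain n i where t: "t = prod_encode (n, i)" by (metis prod_decode_inverse surj_pair)
      have "\<exists>m. \<not> separated N (D (\<beta>(t := m)) (Suc t))"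
      proof (rule ccontr)
        assume "\<nexists>m. \<not> separated N (D (\<beta>(t := m)) (Suc t))"
        then have "\<And>m. separated N (D (\<beta>(t := m)) (Suc t))" by blast
        then have "separated N (D \<beta> t)"
        proof (rule separated_split[where k = n])
          fix m n' assume "n' \<noteq> n"
          then have "prod_encode (n', j) < Suc t \<longleftrightarrow> prod_encode (n', j) < t" for j
            by (auto simp: t less_Suc_eq)
          then show "D (\<beta>(t := m)) (Suc t) n' = D \<beta> t n'"
            by (auto simp: D_def)
        next
          show "D \<beta> t n \<subseteq> (\<Union>m. D (\<beta>(t := m)) (Suc t) n)"
          proof
            fix x assume "x \<in> D \<beta> t n"
            then obtain \<gamma> where \<gamma>: "x = h n \<gamma>" "\<And>j. prod_encode (n, j) < t \<Longrightarrow> \<gamma> j = \<beta> (prod_encode (n, j))"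
              by (auto simp: D_def)
            have "\<gamma> j = (\<beta>(t := \<gamma> i)) (prod_encode (n, j))" if "prod_encode (n, j) < Suc t" for j
              using that \<gamma>(2)[of j] by (auto simp: t less_Suc_eq)
            then have "x \<in> D (\<beta>(t := \<gamma> i)) (Suc t) n" using \<gamma>(1) by (auto simp: D_def)
            then show "x \<in> (\<Union>m. D (\<beta>(t := m)) (Suc t) n)" by blast
          qed
        qed
        then show False using * by blast
      qed
      then show "\<exists>\<beta>'. \<not> separated N (D \<beta>' (Suc t)) \<and> (\<exists>m. \<beta>' = \<beta>(t := m))" by blast
    qed
    then obtain F where F: "\<And>t. \<not> separated N (D (F t) t)" "\<And>t. \<exists>m. F (Suc t) = (F t)(t := m)"
      by blast
    \<comment> \<open>Entry \<open>i\<close> is written in the passage from stage \<open>i\<close>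
      to stage \<open>Suc i\<close> and never changed afterwards.\<close>
    define \<beta> where "\<beta> i = F (Suc i) i" for i
    have "F t i = \<beta> i" if "i < t" for t i
      using that
    proof (induction t)
      case (Suc t)
      obtain m where "F (Suc t) = (F t)(t := m)" using F(2) by blast
      then show ?case using Suc by (cases "i = t") (auto simp: \<beta>_def)
    qed simp
    then have insep: "\<not> separated N (D \<beta> t)" for t using F(1)[of t] D_cong by metis
    define \<alpha> where "\<alpha> n i = \<beta> (prod_encode (n, i))" for n i
    \<comment> \<open>An open condition on the limit code depends on finitely many digits, and these
      are all fixed from some stage on.\<close>
    have stage: "\<exists>t0. \<forall>t\<ge>t0. D \<beta> t n \<subseteq> E" if E: "open (h n -` E)" "h n (\<alpha> n) \<in> E" for n E
    proof -
      obtain L where L: "\<And>\<gamma>. (\<And>i. i < L \<Longrightarrow> \<gamma> i = \<alpha> n i) \<Longrightarrow> h n \<gamma> \<in> E"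
        using open_baire_contains_cylinder[OF E(1), of "\<alpha> n"] E(2) by auto
      obtain t0 where t0: "\<And>i. i < L \<Longrightarrow> prod_encode (n, i) < t0"
        using finite_nat_set_iff_bounded[of "(\<lambda>i. prod_encode (n, i)) ` {..<L}"] by auto
      have "D \<beta> t n \<subseteq> E" if "t \<ge> t0" for t
        using that t0 by (force simp: D_def \<alpha>_def intro: L)
      then show ?thesis by blast
    qed
    have "\<exists>n m. h n (\<alpha> n) \<noteq> h m (\<alpha> m)"
    proof (rule ccontr)
      assume "\<nexists>n m. h n (\<alpha> n) \<noteq> h m (\<alpha> m)"
      then have "h 0 (\<alpha> 0) = h n (\<alpha> n)" for n by blast
      then have "h 0 (\<alpha> 0) \<in> A n" for n using h(1)[of n] by (metis rangeI)
      then show False using disj by blast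
    qed
    then obtain n m where nm: "h n (\<alpha> n) \<noteq> h m (\<alpha> m)" by blast
    have inN: "h n (\<alpha> n) \<in> space N" for n using h(1) analytic_in_subset[OF A] by blast
    obtain k where "(h n (\<alpha> n) \<in> G k) \<noteq> (h m (\<alpha> m) \<in> G k)" using sep inN nm by metis
    then obtain n m where nm: "h n (\<alpha> n) \<in> G k" "h m (\<alpha> m) \<in> - G k" by blast
    have op: "open (h n -` G k)" "open (h m -` (- G k))"
      using h(2) by (auto simp: clopen_def vimage_Compl)
    obtain t1 t2 where "\<forall>t\<ge>t1. D \<beta> t n \<subseteq> G k" "\<forall>t\<ge>t2. D \<beta> t m \<subseteq> - G k"
      using stage[OF op(1) nm(1)] stage[OF op(2) nm(2)] by blast
    then have "D \<beta> (max t1 t2) n \<subseteq> G k" "D \<beta> (max t1 t2) m \<inter> G k = {}"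
      by (meson max.cobounded1 max.cobounded2 disjoint_eq_subset_Compl)+
    then have "separated N (D \<beta> (max t1 t2))"
      using nm by (intro separated_pair[OF G[of k]] D_space) auto
    then show False using insep by blast
  qed
qed

text \<open>Novikov's theorem is applied to the sequence \<open>A\<close>, \<open>B\<close>,
  \<open>B\<close>, and so on. A point of \<open>B\<close> in \<open>D 0\<close> would lie in every
  \<open>D n\<close>.\<close>

corollary lusin_separation:
  assumes "countably_separated N" "analytic_in N A" "analytic_in N B" "A \<inter> B = {}"
  obtains C where "C \<in> sets N" "A \<subseteq> C" "B \<inter> C = {}"
proof -
  have "separated N (\<lambda>n. if n = 0 then A else B)"
  proof (rule novikov_separation[OF assms(1)])
    have "x \<notin> (\<Inter>n::nat. if n = 0 then A else B)" for x
    proof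
      assume "x \<in> (\<Inter>n::nat. if n = 0 then A else B)"
      then have "x \<in> (if n = 0 then A else B)" for n :: nat by blast
      from this[of 0] this[of 1] show False using assms(4) by auto
    qed
    then show "(\<Inter>n::nat. if n = 0 then A else B) = {}" by blast
  qed (use assms in auto)
  then obtain D where D: "\<And>n::nat. D n \<in> sets N" "\<And>n. (if n = 0 then A else B) \<subseteq> D n" "(\<Inter>n. D n) = {}"
    unfolding separated_def by blast
  have "A \<subseteq> D 0" using D(2)[of 0] by simp
  moreover have "B \<inter> D 0 = {}"
  proof (rule ccontr)
    assume "B \<inter> D 0 \<noteq> {}"
    then obtain x where x: "x \<in> B" "x \<in> D 0" by blast
    have "x \<in> D n" for n using D(2)[of n] x by (cases "n = 0") auto
    then show False using D(3) by blast
  qed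
  ultimately show ?thesis using that D(1) by blast
qed

section \<open>Countably separated spaces and injective Borel maps\<close>

lemma countably_separated_polish:
  assumes "polish_topology T"
  shows "countably_separated (borel_sigma T)"
proof -
  obtain M d where "Metric_space M d" and T: "T = Metric_space.mtopology M d"
    using assms unfolding polish_topology_def completely_metrizable_space_def by blast
  interpret Metric_space M d by fact
  obtain C where C: "countable C" "C \<subseteq> M" "Abstract_Topology.closure_of mtopology C = M"
    using assms unfolding polish_topology_def separable_space_def T by auto
  define a where "a = from_nat_into C"
  define E where "E k = (case prod_decode k of (i, j) \<Rightarrow> mball (a i) (1 / real (Suc j)))" for k
  have "E k \<in> sets (borel_sigma T)" for k
    by (auto simp: E_def sets_borel_sigma T openin_mball intro!: sigma_sets.Basic split: prod.split)
  moreover have "x = y" if xy: "x \<in> M" "y \<in> M" and eq: "\<And>k. x \<in> E k \<longleftrightarrow> y \<in> E k" for x y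
  proof (rule ccontr)
    assume "x \<noteq> y"
    then have "d x y > 0" using xy by (simp add: mdist_pos_less)
    then obtain j where j: "1 / real (Suc j) < d x y / 2"
      using nat_approx_posE[of "d x y / 2"] by auto
    have "\<forall>r>0. \<exists>y\<in>C. y \<in> mball x r" using C(3) xy(1) unfolding metric_closure_of by blast
    moreover have "1 / real (Suc j) > 0" by simp
    ultimately obtain z where "z \<in> C" "z \<in> mball x (1 / real (Suc j))" by blast
    then have z: "z \<in> C" "d x z < 1 / real (Suc j)" by simp_all
    obtain i where i: "a i = z" using from_nat_into_surj[OF C(1) z(1)] by (auto simp: a_def)
    have zM: "z \<in> M" using z C(2) by blast
    have "x \<in> E (prod_encode (i, j))" using z zM xy i by (simp add: E_def commute)
    then have "y \<in> E (prod_encode (i, j))" using eq by simp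
    then have "d z y < 1 / real (Suc j)" by (simp add: E_def i)
    then show False using z(2) j triangle[OF xy(1) zM xy(2)] by linarith
  qed
  ultimately show ?thesis
    unfolding countably_separated_def by (intro exI[of _ E]) (auto simp: T)
qed

lemma countably_separated_vimage:
  assumes "countably_separated N" "f \<in> M \<rightarrow>\<^sub>M N" "inj_on f (space M)"
  shows "countably_separated M"
proof -
  obtain G :: "nat \<Rightarrow> 'a set" where G: "\<And>k. G k \<in> sets N" and
    sep: "\<forall>x\<in>space N. \<forall>y\<in>space N. (\<forall>k. x \<in> G k \<longleftrightarrow> y \<in> G k) \<longrightarrow> x = y"
    using assms(1) unfolding countably_separated_def by blast
  have "x = y" if "x \<in> space M" "y \<in> space M"
    "\<forall>k. x \<in> f -` G k \<inter> space M \<longleftrightarrow> y \<in> f -` G k \<inter> space M" for x y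
  proof -
    have "f x = f y" using sep measurable_space[OF assms(2)] that by auto
    then show ?thesis using assms(3) that by (simp add: inj_on_def)
  qed
  then show ?thesis
    unfolding countably_separated_def using measurable_sets[OF assms(2) G]
    by (intro exI[of _ "\<lambda>k. f -` G k \<inter> space M"]) blast
qed

lemma standard_borel_imp_countably_separated:
  assumes "standard_borel M"
  shows "countably_separated M"
proof -
  obtain T :: "real topology" and B u w where T: "polish_topology T"
    and u: "u \<in> M \<rightarrow>\<^sub>M restrict_space (borel_sigma T) B"
    and wu: "\<And>x. x \<in> space M \<Longrightarrow> w (u x) = x"
    using assms unfolding standard_borel_def measurable_isomorphic_def by metis
  have "u \<in> M \<rightarrow>\<^sub>M borel_sigma T" using u by (simp add: measurable_restrict_space2_iff)
  moreover have "inj_on u (space M)" using wu by (metis inj_onI)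
  ultimately show ?thesis using countably_separated_vimage countably_separated_polish[OF T] by blast
qed

lemma countably_separated_borel:
  "countably_separated (borel :: 'a::{second_countable_topology, t2_space} measure)"
proof -
  obtain \<B> :: "'a set set" where \<B>: "countable \<B>" "\<And>C. C \<in> \<B> \<Longrightarrow> open C"
    "\<And>S. open S \<Longrightarrow> \<exists>U. U \<subseteq> \<B> \<and> S = \<Union>U"
    by (rule univ_second_countable) blast
  define B where "B = from_nat_into (insert UNIV \<B>)"
  have range: "range B = insert UNIV \<B>"
    unfolding B_def using \<B>(1) by (intro range_from_nat_into) auto
  have B: "open (B k)" for k
  proof -
    have "B k \<in> insert UNIV \<B>" using range by blast
    then show ?thesis using \<B>(2) by auto
  qed
  have "x = y" if "\<forall>k. x \<in> B k \<longleftrightarrow> y \<in> B k" for x y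
  proof (rule ccontr)
    assume "x \<noteq> y"
    then obtain U where U: "open U" "x \<in> U" "y \<notin> U" by (meson t1_space)
    obtain \<U> where \<U>: "\<U> \<subseteq> \<B>" "U = \<Union>\<U>" using \<B>(3)[OF U(1)] by blast
    then obtain C where C: "C \<in> \<U>" "x \<in> C" using U(2) by blast
    then have "C \<in> range B" using \<U>(1) range by blast
    then have "y \<in> C" using C(2) that by blast
    then show False using C(1) \<U>(2) U(3) by blast
  qed
  then show ?thesis unfolding countably_separated_def using B by (intro exI[of _ B]) auto
qed

lemma countably_separated_pair:
  assumes "countably_separated M" "countably_separated N"
  shows "countably_separated (M \<Otimes>\<^sub>M N)"
proof -
  obtain E :: "nat \<Rightarrow> 'a set" where E: "\<And>k. E k \<in> sets M" and
    sepE: "\<forall>x\<in>space M. \<forall>y\<in>space M. (\<forall>k. x \<in> E k \<longleftrightarrow> y \<in> E k) \<longrightarrow> x = y"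
    using assms(1) unfolding countably_separated_def by blast
  obtain G :: "nat \<Rightarrow> 'b set" where G: "\<And>k. G k \<in> sets N" and
    sepG: "\<forall>x\<in>space N. \<forall>y\<in>space N. (\<forall>k. x \<in> G k \<longleftrightarrow> y \<in> G k) \<longrightarrow> x = y"
    using assms(2) unfolding countably_separated_def by blast
  define H where "H k = (if even k then E (k div 2) \<times> space N else space M \<times> G (k div 2))" for k
  have "H k \<in> sets (M \<Otimes>\<^sub>M N)" for k using E G by (auto simp: H_def)
  moreover have "p = q" if p: "p \<in> space (M \<Otimes>\<^sub>M N)" and q: "q \<in> space (M \<Otimes>\<^sub>M N)"
    and eq: "\<forall>k. p \<in> H k \<longleftrightarrow> q \<in> H k" for p q
  proof -
    have "fst p \<in> E k \<longleftrightarrow> fst q \<in> E k" for k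
      using eq[rule_format, of "2 * k"] p q by (auto simp: H_def space_pair_measure)
    moreover have "snd p \<in> G k \<longleftrightarrow> snd q \<in> G k" for k
      using eq[rule_format, of "Suc (2 * k)"] p q by (auto simp: H_def space_pair_measure)
    moreover have "fst p \<in> space M" "fst q \<in> space M" "snd p \<in> space N" "snd q \<in> space N"
      using p q by (auto simp: space_pair_measure)
    ultimately have "fst p = fst q" "snd p = snd q"
      using sepE sepG by blast+
    then show ?thesis by (simp add: prod_eq_iff)
  qed
  ultimately show ?thesis unfolding countably_separated_def by (intro exI[of _ H]) blast
qed

text \<open>By injectivity the images of \<open>C\<close> and of its complement are disjoint
  analytic sets, and the preimage of a measurable set between them is \<open>C\<close>. So an
  injective measurable map generates the Borel structure of a standard Borel space.\<close>

lemma injective_measurable_vimage: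
  assumes M: "standard_borel M" and N: "countably_separated N"
    and e: "e \<in> M \<rightarrow>\<^sub>M N" "inj_on e (space M)" and C: "C \<in> sets M"
  obtains D where "D \<in> sets N" "C = e -` D \<inter> space M"
proof -
  have CM: "C \<subseteq> space M" using C by (rule sets.sets_into_space)
  have "analytic_in N (e ` C)" "analytic_in N (e ` (space M - C))"
    by (intro analytic_in_image[OF standard_borel_imp_analytic_in[OF M] e(1)] C sets.compl_sets)+
  moreover have "e ` C \<inter> e ` (space M - C) = {}" using e(2) CM by (auto simp: inj_on_def)
  ultimately obtain D where D: "D \<in> sets N" "e ` C \<subseteq> D" "e ` (space M - C) \<inter> D = {}"
    by (rule lusin_separation[OF N])
  have "C = e -` D \<inter> space M" using D CM by blast
  with D(1) show ?thesis by (rule that)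
qed

text \<open>This reduces the measurability of a section to that of countably many real functions,
  which is how limits of sections are handled below.\<close>

lemma measurable_into_standard_borel:
  assumes M: "standard_borel M" and N: "countably_separated N"
    and e: "e \<in> M \<rightarrow>\<^sub>M N" "inj_on e (space M)"
    and s: "s \<in> space L \<rightarrow> space M" "(\<lambda>x. e (s x)) \<in> L \<rightarrow>\<^sub>M N"
  shows "s \<in> L \<rightarrow>\<^sub>M M"
proof (rule measurableI)
  fix C assume "C \<in> sets M"
  then obtain D where D: "D \<in> sets N" "C = e -` D \<inter> space M"
    by (rule injective_measurable_vimage[OF M N e])
  then have "s -` C \<inter> space L = (\<lambda>x. e (s x)) -` D \<inter> space L" using s(1) by auto
  then show "s -` C \<inter> space L \<in> sets L" using measurable_sets[OF s(2) D(1)] by simp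
qed (use s in auto)

lemma standard_borel_restrict_space:
  assumes "standard_borel M" "W \<in> sets M"
  shows "standard_borel (restrict_space M W)"
proof -
  obtain T :: "real topology" and B u w where T: "polish_topology T" "B \<in> sets (borel_sigma T)"
    and u: "u \<in> M \<rightarrow>\<^sub>M restrict_space (borel_sigma T) B"
    and w: "w \<in> restrict_space (borel_sigma T) B \<rightarrow>\<^sub>M M"
    and wu: "\<And>x. x \<in> space M \<Longrightarrow> w (u x) = x"
    and uw: "\<And>y. y \<in> space (restrict_space (borel_sigma T) B) \<Longrightarrow> u (w y) = y"
    using assms(1) unfolding standard_borel_def measurable_isomorphic_def by metis
  let ?R = "restrict_space (borel_sigma T) B"
  define D where "D = w -` W \<inter> space ?R"
  have WM: "W \<subseteq> space M" using assms(2) by (rule sets.sets_into_space)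
  have DR: "D \<in> sets ?R" unfolding D_def by (rule measurable_sets[OF w assms(2)])
  have DB: "D \<subseteq> B" by (auto simp: D_def space_restrict_space)
  have D: "D \<in> sets (borel_sigma T)"
    using DR T(2) by (subst (asm) sets_restrict_space_iff) (auto simp: sets.Int_space_eq2 simp del: space_borel_sigma simp flip: space_borel_sigma)
  have eq: "restrict_space (borel_sigma T) D = restrict_space ?R D"
    using restrict_restrict_space[of B "borel_sigma T" D] DB T(2) D
    by (simp only: sets.Int_space_eq2 Int_absorb1)
  have "u \<in> restrict_space M W \<rightarrow>\<^sub>M restrict_space (borel_sigma T) D"
    unfolding eq
  proof (rule measurable_restrict_space3[OF u])
    show "u \<in> W \<rightarrow> D" using WM measurable_space[OF u] wu by (auto simp: D_def)
  qed
  moreover have "w \<in> restrict_space (borel_sigma T) D \<rightarrow>\<^sub>M restrict_space M W"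
    unfolding eq by (rule measurable_restrict_space3[OF w]) (auto simp: D_def)
  moreover have "w (u x) = x" if "x \<in> space (restrict_space M W)" for x
    using that wu by (simp add: space_restrict_space)
  moreover have "u (w y) = y" if "y \<in> space (restrict_space (borel_sigma T) D)" for y
    using that uw unfolding eq by (simp add: space_restrict_space)
  ultimately show ?thesis
    unfolding standard_borel_def measurable_isomorphic_def using T(1) D by blast
qed

subsection \<open>The Hahn-Banach theorem in separable spaces\<close>

context complex_normed_vs
begin

lemma smult_add_left: "v \<in> carrier V \<Longrightarrow> (a + b) \<odot> v = a \<odot> v \<oplus> b \<odot> v"
  using smult_l_distr[of a b v] by (simp add: complex_ring_def)

lemma smult_mult: "v \<in> carrier V \<Longrightarrow> (a * b) \<odot> v = a \<odot> (b \<odot> v)"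
  using smult_assoc1[of a b v] by (simp add: complex_ring_def)

lemma smult_closed' [simp]: "v \<in> carrier V \<Longrightarrow> a \<odot> v \<in> carrier V"
  using smult_closed[of a v] by (simp add: complex_ring_def)

lemma smult_add_right: "v \<in> carrier V \<Longrightarrow> w \<in> carrier V \<Longrightarrow> a \<odot> (v \<oplus> w) = a \<odot> v \<oplus> a \<odot> w"
  using smult_r_distr[of a v w] by (simp add: complex_ring_def)

lemma smult_1 [simp]: "v \<in> carrier V \<Longrightarrow> 1 \<odot> v = v"
  using smult_one[of v] by (simp add: complex_ring_def)

lemma smult_0 [simp]: "v \<in> carrier V \<Longrightarrow> 0 \<odot> v = \<zero>"
  using smult_l_null[of v] by (simp add: complex_ring_def)

lemma smult_minus_1: "v \<in> carrier V \<Longrightarrow> (-1) \<odot> v = \<ominus> v"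
  using smult_add_left[of v "-1" 1] by (simp add: M.minus_equality)

lemma nrm_zero [simp]: "\<parallel>\<zero>\<parallel> = 0"
  by (simp add: nrm_eq_0_iff)

lemma nrm_minus [simp]: "v \<in> carrier V \<Longrightarrow> \<parallel>\<ominus> v\<parallel> = \<parallel>v\<parallel>"
  using nrm_smult[of v "-1"] by (simp add: smult_minus_1)

lemma minus_closed' [simp]: "v \<in> carrier V \<Longrightarrow> w \<in> carrier V \<Longrightarrow> v \<ominus> w \<in> carrier V"
  by (simp add: a_minus_def)

lemma diff_add_cancel: "v \<in> carrier V \<Longrightarrow> w \<in> carrier V \<Longrightarrow> w \<oplus> (v \<ominus> w) = v"
  by (simp add: a_minus_def M.a_comm M.r_neg1 M.a_lcomm M.r_neg)

lemma nrm_minus_commute: "v \<in> carrier V \<Longrightarrow> w \<in> carrier V \<Longrightarrow> \<parallel>v \<ominus> w\<parallel> = \<parallel>w \<ominus> v\<parallel>"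
  using Metric_space.commute[OF Metric_space_nrm_dist, of v w] by (simp add: nrm_dist_def)

lemma nrm_diff_triangle:
  "u \<in> carrier V \<Longrightarrow> v \<in> carrier V \<Longrightarrow> w \<in> carrier V \<Longrightarrow> \<parallel>u \<ominus> w\<parallel> \<le> \<parallel>u \<ominus> v\<parallel> + \<parallel>v \<ominus> w\<parallel>"
  using Metric_space.triangle[OF Metric_space_nrm_dist, of u v w] by (simp add: nrm_dist_def)

lemma diff_eq_zero_iff: "v \<in> carrier V \<Longrightarrow> w \<in> carrier V \<Longrightarrow> \<parallel>v \<ominus> w\<parallel> = 0 \<longleftrightarrow> v = w"
  using Metric_space.zero[OF Metric_space_nrm_dist, of v w] by (simp add: nrm_dist_def)

end

definition norm_dense :: "('a, 'm) normed_vs_scheme \<Rightarrow> (nat \<Rightarrow> 'a) \<Rightarrow> bool" where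
  "norm_dense V d \<longleftrightarrow> range d \<subseteq> carrier V \<and> (\<forall>v\<in>carrier V. \<forall>\<epsilon>>0. \<exists>k. \<parallel>v \<ominus>\<^bsub>V\<^esub> d k\<parallel>\<^bsub>V\<^esub> < \<epsilon>)"

lemma norm_denseD:
  "norm_dense V d \<Longrightarrow> v \<in> carrier V \<Longrightarrow> \<epsilon> > 0 \<Longrightarrow> \<exists>k. \<parallel>v \<ominus>\<^bsub>V\<^esub> d k\<parallel>\<^bsub>V\<^esub> < \<epsilon>"
  "norm_dense V d \<Longrightarrow> d k \<in> carrier V"
  by (auto simp: norm_dense_def)

text \<open>Only homogeneity under natural numbers is demanded: it suffices for the limit in \<open>hb_step\<close> to exist,
  and real homogeneity of the final additive functional follows from boundedness.\<close>

definition sublinear :: "('a, 'm) normed_vs_scheme \<Rightarrow> ('a \<Rightarrow> real) \<Rightarrow> bool" where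
  "sublinear V p \<longleftrightarrow>
     (\<forall>v\<in>carrier V. \<forall>w\<in>carrier V. p (v \<oplus>\<^bsub>V\<^esub> w) \<le> p v + p w) \<and>
     (\<forall>n::nat. \<forall>v\<in>carrier V. p (of_nat n \<odot>\<^bsub>V\<^esub> v) = real n * p v) \<and>
     (\<forall>v\<in>carrier V. p v \<le> \<parallel>v\<parallel>\<^bsub>V\<^esub>)"

text \<open>Explicit limits instead of Zorn's lemma make the functional depend measurably on the base point
  when the space varies in a Borel field.\<close>

definition hb_step :: "('a, 'm) normed_vs_scheme \<Rightarrow> ('a \<Rightarrow> real) \<Rightarrow> 'a \<Rightarrow> 'a \<Rightarrow> real" where
  "hb_step V p y v = lim (\<lambda>n. p (v \<oplus>\<^bsub>V\<^esub> (of_nat n \<odot>\<^bsub>V\<^esub> y)) - real n * p y)"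

primrec hb_seq :: "('a, 'm) normed_vs_scheme \<Rightarrow> ('a \<Rightarrow> real) \<Rightarrow> (nat \<Rightarrow> 'a) \<Rightarrow> nat \<Rightarrow> 'a \<Rightarrow> real" where
  "hb_seq V p d 0 = p"
| "hb_seq V p d (Suc k) = hb_step V (hb_seq V p d k) (d k)"

definition hb :: "('a, 'm) normed_vs_scheme \<Rightarrow> ('a \<Rightarrow> real) \<Rightarrow> (nat \<Rightarrow> 'a) \<Rightarrow> 'a \<Rightarrow> real" where
  "hb V p d v = lim (\<lambda>k. hb_seq V p d k v)"

lemma decseq_bounded_below_LIMSEQ_lim:
  fixes X :: "nat \<Rightarrow> real"
  assumes "decseq X" "\<And>n. B \<le> X n"
  shows "X \<longlonglongrightarrow> lim X" "\<And>n. lim X \<le> X n"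
proof -
  obtain L where L: "X \<longlonglongrightarrow> L" "\<forall>i. L \<le> X i" using decseq_convergent[OF assms(1)] assms(2) by metis
  then show "X \<longlonglongrightarrow> lim X" "\<And>n. lim X \<le> X n" by (auto simp: limI)
qed

context complex_normed_vs
begin

lemma sublinearD:
  assumes "sublinear V p"
  shows "v \<in> carrier V \<Longrightarrow> w \<in> carrier V \<Longrightarrow> p (v \<oplus> w) \<le> p v + p w"
    "v \<in> carrier V \<Longrightarrow> p (of_nat n \<odot> v) = real n * p v"
    "v \<in> carrier V \<Longrightarrow> p v \<le> \<parallel>v\<parallel>"
    "p \<zero> = 0"
    "v \<in> carrier V \<Longrightarrow> - p (\<ominus> v) \<le> p v"
    "v \<in> carrier V \<Longrightarrow> - \<parallel>v\<parallel> \<le> p v"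
proof -
  show 1: "p (v \<oplus> w) \<le> p v + p w" if "v \<in> carrier V" "w \<in> carrier V" for v w
    using assms that by (simp add: sublinear_def)
  show 2: "v \<in> carrier V \<Longrightarrow> p (of_nat n \<odot> v) = real n * p v" for n v
    using assms by (simp add: sublinear_def)
  show 3: "v \<in> carrier V \<Longrightarrow> p v \<le> \<parallel>v\<parallel>" for v
    using assms by (simp add: sublinear_def)
  show 4: "p \<zero> = 0" using 2[of \<zero> 0] by simp
  show 5: "- p (\<ominus> v) \<le> p v" if "v \<in> carrier V" for v
    using 1[of "\<ominus> v" v] 4 that by (simp add: M.l_neg)
  show "- \<parallel>v\<parallel> \<le> p v" if "v \<in> carrier V" for v
    using 5[OF that] 3[of "\<ominus> v"] that by simp
qed

lemma sublinear_lipschitz: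
  assumes "sublinear V p" "v \<in> carrier V" "w \<in> carrier V"
  shows "\<bar>p v - p w\<bar> \<le> \<parallel>v \<ominus> w\<parallel>"
proof -
  have "p v \<le> p w + p (v \<ominus> w)" "p w \<le> p v + p (w \<ominus> v)"
    using sublinearD(1)[OF assms(1), of w "v \<ominus> w"] sublinearD(1)[OF assms(1), of v "w \<ominus> v"] assms
    by (simp_all add: diff_add_cancel)
  moreover have "p (v \<ominus> w) \<le> \<parallel>v \<ominus> w\<parallel>" "p (w \<ominus> v) \<le> \<parallel>w \<ominus> v\<parallel>"
    using sublinearD(3)[OF assms(1)] assms(2,3) by auto
  moreover have "\<parallel>w \<ominus> v\<parallel> = \<parallel>v \<ominus> w\<parallel>" using assms(2,3) by (rule nrm_minus_commute[rotated])
  ultimately show ?thesis by linarith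
qed

lemma sublinear_nrm: "sublinear V (nrm V)"
  by (simp add: sublinear_def nrm_triangle nrm_smult)

text \<open>Subadditivity makes the sequence decrease, and homogeneity along \<open>y\<close> bounds
  it from below by \<open>- p (\<ominus> v)\<close>. Hence the limit exists and is also the
  infimum.\<close>

lemma hb_step_seq:
  assumes p: "sublinear V p" and y: "y \<in> carrier V" and v: "v \<in> carrier V"
  defines "X \<equiv> \<lambda>n. p (v \<oplus> of_nat n \<odot> y) - real n * p y"
  shows "X \<longlonglongrightarrow> hb_step V p y v" "\<And>n. hb_step V p y v \<le> X n" "- p (\<ominus> v) \<le> hb_step V p y v"
proof -
  have Suc: "v \<oplus> of_nat (Suc n) \<odot> y = (v \<oplus> of_nat n \<odot> y) \<oplus> y" for n
    using v y by (simp add: smult_add_left M.a_ac)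
  have dec: "decseq X"
  proof (rule decseq_SucI)
    fix n
    have "p (v \<oplus> of_nat (Suc n) \<odot> y) \<le> p (v \<oplus> of_nat n \<odot> y) + p y"
      unfolding Suc by (intro sublinearD(1)[OF p]) (use v y in auto)
    then show "X (Suc n) \<le> X n" by (simp add: X_def algebra_simps)
  qed
  have low: "- p (\<ominus> v) \<le> X n" for n
  proof -
    have "real n * p y = p (\<ominus> v \<oplus> (v \<oplus> of_nat n \<odot> y))"
      using sublinearD(2)[OF p y, of n] v y by (simp add: M.r_neg1)
    also have "\<dots> \<le> p (\<ominus> v) + p (v \<oplus> of_nat n \<odot> y)"
      by (intro sublinearD(1)[OF p]) (use v y in auto)
    finally show ?thesis by (simp add: X_def)
  qed
  show lim: "X \<longlonglongrightarrow> hb_step V p y v" and "\<And>n. hb_step V p y v \<le> X n"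
    using decseq_bounded_below_LIMSEQ_lim[OF dec low] by (simp_all add: hb_step_def X_def)
  show "- p (\<ominus> v) \<le> hb_step V p y v" by (rule LIMSEQ_le_const[OF lim]) (use low in auto)
qed

lemma hb_step_le:
  assumes "sublinear V p" "y \<in> carrier V" "v \<in> carrier V"
  shows "hb_step V p y v \<le> p v"
  using hb_step_seq(2)[OF assms, of 0] assms by simp

text \<open>At \<open>n = 1\<close> the sequence for \<open>\<ominus> y\<close> takes the value
  \<open>p \<zero> - p y\<close>. This is the gain of the step: in the direction \<open>y\<close>
  the functional becomes odd.\<close>

lemma hb_step_minus:
  assumes "sublinear V p" "y \<in> carrier V"
  shows "hb_step V p y (\<ominus> y) \<le> - p y"
  using hb_step_seq(2)[OF assms, of "\<ominus> y" 1] assms sublinearD(4)[OF assms(1)] by (simp add: M.l_neg)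

lemma sublinear_hb_step:
  assumes p: "sublinear V p" and y: "y \<in> carrier V"
  shows "sublinear V (hb_step V p y)"
  unfolding sublinear_def
proof (intro conjI ballI allI)
  fix v w assume v: "v \<in> carrier V" and w: "w \<in> carrier V"
  let ?X = "\<lambda>v n. p (v \<oplus> of_nat n \<odot> y) - real n * p y"
  have "hb_step V p y (v \<oplus> w) \<le> ?X v n + ?X w n" for n
  proof -
    \<comment> \<open>The index \<open>n + n\<close> supplies one copy of
      \<open>of_nat n \<odot> y\<close> for each of the two summands.\<close>
    have "hb_step V p y (v \<oplus> w) \<le> p ((v \<oplus> w) \<oplus> of_nat (n + n) \<odot> y) - real (n + n) * p y"
      by (intro hb_step_seq(2)[OF p y]) (use v w in auto)
    also have "(v \<oplus> w) \<oplus> of_nat (n + n) \<odot> y = (v \<oplus> of_nat n \<odot> y) \<oplus> (w \<oplus> of_nat n \<odot> y)"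
      using v w y by (simp only: of_nat_add smult_add_left) (simp add: M.a_ac)
    also have "p \<dots> - real (n + n) * p y
        \<le> (p (v \<oplus> of_nat n \<odot> y) + p (w \<oplus> of_nat n \<odot> y)) - real (n + n) * p y"
      by (intro diff_right_mono sublinearD(1)[OF p]) (use v w y in auto)
    finally show ?thesis by (simp add: algebra_simps)
  qed
  then show "hb_step V p y (v \<oplus> w) \<le> hb_step V p y v + hb_step V p y w"
    by (intro LIMSEQ_le_const[OF tendsto_add[OF hb_step_seq(1)[OF p y v] hb_step_seq(1)[OF p y w]]]) auto
next
  fix n :: nat and v assume v: "v \<in> carrier V"
  show "hb_step V p y (of_nat n \<odot> v) = real n * hb_step V p y v"
  proof (cases "n = 0")
    case True
    have "hb_step V p y \<zero> \<le> 0" "0 \<le> hb_step V p y \<zero>"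
      using hb_step_le[OF p y, of \<zero>] hb_step_seq(3)[OF p y, of \<zero>] sublinearD(4)[OF p]
      using M.minus_equality[of \<zero> \<zero>] by auto
    then show ?thesis using True v by simp
  next
    case False
    \<comment> \<open>Along the multiples of \<open>n\<close> the factor \<open>n\<close> comes out
      of every term of the sequence.\<close>
    have "(\<lambda>k. p (of_nat n \<odot> v \<oplus> of_nat (n * k) \<odot> y) - real (n * k) * p y)
      \<longlonglongrightarrow> hb_step V p y (of_nat n \<odot> v)"
    proof -
      have "strict_mono (\<lambda>k. n * k)" using False by (simp add: strict_mono_def)
      then show ?thesis
        using LIMSEQ_subseq_LIMSEQ[OF hb_step_seq(1)[OF p y smult_closed'[OF v]], of "\<lambda>k. n * k"]
        by (simp only: o_def)
    qed
    moreover have "p (of_nat n \<odot> v \<oplus> of_nat (n * k) \<odot> y) - real (n * k) * p y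
        = real n * (p (v \<oplus> of_nat k \<odot> y) - real k * p y)" for k
    proof -
      have "of_nat n \<odot> v \<oplus> of_nat (n * k) \<odot> y = of_nat n \<odot> (v \<oplus> of_nat k \<odot> y)"
        using v y by (simp add: smult_add_right smult_mult)
      then show ?thesis using sublinearD(2)[OF p, of "v \<oplus> of_nat k \<odot> y" n] v y by (simp add: algebra_simps)
    qed
    ultimately show ?thesis
      using LIMSEQ_unique tendsto_mult_left[OF hb_step_seq(1)[OF p y v], of "real n"] by simp
  qed
next
  fix v assume "v \<in> carrier V"
  then show "hb_step V p y v \<le> \<parallel>v\<parallel>"
    using hb_step_le[OF p y] sublinearD(3)[OF p] by (meson order_trans)
qed

lemma sublinear_hb_seq:
  assumes "sublinear V p" "range d \<subseteq> carrier V"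
  shows "sublinear V (hb_seq V p d k)"
proof -
  have "d k \<in> carrier V" for k using assms(2) by blast
  then show ?thesis by (induction k) (simp_all add: assms(1) sublinear_hb_step)
qed

lemma hb_LIMSEQ:
  assumes "sublinear V p" "range d \<subseteq> carrier V" "v \<in> carrier V"
  shows "(\<lambda>k. hb_seq V p d k v) \<longlonglongrightarrow> hb V p d v" "\<And>k. hb V p d v \<le> hb_seq V p d k v"
proof -
  have "decseq (\<lambda>k. hb_seq V p d k v)"
    by (rule decseq_SucI)
       (use assms(2) in \<open>auto intro!: hb_step_le sublinear_hb_seq assms\<close>)
  moreover have "- \<parallel>v\<parallel> \<le> hb_seq V p d k v" for k
    by (rule sublinearD(6)[OF sublinear_hb_seq]) (use assms in auto)
  ultimately show "(\<lambda>k. hb_seq V p d k v) \<longlonglongrightarrow> hb V p d v" "\<And>k. hb V p d v \<le> hb_seq V p d k v"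
    using decseq_bounded_below_LIMSEQ_lim unfolding hb_def by blast+
qed

lemma hb_le:
  assumes "sublinear V p" "range d \<subseteq> carrier V" "v \<in> carrier V"
  shows "hb V p d v \<le> p v"
  using hb_LIMSEQ(2)[OF assms, of 0] by simp

lemma sublinear_hb:
  assumes p: "sublinear V p" and d: "range d \<subseteq> carrier V"
  shows "sublinear V (hb V p d)"
  unfolding sublinear_def
proof (intro conjI ballI allI)
  note lim = hb_LIMSEQ(1)[OF p d] and sub = sublinearD[OF sublinear_hb_seq[OF p d]]
  show "hb V p d (v \<oplus> w) \<le> hb V p d v + hb V p d w" if "v \<in> carrier V" "w \<in> carrier V" for v w
    by (rule LIMSEQ_le[OF lim tendsto_add[OF lim lim]]) (use that sub(1) in auto)
  show "hb V p d (of_nat n \<odot> v) = real n * hb V p d v" if "v \<in> carrier V" for n v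
    using LIMSEQ_unique[OF lim[of "of_nat n \<odot> v"], of "real n * hb V p d v"]
      tendsto_mult_left[OF lim[OF that], of "real n"] sub(2) that by simp
  show "hb V p d v \<le> \<parallel>v\<parallel>" if "v \<in> carrier V" for v
    using hb_le[OF p d, of v] that sublinearD(3)[OF p that] by simp
qed

text \<open>Step \<open>k\<close> pushes the value at \<open>\<ominus> d k\<close> down to minus the
  value at \<open>d k\<close>, and later steps only decrease it further. Sublinearity of the limit
  gives the opposite inequality.\<close>

lemma hb_minus_direction:
  assumes p: "sublinear V p" and d: "range d \<subseteq> carrier V"
  shows "hb V p d (\<ominus> d k) = - hb V p d (d k)" "hb V p d (\<ominus> d k) \<le> - hb_seq V p d k (d k)"
proof -
  have dk: "d k \<in> carrier V" using d by blast
  have "hb V p d (\<ominus> d k) \<le> hb_seq V p d (Suc k) (\<ominus> d k)"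
    by (rule hb_LIMSEQ(2)[OF p d]) (simp add: dk)
  also have "\<dots> \<le> - hb_seq V p d k (d k)"
    using hb_step_minus[OF sublinear_hb_seq[OF p d] dk] by simp
  finally show 1: "hb V p d (\<ominus> d k) \<le> - hb_seq V p d k (d k)" .
  have "hb V p d (d k) \<le> hb_seq V p d k (d k)" by (rule hb_LIMSEQ(2)[OF p d dk])
  moreover have "- hb V p d (\<ominus> d k) \<le> hb V p d (d k)"
    by (rule sublinearD(5)[OF sublinear_hb[OF p d] dk])
  ultimately show "hb V p d (\<ominus> d k) = - hb V p d (d k)" using 1 by linarith
qed

text \<open>At step 0 the functional is still \<open>p\<close>, so nothing is lost in the first
  direction. A vector at which \<open>p\<close> is to be attained is therefore placed at the head of
  the sequence.\<close>

lemma hb_first_direction: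
  assumes p: "sublinear V p" and d: "range d \<subseteq> carrier V"
  shows "hb V p d (d 0) = p (d 0)"
proof -
  have "d 0 \<in> carrier V" using d by blast
  then show ?thesis using hb_minus_direction[OF p d, of 0] hb_le[OF p d, of "d 0"] by simp
qed

text \<open>An odd sublinear functional is additive. Oddness holds at each \<open>d k\<close> and
  spreads to all vectors by density and the Lipschitz bound.\<close>

lemma hb_additive:
  assumes p: "sublinear V p" and dense: "norm_dense V d"
    and v: "v \<in> carrier V" and w: "w \<in> carrier V"
  shows "hb V p d (v \<oplus> w) = hb V p d v + hb V p d w"
proof -
  let ?g = "hb V p d"
  have d: "range d \<subseteq> carrier V" using dense by (simp add: norm_dense_def)
  then have dk: "d k \<in> carrier V" for k by blast
  note g = sublinear_hb[OF p d]
  have odd: "?g (\<ominus> v) = - ?g v" if v: "v \<in> carrier V" for v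
  proof -
    have "\<bar>?g (\<ominus> v) + ?g v\<bar> \<le> 0 + \<epsilon>" if "\<epsilon> > 0" for \<epsilon>
    proof -
      obtain k where k: "\<parallel>v \<ominus> d k\<parallel> < \<epsilon> / 2" using norm_denseD(1)[OF dense v, of "\<epsilon> / 2"] \<open>\<epsilon> > 0\<close> by auto
      have "\<ominus> v \<ominus> (\<ominus> d k) = \<ominus> (v \<ominus> d k)"
        using v dk[of k] by (simp add: a_minus_def M.minus_add)
      then have "\<parallel>\<ominus> v \<ominus> (\<ominus> d k)\<parallel> < \<epsilon> / 2" using k v dk[of k] by simp
      then show ?thesis
        using sublinear_lipschitz[OF g v dk[of k]] sublinear_lipschitz[OF g, of "\<ominus> v" "\<ominus> d k"]
          hb_minus_direction(1)[OF p d, of k] k v dk[of k] by (auto simp: abs_if split: if_splits)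
    qed
    then have "\<bar>?g (\<ominus> v) + ?g v\<bar> \<le> 0" by (rule field_le_epsilon)
    then show ?thesis by linarith
  qed
  have "?g (\<ominus> v \<oplus> \<ominus> w) \<le> ?g (\<ominus> v) + ?g (\<ominus> w)" by (rule sublinearD(1)[OF g]) (use v w in auto)
  moreover have "\<ominus> v \<oplus> \<ominus> w = \<ominus> (v \<oplus> w)" using v w by (simp add: M.minus_add)
  ultimately show ?thesis
    using sublinearD(1)[OF g v w] odd[OF v] odd[OF w] odd[of "v \<oplus> w"] v w by simp
qed

end

text \<open>After subtraction of the candidate \<open>t * k 1\<close> the function vanishes at the
  integers, so it has period 1 and is bounded. A bounded additive function is zero, as its multiples
  show.\<close>

lemma additive_bounded_real:
  fixes k :: "real \<Rightarrow> real"
  assumes add: "\<And>s t. k (s + t) = k s + k t" and bound: "\<And>t. \<bar>k t\<bar> \<le> C * \<bar>t\<bar>"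
  shows "k t = t * k 1"
proof -
  define m where "m t = k t - t * k 1" for t
  have m: "m (s + t) = m s + m t" for s t by (simp add: m_def add algebra_simps)
  have nat: "m (real n * t) = real n * m t" for n t
    by (induction n) (use m[of 0 0] in \<open>auto simp: m algebra_simps\<close>)
  have nat0: "m (real n) = 0" for n using nat[of n 1] by (simp add: m_def)
  have "m (real n) + m (- real n) = 0" for n using m[of "real n" "- real n"] m[of 0 0] by simp
  then have "m (of_int z) = 0" for z
    using nat0 by (cases z rule: int_cases2) auto
  then have frac: "m t = m (frac t)" for t using m[of "of_int \<lfloor>t\<rfloor>" "frac t"] by (simp add: frac_def)
  have bounded: "\<bar>m t\<bar> \<le> 2 * \<bar>C\<bar>" for t
  proof -
    have "\<bar>k (frac t)\<bar> \<le> \<bar>C\<bar>"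
    proof -
      have "\<bar>k (frac t)\<bar> \<le> C * frac t" using bound[of "frac t"] by simp
      also have "\<dots> \<le> \<bar>C\<bar> * 1"
        using frac_lt_1[of t] by (intro mult_mono) auto
      finally show ?thesis by simp
    qed
    moreover have "\<bar>frac t * k 1\<bar> \<le> \<bar>C\<bar>"
    proof -
      have "\<bar>frac t * k 1\<bar> = frac t * \<bar>k 1\<bar>" by (simp add: abs_mult)
      also have "\<dots> \<le> 1 * \<bar>C\<bar>"
        using bound[of 1] frac_lt_1[of t] by (intro mult_mono) auto
      finally show ?thesis by simp
    qed
    ultimately show ?thesis using frac[of t] unfolding m_def by linarith
  qed
  have "m t = 0"
  proof (rule ccontr)
    assume "m t \<noteq> 0"
    then obtain n :: nat where "2 * \<bar>C\<bar> < real n * \<bar>m t\<bar>" using reals_Archimedean3[of "\<bar>m t\<bar>"] by auto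
    then show False using bounded[of "real n * t"] by (simp add: nat abs_mult)
  qed
  then show ?thesis by (simp add: m_def)
qed

context complex_normed_vs
begin

text \<open>A complex functional is recovered from its real part as
  \<open>g v - \<i> * g (\<i> \<odot> v)\<close>. Its modulus obeys the same bound because a
  unimodular factor rotates \<open>f v\<close> onto the nonnegative reals, where only the real part
  counts.\<close>

lemma real_part_of_bounded_functional:
  assumes add: "\<And>v w. v \<in> carrier V \<Longrightarrow> w \<in> carrier V \<Longrightarrow> g (v \<oplus> w) = g v + g w"
    and le: "\<And>v. v \<in> carrier V \<Longrightarrow> g v \<le> \<parallel>v\<parallel>"
  shows "\<exists>f\<in>bounded_functionals V.
    \<forall>v\<in>carrier V. f v = Complex (g v) (- g (\<i> \<odot> v)) \<and> cmod (f v) \<le> \<parallel>v\<parallel>"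
proof -
  have g0: "g \<zero> = 0" using add[of \<zero> \<zero>] by simp
  have gm: "g (\<ominus> v) = - g v" if "v \<in> carrier V" for v
    using add[of v "\<ominus> v"] that g0 by (simp add: M.r_neg)
  have abs: "\<bar>g v\<bar> \<le> \<parallel>v\<parallel>" if "v \<in> carrier V" for v
    using le[OF that] le[of "\<ominus> v"] gm[OF that] that by auto
  have real: "g (of_real t \<odot> v) = t * g v" if v: "v \<in> carrier V" for t v
  proof -
    have "g (of_real t \<odot> v) = t * g (of_real 1 \<odot> v)"
    proof (rule additive_bounded_real)
      show "g (of_real (s + t) \<odot> v) = g (of_real s \<odot> v) + g (of_real t \<odot> v)" for s t
        using v by (simp add: smult_add_left add)
      show "\<bar>g (of_real t \<odot> v)\<bar> \<le> \<parallel>v\<parallel> * \<bar>t\<bar>" for t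
        using abs[of "of_real t \<odot> v"] v by (simp add: nrm_smult mult.commute)
    qed
    then show ?thesis using v by simp
  qed
  define f where "f = (\<lambda>v\<in>carrier V. Complex (g v) (- g (\<i> \<odot> v)))"
  have f: "f v = Complex (g v) (- g (\<i> \<odot> v))" if "v \<in> carrier V" for v using that by (simp add: f_def)
  have fadd: "f (v \<oplus> w) = f v + f w" if "v \<in> carrier V" "w \<in> carrier V" for v w
    using that by (simp add: f add smult_add_right complex_eq_iff)
  have fsmult: "f (c \<odot> v) = c * f v" if v: "v \<in> carrier V" for c v
  proof -
    have split: "c \<odot> v = of_real (Re c) \<odot> v \<oplus> of_real (Im c) \<odot> (\<i> \<odot> v)"
    proof -
      have "c = of_real (Re c) + of_real (Im c) * \<i>" by (simp add: complex_eq_iff)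
      then show ?thesis using smult_add_left[OF v, of "of_real (Re c)" "of_real (Im c) * \<i>"]
        smult_mult[OF v] by simp
    qed
    have re: "g (c \<odot> v) = Re c * g v + Im c * g (\<i> \<odot> v)" unfolding split using v by (simp add: add real)
    have split': "\<i> \<odot> (c \<odot> v) = of_real (Re c) \<odot> (\<i> \<odot> v) \<oplus> of_real (- Im c) \<odot> v"
    proof -
      have "\<i> * c = of_real (Re c) * \<i> + of_real (- Im c)" by (simp add: complex_eq_iff)
      then show ?thesis using smult_add_left[OF v, of "of_real (Re c) * \<i>" "of_real (- Im c)"]
        smult_mult[OF v] by metis
    qed
    have im: "g (\<i> \<odot> (c \<odot> v)) = Re c * g (\<i> \<odot> v) - Im c * g v"
      unfolding split' using v real[OF v, of "- Im c"] by (simp add: add real del: of_real_minus)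
    show ?thesis using v by (simp add: f re im complex_eq_iff algebra_simps)
  qed
  have fle: "cmod (f v) \<le> \<parallel>v\<parallel>" if v: "v \<in> carrier V" for v
  proof (cases "f v = 0")
    case True
    then show ?thesis using nrm_nonneg[OF v] by simp
  next
    case False
    define c where "c = cnj (f v) / of_real (cmod (f v))"
    have "c * f v = of_real (cmod (f v))"
      using False by (simp add: c_def complex_norm_square[symmetric] power2_eq_square mult.commute)
    then have "cmod (f v) = Re (f (c \<odot> v))" using fsmult[OF v] by simp
    also have "\<dots> = g (c \<odot> v)" using v by (simp add: f)
    also have "\<dots> \<le> cmod c * \<parallel>v\<parallel>" using le[of "c \<odot> v"] v by (simp add: nrm_smult)
    also have "cmod c = 1" using False by (simp add: c_def norm_divide)
    finally show ?thesis by simp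
  qed
  have "f \<in> bounded_functionals V"
    unfolding bounded_functionals_def
  proof (intro CollectI conjI ballI allI)
    show "f \<in> extensional (carrier V)" by (simp add: f_def)
    show "\<exists>C. \<forall>v\<in>carrier V. cmod (f v) \<le> C * \<parallel>v\<parallel>" using fle by (intro exI[of _ 1]) simp
  qed (use fadd fsmult in auto)
  then show ?thesis using f fle by blast
qed

text \<open>The vector \<open>u\<close> is put in front of the dense sequence so that the
  first-direction property applies to it.\<close>

theorem hahn_banach:
  assumes p: "sublinear V p" and u: "u \<in> carrier V" and dense: "norm_dense V d"
  shows "\<exists>f\<in>bounded_functionals V.
    (\<forall>v\<in>carrier V. cmod (f v) \<le> \<parallel>v\<parallel> \<and> Re (f v) \<le> p v) \<and> Re (f u) = p u"
proof -
  let ?d = "case_nat u d" and ?g = "hb V p (case_nat u d)"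
  have dense': "norm_dense V ?d"
    unfolding norm_dense_def
  proof (intro conjI ballI allI impI)
    show "range ?d \<subseteq> carrier V" using u norm_denseD(2)[OF dense] by (auto split: nat.splits)
    show "\<exists>k. \<parallel>v \<ominus> ?d k\<parallel> < \<epsilon>" if "v \<in> carrier V" "0 < \<epsilon>" for v \<epsilon>
    proof -
      obtain k where "\<parallel>v \<ominus> d k\<parallel> < \<epsilon>" using norm_denseD(1)[OF dense \<open>v \<in> carrier V\<close> \<open>0 < \<epsilon>\<close>] by blast
      then show ?thesis by (intro exI[of _ "Suc k"]) simp
    qed
  qed
  then have d': "range ?d \<subseteq> carrier V" by (simp add: norm_dense_def)
  obtain f where f: "f \<in> bounded_functionals V"
      "\<And>v. v \<in> carrier V \<Longrightarrow> f v = Complex (?g v) (- ?g (\<i> \<odot> v))"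
      "\<And>v. v \<in> carrier V \<Longrightarrow> cmod (f v) \<le> \<parallel>v\<parallel>"
    using real_part_of_bounded_functional[of ?g, OF hb_additive[OF p dense']
        sublinearD(3)[OF sublinear_hb[OF p d']]] by blast
  have "Re (f v) \<le> p v" if "v \<in> carrier V" for v using f(2)[OF that] hb_le[OF p d', of v] that by simp
  moreover have "Re (f u) = p u" using f(2)[OF u] hb_first_direction[OF p d'] by simp
  ultimately show ?thesis using f(1,3) by blast
qed

end

subsection \<open>Weak compactness in reflexive spaces\<close>

definition norm_setdist :: "('a, 'm) normed_vs_scheme \<Rightarrow> 'a set \<Rightarrow> 'a \<Rightarrow> real" where
  "norm_setdist V W u = (INF w\<in>W. \<parallel>u \<ominus>\<^bsub>V\<^esub> w\<parallel>\<^bsub>V\<^esub>)"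

locale closed_subspace = complex_normed_vs +
  fixes W
  assumes submodule: "submodule W complex_ring V"
    and closed: "closedin (nrm_topology V) W"
begin

lemma subset: "W \<subseteq> carrier V"
  using submoduleE(1)[OF submodule] .

lemma in_carrier: "w \<in> W \<Longrightarrow> w \<in> carrier V"
  using subset by blast

lemma zero_mem: "\<zero> \<in> W"
  using submodule.axioms(1)[OF submodule] subgroup.one_closed by fastforce

lemma add_mem: "v \<in> W \<Longrightarrow> w \<in> W \<Longrightarrow> v \<oplus> w \<in> W"
  using submoduleE(5)[OF submodule] .

lemma smult_mem: "w \<in> W \<Longrightarrow> a \<odot> w \<in> W"
  using submoduleE(4)[OF submodule, of a w] by (simp add: complex_ring_def)

lemma bdd_below_dist: "u \<in> carrier V \<Longrightarrow> bdd_below ((\<lambda>w. \<parallel>u \<ominus> w\<parallel>) ` W)"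
  by (rule bdd_belowI2[of _ 0]) (simp add: nrm_nonneg in_carrier)

lemma norm_setdist_le: "u \<in> carrier V \<Longrightarrow> w \<in> W \<Longrightarrow> norm_setdist V W u \<le> \<parallel>u \<ominus> w\<parallel>"
  unfolding norm_setdist_def by (rule cINF_lower[OF bdd_below_dist])

lemma norm_setdist_ge: "(\<And>w. w \<in> W \<Longrightarrow> r \<le> \<parallel>u \<ominus> w\<parallel>) \<Longrightarrow> r \<le> norm_setdist V W u"
  unfolding norm_setdist_def by (rule cINF_greatest) (use zero_mem in auto)

lemma norm_setdist_lessE:
  assumes "u \<in> carrier V" "norm_setdist V W u < r"
  obtains w where "w \<in> W" "\<parallel>u \<ominus> w\<parallel> < r"
  using norm_setdist_ge[of r u] assms(2) by (meson leD leI)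

lemma norm_setdist_nonneg: "u \<in> carrier V \<Longrightarrow> 0 \<le> norm_setdist V W u"
  by (rule norm_setdist_ge) (simp add: nrm_nonneg in_carrier)

lemma norm_setdist_mem: "w \<in> W \<Longrightarrow> norm_setdist V W w = 0"
  using norm_setdist_le[of w w] norm_setdist_nonneg[of w] diff_eq_zero_iff[of w w] by (simp add: in_carrier)

lemma norm_setdist_pos:
  assumes "u \<in> carrier V" "u \<notin> W"
  shows "0 < norm_setdist V W u"
proof -
  interpret Metric_space "carrier V" "nrm_dist V" by (rule Metric_space_nrm_dist)
  obtain r where r: "r > 0" "disjnt W (mball u r)"
    using closed assms unfolding nrm_topology_def closedin_metric by blast
  have "r \<le> norm_setdist V W u"
  proof (rule norm_setdist_ge)
    fix w assume "w \<in> W"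
    then have "w \<notin> mball u r" using r(2) by (auto simp: disjnt_def)
    then show "r \<le> \<parallel>u \<ominus> w\<parallel>" using assms \<open>w \<in> W\<close> by (simp add: in_carrier nrm_dist_def)
  qed
  then show ?thesis using r(1) by simp
qed

lemma norm_setdist_add:
  assumes u: "u \<in> carrier V" and v: "v \<in> carrier V"
  shows "norm_setdist V W (u \<oplus> v) \<le> norm_setdist V W u + norm_setdist V W v"
proof (rule field_le_epsilon)
  fix \<epsilon> :: real assume "\<epsilon> > 0"
  obtain w where w: "w \<in> W" "\<parallel>u \<ominus> w\<parallel> < norm_setdist V W u + \<epsilon>/2"
    using norm_setdist_lessE[OF u, of "norm_setdist V W u + \<epsilon>/2"] \<open>\<epsilon> > 0\<close> by auto
  obtain z where z: "z \<in> W" "\<parallel>v \<ominus> z\<parallel> < norm_setdist V W v + \<epsilon>/2"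
    using norm_setdist_lessE[OF v, of "norm_setdist V W v + \<epsilon>/2"] \<open>\<epsilon> > 0\<close> by auto
  note c = u v in_carrier[OF w(1)] in_carrier[OF z(1)]
  have "norm_setdist V W (u \<oplus> v) \<le> \<parallel>(u \<oplus> v) \<ominus> (w \<oplus> z)\<parallel>"
    by (intro norm_setdist_le add_mem w z) (use u v in auto)
  also have "(u \<oplus> v) \<ominus> (w \<oplus> z) = (u \<ominus> w) \<oplus> (v \<ominus> z)"
    using c by (simp add: a_minus_def M.minus_add M.a_ac)
  also have "\<parallel>\<dots>\<parallel> \<le> \<parallel>u \<ominus> w\<parallel> + \<parallel>v \<ominus> z\<parallel>" by (intro nrm_triangle) (use c in auto)
  finally show "norm_setdist V W (u \<oplus> v) \<le> norm_setdist V W u + norm_setdist V W v + \<epsilon>"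
    using w(2) z(2) by linarith
qed

lemma smult_diff: "u \<in> carrier V \<Longrightarrow> v \<in> carrier V \<Longrightarrow> a \<odot> u \<ominus> a \<odot> v = a \<odot> (u \<ominus> v)"
  using smult_r_minus[of a v] by (simp add: a_minus_def smult_add_right complex_ring_def)

lemma norm_setdist_of_nat:
  assumes u: "u \<in> carrier V"
  shows "norm_setdist V W (of_nat n \<odot> u) = real n * norm_setdist V W u"
proof (cases "n = 0")
  case True
  then show ?thesis using norm_setdist_mem[OF zero_mem] u by simp
next
  case False
  show ?thesis
  proof (rule antisym)
    have "norm_setdist V W (of_nat n \<odot> u) / real n \<le> \<parallel>u \<ominus> w\<parallel>" if w: "w \<in> W" for w
    proof -
      have "norm_setdist V W (of_nat n \<odot> u) \<le> \<parallel>of_nat n \<odot> u \<ominus> of_nat n \<odot> w\<parallel>"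
        by (intro norm_setdist_le smult_mem w) (use u in auto)
      also have "\<dots> = real n * \<parallel>u \<ominus> w\<parallel>" using u w by (simp add: smult_diff nrm_smult in_carrier)
      finally show ?thesis using False by (simp add: field_simps)
    qed
    then have "norm_setdist V W (of_nat n \<odot> u) / real n \<le> norm_setdist V W u" by (rule norm_setdist_ge)
    then show "norm_setdist V W (of_nat n \<odot> u) \<le> real n * norm_setdist V W u"
      using False by (simp add: field_simps)
    show "real n * norm_setdist V W u \<le> norm_setdist V W (of_nat n \<odot> u)"
    proof (rule norm_setdist_ge)
      fix w assume w: "w \<in> W"
      let ?z = "(1 / of_nat n) \<odot> w"
      have "of_nat n \<odot> ?z = w" using False w by (simp add: smult_mult[symmetric] in_carrier)
      then have "\<parallel>of_nat n \<odot> u \<ominus> w\<parallel> = real n * \<parallel>u \<ominus> ?z\<parallel>"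
        using smult_diff[of u ?z "of_nat n"] u w by (simp add: nrm_smult in_carrier)
      then show "real n * norm_setdist V W u \<le> \<parallel>of_nat n \<odot> u \<ominus> w\<parallel>"
        using norm_setdist_le[OF u smult_mem[OF w]] by (simp add: mult_left_mono)
    qed
  qed
qed

text \<open>As a majorant in the Hahn-Banach theorem the distance does two things at once: it is 0
  on \<open>W\<close>, which forces the functional to vanish there, and it is positive at the point
  to be separated.\<close>

lemma sublinear_norm_setdist: "sublinear V (norm_setdist V W)"
  unfolding sublinear_def
proof (intro conjI ballI allI)
  show "norm_setdist V W (v \<oplus> w) \<le> norm_setdist V W v + norm_setdist V W w"
    if "v \<in> carrier V" "w \<in> carrier V" for v w
    using that by (rule norm_setdist_add)
  show "norm_setdist V W (of_nat n \<odot> v) = real n * norm_setdist V W v" if "v \<in> carrier V" for n v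
    using that by (rule norm_setdist_of_nat)
  show "norm_setdist V W v \<le> \<parallel>v\<parallel>" if "v \<in> carrier V" for v
  proof -
    have "v \<ominus> \<zero> = v" using diff_add_cancel[of v \<zero>] that by simp
    then show ?thesis using norm_setdist_le[OF that zero_mem] by simp
  qed
qed

end

section \<open>Separation by functionals and evaluation on the dual\<close>

lemma (in complex_normed_vs) bounded_functionalD:
  assumes "f \<in> bounded_functionals V"
  shows "v \<in> carrier V \<Longrightarrow> w \<in> carrier V \<Longrightarrow> f (v \<oplus> w) = f v + f w"
    "v \<in> carrier V \<Longrightarrow> f (c \<odot> v) = c * f v"
    "v \<in> carrier V \<Longrightarrow> w \<in> carrier V \<Longrightarrow> f (v \<ominus> w) = f v - f w"
proof -
  show 1: "v \<in> carrier V \<Longrightarrow> w \<in> carrier V \<Longrightarrow> f (v \<oplus> w) = f v + f w" for v w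
    using assms by (simp add: bounded_functionals_def)
  show 2: "v \<in> carrier V \<Longrightarrow> f (c \<odot> v) = c * f v" for v c
    using assms by (simp add: bounded_functionals_def)
  show "v \<in> carrier V \<Longrightarrow> w \<in> carrier V \<Longrightarrow> f (v \<ominus> w) = f v - f w"
    using 1[of v "\<ominus> w"] 2[of w "-1"] by (simp add: a_minus_def smult_minus_1)
qed

lemma (in closed_subspace) separating_functional:
  assumes d: "norm_dense V d" and v: "v \<in> carrier V" "v \<notin> W"
  shows "\<exists>f\<in>bounded_functionals V. (\<forall>w\<in>W. f w = 0) \<and> f v \<noteq> 0"
proof -
  obtain f where f: "f \<in> bounded_functionals V" "\<And>u. u \<in> carrier V \<Longrightarrow> Re (f u) \<le> norm_setdist V W u"
    "Re (f v) = norm_setdist V W v"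
    using hahn_banach[OF sublinear_norm_setdist v(1) d] by blast
  have "f w = 0" if w: "w \<in> W" for w
  proof -
    \<comment> \<open>The factor \<open>cnj (f w)\<close> turns the bound on a real part into a
      bound on the squared modulus of \<open>f w\<close>.\<close>
    have "Re (f (cnj (f w) \<odot> w)) \<le> 0"
      using f(2)[of "cnj (f w) \<odot> w"] norm_setdist_mem[OF smult_mem[OF w]] in_carrier[OF w] by simp
    then have "(cmod (f w))\<^sup>2 \<le> 0"
    proof -
      have "Re (cnj (f w) * f w) = (cmod (f w))\<^sup>2" unfolding cmod_power2 by (simp add: power2_eq_square)
      then show ?thesis
        using \<open>Re (f (cnj (f w) \<odot> w)) \<le> 0\<close> bounded_functionalD(2)[OF f(1) in_carrier[OF w]] by simp
    qed
    then show ?thesis by simp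
  qed
  moreover have "f v \<noteq> 0" using f(3) norm_setdist_pos[OF v] by auto
  ultimately show ?thesis using f(1) by blast
qed

context complex_normed_vs
begin

lemma dual_nrm_bound:
  assumes f: "f \<in> bounded_functionals V"
  shows "v \<in> carrier V \<Longrightarrow> cmod (f v) \<le> nrm (dual V) f * \<parallel>v\<parallel>" "0 \<le> nrm (dual V) f"
proof -
  let ?B = "{v \<in> carrier V. \<parallel>v\<parallel> \<le> 1}"
  obtain C where "\<forall>v\<in>carrier V. cmod (f v) \<le> C * \<parallel>v\<parallel>"
    using f unfolding bounded_functionals_def by blast
  then have C: "\<And>v. v \<in> carrier V \<Longrightarrow> cmod (f v) \<le> C * \<parallel>v\<parallel>" by blast
  have "cmod (f v) \<le> \<bar>C\<bar>" if "v \<in> ?B" for v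
  proof -
    have "cmod (f v) \<le> C * \<parallel>v\<parallel>" using C that by simp
    also have "\<dots> \<le> \<bar>C\<bar> * 1" by (intro mult_mono) (use that nrm_nonneg in auto)
    finally show ?thesis by simp
  qed
  then have "bdd_above ((\<lambda>v. cmod (f v)) ` ?B)" by (intro bdd_aboveI2)
  then have upper: "cmod (f v) \<le> nrm (dual V) f" if "v \<in> ?B" for v
    using cSUP_upper[OF that] by (simp add: dual_def)
  show "0 \<le> nrm (dual V) f"
    using upper[of \<zero>] norm_ge_zero[of "f \<zero>"] by (simp del: norm_ge_zero)
  show "cmod (f v) \<le> nrm (dual V) f * \<parallel>v\<parallel>" if v: "v \<in> carrier V" for v
  proof (cases "\<parallel>v\<parallel> = 0")
    case True
    then show ?thesis using C[OF v] by simp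
  next
    case False
    then have pos: "\<parallel>v\<parallel> > 0" using nrm_nonneg[OF v] by simp
    have "cmod (f (of_real (1 / \<parallel>v\<parallel>) \<odot> v)) \<le> nrm (dual V) f"
      by (rule upper) (use v pos in \<open>simp add: nrm_smult norm_divide\<close>)
    then show ?thesis
      using bounded_functionalD(2)[OF f v] pos by (simp add: norm_mult norm_divide field_simps)
  qed
qed

lemma dual_nrm_le:
  assumes "\<And>v. v \<in> carrier V \<Longrightarrow> cmod (f v) \<le> \<parallel>v\<parallel>"
  shows "nrm (dual V) f \<le> 1"
proof -
  have "cmod (f v) \<le> 1" if "v \<in> carrier V" "\<parallel>v\<parallel> \<le> 1" for v using assms[OF that(1)] that(2) by simp
  moreover have "\<zero> \<in> {v \<in> carrier V. \<parallel>v\<parallel> \<le> 1}" by simp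
  ultimately show ?thesis unfolding dual_def by (auto intro!: cSUP_least)
qed

end

text \<open>By reflexivity and the Hahn-Banach theorem the evaluations at these points form a closed subset of
  a product of discs, so Tychonoff's theorem applies.\<close>

theorem (in closed_subspace) compact_evaluations:
  assumes refl: "reflexive V" and d: "norm_dense V d" and c: "c \<in> carrier V" and r: "0 \<le> r"
  shows "compact ((\<lambda>v. \<lambda>f\<in>bounded_functionals V. f v) ` {w \<in> W. \<parallel>w \<ominus> c\<parallel> \<le> r})" (is "compact ?L")
proof -
  let ?B = "bounded_functionals V" and ?n = "nrm (dual V)"
  let ?add = "\<lambda>f g. \<lambda>v\<in>carrier V. f v + g v" and ?sm = "\<lambda>a f. \<lambda>v\<in>carrier V. a * f v"
  \<comment> \<open>The ball \<open>\<parallel>v \<ominus> c\<parallel> \<le> r\<close> is expressed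
    coordinatewise by discs around \<open>f c\<close>. Outside the dual the restricted evaluations
    take the value \<open>undefined\<close>, and a singleton keeps the product compact
    there.\<close>
  define Q :: "('a \<Rightarrow> complex) \<Rightarrow> complex set" where
    "Q f = (if f \<in> ?B then cball (f c) (r * ?n f) else {undefined})" for f
  \<comment> \<open>Linearity and vanishing on the annihilator of \<open>W\<close> involve finitely
    many coordinates at a time, so they cut out closed sets. By separation the last condition forces
    a representing vector into \<open>W\<close>.\<close>
  define L :: "(('a \<Rightarrow> complex) \<Rightarrow> complex) set" where
    "L = (\<Pi>\<^sub>E f\<in>UNIV. Q f) \<inter> {\<Lambda>. \<forall>f\<in>?B. \<forall>g\<in>?B. \<Lambda> (?add f g) = \<Lambda> f + \<Lambda> g}
       \<inter> {\<Lambda>. \<forall>a. \<forall>f\<in>?B. \<Lambda> (?sm a f) = a * \<Lambda> f}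
       \<inter> {\<Lambda>. \<forall>f\<in>?B. (\<forall>w\<in>W. f w = 0) \<longrightarrow> \<Lambda> f = 0}"
  have "compactin (product_topology (\<lambda>_. euclidean) UNIV) (\<Pi>\<^sub>E f\<in>UNIV. Q f)"
    by (subst compactin_PiE) (simp add: Q_def)
  then have compact: "compact (\<Pi>\<^sub>E f\<in>UNIV. Q f)" by (simp add: euclidean_product_topology)
  have cont: "continuous_on UNIV (\<lambda>\<Lambda>. \<Lambda> f)" for f :: "'a \<Rightarrow> complex" by (rule continuous_on_product_coordinates)
  have "closed {\<Lambda> :: ('a \<Rightarrow> complex) \<Rightarrow> complex. \<Lambda> (?add f g) = \<Lambda> f + \<Lambda> g}" for f g
    by (rule closed_Collect_eq[OF cont continuous_on_add[OF cont cont]])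
  then have "closed (\<Inter>f\<in>?B. \<Inter>g\<in>?B. {\<Lambda> :: ('a \<Rightarrow> complex) \<Rightarrow> complex. \<Lambda> (?add f g) = \<Lambda> f + \<Lambda> g})"
    by (intro closed_INT ballI)
  moreover have "closed {\<Lambda> :: ('a \<Rightarrow> complex) \<Rightarrow> complex. \<Lambda> (?sm a f) = a * \<Lambda> f}" for a f
    by (rule closed_Collect_eq[OF cont continuous_on_mult[OF continuous_on_const cont]])
  then have "closed (\<Inter>a. \<Inter>f\<in>?B. {\<Lambda>. \<Lambda> (?sm a f) = a * \<Lambda> f})"
    by (intro closed_INT ballI)
  moreover have "closed {\<Lambda> :: ('a \<Rightarrow> complex) \<Rightarrow> complex. \<Lambda> f = 0}" for f
    by (rule closed_Collect_eq[OF cont continuous_on_const])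
  then have "closed (\<Inter>f\<in>{f \<in> ?B. \<forall>w\<in>W. f w = 0}. {\<Lambda> :: ('a \<Rightarrow> complex) \<Rightarrow> complex. \<Lambda> f = 0})"
    by (intro closed_INT ballI)
  ultimately have "compact ((\<Pi>\<^sub>E f\<in>UNIV. Q f)
      \<inter> (\<Inter>f\<in>?B. \<Inter>g\<in>?B. {\<Lambda>. \<Lambda> (?add f g) = \<Lambda> f + \<Lambda> g})
      \<inter> (\<Inter>a. \<Inter>f\<in>?B. {\<Lambda>. \<Lambda> (?sm a f) = a * \<Lambda> f})
      \<inter> (\<Inter>f\<in>{f \<in> ?B. \<forall>w\<in>W. f w = 0}. {\<Lambda>. \<Lambda> f = 0}))"
    by (intro compact_Int_closed compact)
  also have "\<dots> = L" by (auto simp: L_def)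
  finally have "compact L" .
  moreover have "?L \<subseteq> L"
  proof (rule image_subsetI)
    fix v assume "v \<in> {w \<in> W. \<parallel>w \<ominus> c\<parallel> \<le> r}"
    then have v: "v \<in> W" "\<parallel>v \<ominus> c\<parallel> \<le> r" "v \<in> carrier V" by (auto simp: in_carrier)
    have "dist (f c) (f v) \<le> r * ?n f" if f: "f \<in> ?B" for f
    proof -
      have "dist (f c) (f v) = cmod (f (v \<ominus> c))"
        using bounded_functionalD(3)[OF f v(3) c] by (simp add: dist_norm norm_minus_commute)
      also have "\<dots> \<le> ?n f * \<parallel>v \<ominus> c\<parallel>" by (rule dual_nrm_bound(1)[OF f]) (use v c in simp)
      also have "\<dots> \<le> ?n f * r" by (rule mult_left_mono[OF v(2) dual_nrm_bound(2)[OF f]])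
      finally show ?thesis by (simp add: mult.commute)
    qed
    moreover have "?add f g \<in> ?B" if f: "f \<in> ?B" and g: "g \<in> ?B" for f g
    proof -
      obtain C where "\<forall>v\<in>carrier V. cmod (f v) \<le> C * \<parallel>v\<parallel>"
        using f unfolding bounded_functionals_def by blast
      moreover obtain D where "\<forall>v\<in>carrier V. cmod (g v) \<le> D * \<parallel>v\<parallel>"
        using g unfolding bounded_functionals_def by blast
      ultimately have "\<forall>v\<in>carrier V. cmod (f v + g v) \<le> (C + D) * \<parallel>v\<parallel>"
        by (auto intro!: norm_triangle_le simp: distrib_right add_mono)
      then have "\<exists>E. \<forall>v\<in>carrier V. cmod (?add f g v) \<le> E * \<parallel>v\<parallel>" by (intro exI[of _ "C + D"]) simp
      then show ?thesis using bounded_functionalD[OF that(1)] bounded_functionalD[OF that(2)]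
        by (simp add: bounded_functionals_def distrib_left)
    qed
    moreover have "?sm a f \<in> ?B" if f: "f \<in> ?B" for a f
    proof -
      obtain C where "\<forall>v\<in>carrier V. cmod (f v) \<le> C * \<parallel>v\<parallel>"
        using f unfolding bounded_functionals_def by blast
      then have "\<forall>v\<in>carrier V. cmod (a * f v) \<le> (cmod a * C) * \<parallel>v\<parallel>"
        by (auto simp: norm_mult mult.assoc intro!: mult_left_mono)
      then have "\<exists>E. \<forall>v\<in>carrier V. cmod (?sm a f v) \<le> E * \<parallel>v\<parallel>" by (intro exI[of _ "cmod a * C"]) simp
      then show ?thesis using bounded_functionalD[OF that]
        by (simp add: bounded_functionals_def distrib_left)
    qed
    ultimately show "(\<lambda>f\<in>?B. f v) \<in> L" using v by (auto simp: L_def Q_def PiE_iff)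
  qed
  moreover have "L \<subseteq> ?L"
  proof
    fix \<Lambda> assume \<Lambda>: "\<Lambda> \<in> L"
    have ball: "cmod (\<Lambda> f - f c) \<le> r * ?n f" if "f \<in> ?B" for f
    proof -
      have "\<Lambda> f \<in> Q f" using \<Lambda> by (auto simp: L_def PiE_iff)
      then show ?thesis using that by (simp add: Q_def dist_norm norm_minus_commute)
    qed
    have "\<Lambda> f = undefined" if "f \<notin> ?B" for f
    proof -
      have "\<Lambda> f \<in> Q f" using \<Lambda> by (auto simp: L_def PiE_iff)
      then show ?thesis using that by (simp add: Q_def)
    qed
    then have ext: "\<Lambda> \<in> extensional ?B" by (auto simp: extensional_def)
    \<comment> \<open>The discs bound \<open>\<Lambda>\<close> on the dual, so it belongs to the
      bidual and reflexivity represents it by a vector.\<close>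
    have "cmod (\<Lambda> f) \<le> (\<parallel>c\<parallel> + r) * ?n f" if "f \<in> ?B" for f
      using ball[OF that] dual_nrm_bound(1)[OF that c] norm_triangle_sub[of "\<Lambda> f" "f c"]
      by (simp add: algebra_simps)
    then have "\<exists>C. \<forall>f\<in>?B. cmod (\<Lambda> f) \<le> C * ?n f" by blast
    then have "\<Lambda> \<in> carrier (dual (dual V))"
      using \<Lambda> ext unfolding dual_def[of "dual V"] bounded_functionals_def[of "dual V"]
      by (auto simp: dual_def[of V] L_def)
    then obtain v where v: "v \<in> carrier V" "\<Lambda> = (\<lambda>f\<in>?B. f v)"
      using refl unfolding reflexive_def by (auto simp: dual_def[of V])
    have "v \<in> W"
    proof (rule ccontr)
      assume "v \<notin> W"
      then obtain f where "f \<in> ?B" "\<And>w. w \<in> W \<Longrightarrow> f w = 0" "f v \<noteq> 0"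
        using separating_functional[OF d v(1)] by blast
      then show False using \<Lambda> v(2) by (auto simp: L_def)
    qed
    moreover have "\<parallel>v \<ominus> c\<parallel> \<le> r"
    proof -
      have vc: "v \<ominus> c \<in> carrier V" using v(1) c by simp
      \<comment> \<open>A functional of norm at most 1 that attains the norm at
        \<open>v \<ominus> c\<close> turns the disc condition back into the ball condition.\<close>
      obtain f where f: "f \<in> ?B" "\<And>v. v \<in> carrier V \<Longrightarrow> cmod (f v) \<le> \<parallel>v\<parallel>" "Re (f (v \<ominus> c)) = \<parallel>v \<ominus> c\<parallel>"
        using hahn_banach[OF sublinear_nrm vc d] by blast
      have "\<parallel>v \<ominus> c\<parallel> \<le> cmod (\<Lambda> f - f c)"
        using complex_Re_le_cmod[of "f (v \<ominus> c)"] f(1,3) v c bounded_functionalD(3)[OF f(1) v(1) c] by simp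
      also have "\<dots> \<le> r * ?n f" by (rule ball[OF f(1)])
      finally have le: "\<parallel>v \<ominus> c\<parallel> \<le> r * ?n f" .
      show ?thesis using le r dual_nrm_le[of f, OF f(2)] mult_left_le[of "?n f" r] by linarith
    qed
    ultimately show "\<Lambda> \<in> ?L" unfolding v(2) by (intro imageI CollectI conjI)
  qed
  ultimately show ?thesis using subset_antisym[of ?L L] by simp
qed

text \<open>Reading off the coordinates \<open>F i\<close> is continuous for the product topologies,
  so compactness survives the passage from all functionals to any chosen family.\<close>

corollary (in closed_subspace) compact_functional_image:
  fixes F :: "'i \<Rightarrow> 'a \<Rightarrow> complex"
  assumes refl: "reflexive V" and d: "norm_dense V d" and c: "c \<in> carrier V" and r: "0 \<le> r"
    and F: "\<And>i. F i \<in> bounded_functionals V"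
  shows "compact ((\<lambda>v i. Re (F i v)) ` {w \<in> W. \<parallel>w \<ominus> c\<parallel> \<le> r})"
proof -
  let ?e = "\<lambda>(\<Lambda> :: ('a \<Rightarrow> complex) \<Rightarrow> complex) i. Re (\<Lambda> (F i))"
  have "continuous_on UNIV ?e"
    by (intro continuous_on_coordinatewise_then_product continuous_on_Re continuous_on_product_coordinates)
  then have "compact (?e ` (\<lambda>v. \<lambda>f\<in>bounded_functionals V. f v) ` {w \<in> W. \<parallel>w \<ominus> c\<parallel> \<le> r})"
    by (intro compact_continuous_image compact_evaluations[OF refl d c r]) (rule continuous_on_subset, auto)
  then show ?thesis using F by (simp add: image_image)
qed

subsection \<open>Projections along compact fibres\<close>

text \<open>The rectangles over closed balls also stay inside \<open>A\<close>, which leaves room for closures when a finite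
  subcover is taken below.\<close>

theorem kunugui_novikov:
  fixes e :: "'p \<Rightarrow> 'y::{metric_space, second_countable_topology}"
  assumes X: "standard_borel X" and M: "standard_borel M"
    and \<pi>: "\<pi> \<in> M \<rightarrow>\<^sub>M (X :: 'x measure)" and e: "e \<in> borel_measurable M" and A: "A \<in> sets M"
    and fibre_open: "\<And>p. p \<in> A \<Longrightarrow>
      \<exists>U. open U \<and> e p \<in> U \<and> (\<forall>q\<in>space M. \<pi> q = \<pi> p \<longrightarrow> e q \<in> U \<longrightarrow> q \<in> A)"
  shows "\<exists>(D :: nat \<Rightarrow> 'x set) c r. (\<forall>i. D i \<in> sets X) \<and>
    (\<forall>p\<in>A. \<exists>i. \<pi> p \<in> D i \<and> e p \<in> ball (c i) (r i)) \<and>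
    (\<forall>i. \<forall>q\<in>space M. \<pi> q \<in> D i \<longrightarrow> e q \<in> cball (c i) (r i) \<longrightarrow> q \<in> A)"
proof -
  obtain S :: "'y set" where S: "countable S" "\<And>U. open U \<Longrightarrow> U \<noteq> {} \<Longrightarrow> \<exists>d\<in>S. d \<in> U"
    using countable_dense_setE by metis
  have "S \<noteq> {}" using S(2)[of UNIV] by auto
  define c where "c i = from_nat_into S (fst (prod_decode i))" for i
  define r where "r i = 1 / real (Suc (snd (prod_decode i)))" for i
  have basis: "\<exists>i. y \<in> ball (c i) (r i) \<and> cball (c i) (r i) \<subseteq> U" if U: "open U" "y \<in> U" for y U
  proof -
    obtain \<epsilon> where \<epsilon>: "\<epsilon> > 0" "cball y \<epsilon> \<subseteq> U" using U open_contains_cball by blast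
    obtain j where j: "1 / real (Suc j) < \<epsilon> / 2" using nat_approx_posE[of "\<epsilon> / 2"] \<epsilon>(1) by auto
    obtain s where s: "s \<in> S" "s \<in> ball y (1 / real (Suc j))" using S(2)[of "ball y (1 / real (Suc j))"] by auto
    obtain i where i: "from_nat_into S i = s" using from_nat_into_surj[OF S(1) s(1)] by blast
    have "c (prod_encode (i, j)) = s" "r (prod_encode (i, j)) = 1 / real (Suc j)"
      by (simp_all add: c_def r_def i)
    moreover have "cball s (1 / real (Suc j)) \<subseteq> cball y \<epsilon>"
    proof
      fix z assume "z \<in> cball s (1 / real (Suc j))"
      then show "z \<in> cball y \<epsilon>" using s(2) j dist_triangle[of y z s] by simp
    qed
    ultimately show ?thesis
      using s(2) \<epsilon>(2) by (intro exI[of _ "prod_encode (i, j)"]) (auto simp: dist_commute)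
  qed
  note Xs = standard_borel_imp_countably_separated[OF X]
  \<comment> \<open>These are the bad base points, over which the \<open>i\<close>-th closed ball
    meets the complement of \<open>A\<close>. They form only an analytic set, so good base points
    have to be found by separation.\<close>
  define Q where "Q i = \<pi> ` {q \<in> space M - A. e q \<in> cball (c i) (r i)}" for i
  have Q: "analytic_in X (Q i)" for i
    unfolding Q_def
  proof (rule analytic_in_image[OF standard_borel_imp_analytic_in[OF M] \<pi>])
    have "{q \<in> space M - A. e q \<in> cball (c i) (r i)} = e -` cball (c i) (r i) \<inter> space M - A" by blast
    then show "{q \<in> space M - A. e q \<in> cball (c i) (r i)} \<in> sets M"
      using A measurable_sets[OF e, of "cball (c i) (r i)"] by simp
  qed
  \<comment> \<open>A point of \<open>A\<close> lies in \<open>T i\<close> when the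
    \<open>i\<close>-th rectangle does not account for it: its base point is bad or its image misses
    the ball. Open fibres mean that no point lies in all of these.\<close>
  define T where "T i = {p \<in> A. \<pi> p \<in> Q i} \<union> (A - e -` ball (c i) (r i))" for i
  have T: "analytic_in M (T i)" for i
    unfolding T_def
  proof (rule analytic_in_Un)
    show "analytic_in M {p \<in> A. \<pi> p \<in> Q i}"
      by (rule analytic_in_vimage[OF standard_borel_imp_analytic_in[OF M A] Q \<pi> Xs])
    have "A - e -` ball (c i) (r i) = A - (e -` ball (c i) (r i) \<inter> space M)"
      using sets.sets_into_space[OF A] by blast
    then have "A - e -` ball (c i) (r i) \<in> sets M"
      using A measurable_sets[OF e, of "ball (c i) (r i)"] by simp
    then show "analytic_in M (A - e -` ball (c i) (r i))" by (rule standard_borel_imp_analytic_in[OF M])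
  qed
  have "(\<Inter>i. T i) = {}"
  proof (rule ccontr)
    assume "(\<Inter>i. T i) \<noteq> {}"
    then obtain p where p: "\<And>i. p \<in> T i" by blast
    then have pA: "p \<in> A" using p[of 0] by (auto simp: T_def)
    obtain U where U: "open U" "e p \<in> U" "\<forall>q\<in>space M. \<pi> q = \<pi> p \<longrightarrow> e q \<in> U \<longrightarrow> q \<in> A"
      using fibre_open[OF pA] by blast
    obtain i where i: "e p \<in> ball (c i) (r i)" "cball (c i) (r i) \<subseteq> U" using basis[OF U(1,2)] by blast
    then have "\<pi> p \<in> Q i" using p[of i] by (auto simp: T_def)
    then obtain q where "q \<in> space M - A" "e q \<in> cball (c i) (r i)" "\<pi> q = \<pi> p" by (auto simp: Q_def)
    then show False using U(3) i(2) by blast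
  qed
  then have "separated M T"
    by (rule novikov_separation[OF standard_borel_imp_countably_separated[OF M] T])
  then obtain B where B: "\<And>i. B i \<in> sets M" "\<And>i. T i \<subseteq> B i" "(\<Inter>i. B i) = {}"
    unfolding separated_def by blast
  \<comment> \<open>Points of \<open>A\<close> outside \<open>B i\<close> have a good base point, so
    their projection is disjoint from \<open>Q i\<close>. Both sets are analytic, and Lusin's
    theorem puts a Borel base between them.\<close>
  have "\<exists>D\<in>sets X. \<pi> ` (A - B i) \<subseteq> D \<and> Q i \<inter> D = {}" for i
  proof -
    have "analytic_in X (\<pi> ` (A - B i))"
      by (intro analytic_in_image[OF standard_borel_imp_analytic_in[OF M] \<pi>]) (use A B(1) in simp)
    moreover have "\<pi> ` (A - B i) \<inter> Q i = {}" using B(2)[of i] by (auto simp: T_def)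
    ultimately obtain D where "D \<in> sets X" "\<pi> ` (A - B i) \<subseteq> D" "Q i \<inter> D = {}"
      using lusin_separation[OF Xs _ Q] by metis
    then show ?thesis by blast
  qed
  then obtain D where D: "\<And>i. D i \<in> sets X" "\<And>i. \<pi> ` (A - B i) \<subseteq> D i" "\<And>i. Q i \<inter> D i = {}" by metis
  have "\<exists>i. \<pi> p \<in> D i \<and> e p \<in> ball (c i) (r i)" if p: "p \<in> A" for p
  proof -
    obtain i where i: "p \<notin> B i" using B(3) by blast
    then have "e p \<in> ball (c i) (r i)" using B(2)[of i] p by (auto simp: T_def)
    moreover have "\<pi> p \<in> D i" using D(2)[of i] i p by blast
    ultimately show ?thesis by blast
  qed
  moreover have "q \<in> A" if "q \<in> space M" "\<pi> q \<in> D i" "e q \<in> cball (c i) (r i)" for i q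
  proof (rule ccontr)
    assume "q \<notin> A"
    then have "\<pi> q \<in> Q i" using that by (auto simp: Q_def)
    then show False using D(3)[of i] that by blast
  qed
  ultimately show ?thesis using D(1) by (intro exI[of _ D] exI[of _ c] exI[of _ r]) blast
qed

text \<open>The compact sets \<open>S x\<close> replace the fixed compact ambient space of Novikov's projection theorem;
  as closures of countably many sections they can be tested for containment in a closed set by
  countably many Borel conditions.\<close>

theorem compact_fibres_empty_measurable:
  fixes e :: "'p \<Rightarrow> 'y::{metric_space, second_countable_topology}"
  assumes X: "standard_borel X" and M: "standard_borel M"
    and \<pi>: "\<pi> \<in> M \<rightarrow>\<^sub>M (X :: 'x measure)" and e: "e \<in> borel_measurable M"
    and K: "K \<in> sets M" and G: "G \<in> sets M"
    and \<sigma>: "\<And>j::nat. \<sigma> j \<in> X \<rightarrow>\<^sub>M M"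
    and inj: "\<And>p q. p \<in> space M \<Longrightarrow> q \<in> space M \<Longrightarrow> \<pi> p = \<pi> q \<Longrightarrow> e p = e q \<Longrightarrow> p = q"
    and K_compact: "\<And>x. x \<in> space X \<Longrightarrow> compact (e ` {p \<in> K. \<pi> p = x})"
    and S_compact: "\<And>x. x \<in> space X \<Longrightarrow> compact (S x)"
    and K_S: "\<And>p. p \<in> K \<Longrightarrow> e p \<in> S (\<pi> p)"
    and S_fibre: "\<And>x. x \<in> space X \<Longrightarrow> S x \<subseteq> e ` {p \<in> space M. \<pi> p = x}"
    and \<sigma>_S: "\<And>x j. x \<in> space X \<Longrightarrow> \<sigma> j x \<in> G \<Longrightarrow> e (\<sigma> j x) \<in> S x"
    and S_closure: "\<And>x. x \<in> space X \<Longrightarrow> S x \<subseteq> closure {e (\<sigma> j x) |j. \<sigma> j x \<in> G}"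
  shows "{x \<in> space X. \<forall>p\<in>K. \<pi> p \<noteq> x} \<in> sets X"
proof -
  have KM: "K \<subseteq> space M" using K by (rule sets.sets_into_space)
  have \<pi>X: "p \<in> space M \<Longrightarrow> \<pi> p \<in> space X" for p using measurable_space[OF \<pi>] .
  \<comment> \<open>On each fibre the image of \<open>K\<close> is compact, hence closed, and its
    complement is the desired neighbourhood; injectivity on fibres keeps points outside
    \<open>K\<close> from having an image in it.\<close>
  have "\<exists>U. open U \<and> e p \<in> U \<and> (\<forall>q\<in>space M. \<pi> q = \<pi> p \<longrightarrow> e q \<in> U \<longrightarrow> q \<in> space M - K)"
    if p: "p \<in> space M - K" for p
  proof (intro exI conjI ballI impI)
    show "open (- e ` {q \<in> K. \<pi> q = \<pi> p})"
      using K_compact[of "\<pi> p"] \<pi>X p by (simp add: compact_imp_closed open_Compl)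
    show "e p \<in> - e ` {q \<in> K. \<pi> q = \<pi> p}"
    proof
      assume "e p \<in> e ` {q \<in> K. \<pi> q = \<pi> p}"
      then obtain q where "q \<in> K" "\<pi> q = \<pi> p" "e p = e q" by blast
      moreover from this have "p = q" using inj[of p q] p KM by auto
      ultimately show False using p by simp
    qed
    fix q assume "q \<in> space M" "\<pi> q = \<pi> p" "e q \<in> - e ` {q \<in> K. \<pi> q = \<pi> p}"
    then show "q \<in> space M - K" by auto
  qed
  note nbhd = this
  have "\<exists>(D :: nat \<Rightarrow> 'x set) c r. (\<forall>i. D i \<in> sets X) \<and>
    (\<forall>p\<in>space M - K. \<exists>i. \<pi> p \<in> D i \<and> e p \<in> ball (c i) (r i)) \<and>
    (\<forall>i. \<forall>q\<in>space M. \<pi> q \<in> D i \<longrightarrow> e q \<in> cball (c i) (r i) \<longrightarrow> q \<in> space M - K)"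
    by (rule kunugui_novikov[OF X M \<pi> e sets.compl_sets[OF K]]) (rule nbhd)
  then obtain D :: "nat \<Rightarrow> 'x set" and c :: "nat \<Rightarrow> 'y" and r :: "nat \<Rightarrow> real" where "\<forall>i. D i \<in> sets X"
    and "\<forall>p\<in>space M - K. \<exists>i. \<pi> p \<in> D i \<and> e p \<in> ball (c i) (r i)"
    and "\<forall>i. \<forall>q\<in>space M. \<pi> q \<in> D i \<longrightarrow> e q \<in> cball (c i) (r i) \<longrightarrow> q \<in> space M - K"
    by (elim exE conjE) (rule that)
  then have D: "\<And>i. D i \<in> sets X"
    and cover: "\<And>p. p \<in> space M - K \<Longrightarrow> \<exists>i. \<pi> p \<in> D i \<and> e p \<in> ball (c i) (r i)"
    and avoid: "\<And>i q. q \<in> space M \<Longrightarrow> \<pi> q \<in> D i \<Longrightarrow> e q \<in> cball (c i) (r i) \<Longrightarrow> q \<in> space M - K"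
    by blast+
  \<comment> \<open>If the fibre of \<open>K\<close> is empty, the open balls of the rectangles over
    \<open>x\<close> cover \<open>S x\<close>, and compactness leaves finitely many. Conversely, a
    finite union of closed balls is closed and contains \<open>S x\<close> once it contains the
    dense points, while no point of \<open>K\<close> over \<open>x\<close> maps into it.\<close>
  have "(\<forall>p\<in>K. \<pi> p \<noteq> x) \<longleftrightarrow> (\<exists>I. finite I \<and> (\<forall>i\<in>I. x \<in> D i) \<and>
      (\<forall>j. \<sigma> j x \<in> G \<longrightarrow> e (\<sigma> j x) \<in> (\<Union>i\<in>I. cball (c i) (r i))))"
    (is "?empty \<longleftrightarrow> ?covered") if x: "x \<in> space X" for x
  proof
    assume empty: ?empty
    have "S x \<subseteq> (\<Union>i\<in>{i. x \<in> D i}. ball (c i) (r i))"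
    proof
      fix y assume "y \<in> S x"
      then obtain p where p: "p \<in> space M" "\<pi> p = x" "y = e p" using S_fibre[OF x] by blast
      then have "p \<in> space M - K" using empty by blast
      then show "y \<in> (\<Union>i\<in>{i. x \<in> D i}. ball (c i) (r i))" using cover p by blast
    qed
    then obtain I where I: "I \<subseteq> {i. x \<in> D i}" "finite I" "S x \<subseteq> (\<Union>i\<in>I. ball (c i) (r i))"
      by (rule compactE_image[OF S_compact[OF x], rotated]) auto
    moreover have "ball (c i) (r i) \<subseteq> cball (c i) (r i)" for i by auto
    ultimately show ?covered using \<sigma>_S[OF x] by (intro exI[of _ I]) blast
  next
    assume ?covered
    then obtain I where I: "finite I" "\<And>i. i \<in> I \<Longrightarrow> x \<in> D i"
      "\<And>j. \<sigma> j x \<in> G \<Longrightarrow> e (\<sigma> j x) \<in> (\<Union>i\<in>I. cball (c i) (r i))" by blast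
    have "closed (\<Union>i\<in>I. cball (c i) (r i))" using I(1) by auto
    moreover have "{e (\<sigma> j x) |j. \<sigma> j x \<in> G} \<subseteq> (\<Union>i\<in>I. cball (c i) (r i))" using I(3) by blast
    ultimately have S: "S x \<subseteq> (\<Union>i\<in>I. cball (c i) (r i))"
      using S_closure[OF x] closure_minimal by (meson subset_trans)
    show ?empty
    proof
      fix p assume p: "p \<in> K"
      show "\<pi> p \<noteq> x"
      proof
        assume "\<pi> p = x"
        then obtain i where "i \<in> I" "e p \<in> cball (c i) (r i)" using K_S[OF p] S by blast
        then show False using avoid[of p i] I(2)[of i] KM p \<open>\<pi> p = x\<close> by blast
      qed
    qed
  qed
  note iff = this
  \<comment> \<open>The union is countable because \<open>I\<close> ranges over finite sets of
    natural numbers.\<close>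
  have "{x \<in> space X. \<forall>p\<in>K. \<pi> p \<noteq> x} = (\<Union>I\<in>{I. finite I}.
      {x \<in> space X. \<forall>i\<in>I. x \<in> D i} \<inter>
      {x \<in> space X. \<forall>j. \<sigma> j x \<in> G \<longrightarrow> e (\<sigma> j x) \<in> (\<Union>i\<in>I. cball (c i) (r i))})"
    (is "?l = ?r")
  proof (rule Set.set_eqI)
    fix x show "x \<in> ?l \<longleftrightarrow> x \<in> ?r"
    proof (cases "x \<in> space X")
      case True
      show ?thesis using iff[OF True] True by simp
    qed simp
  qed
  also have "\<dots> \<in> sets X"
  proof (rule sets.countable_UN'')
    show "countable {I :: nat set. finite I}" by (rule countable_Collect_finite)
  next
    fix I :: "nat set" assume "I \<in> {I. finite I}"
    then have "finite I" by simp
    have "{x \<in> space X. x \<in> D i} = D i" for i using sets.sets_into_space[OF D[of i]] by auto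
    then have "{x \<in> space X. x \<in> D i} \<in> sets X" for i using D[of i] by simp
    then have "{x \<in> space X. \<forall>i\<in>I. x \<in> D i} \<in> sets X"
      using \<open>finite I\<close> by (rule sets.sets_Collect_finite_All)
    moreover have F: "closed (\<Union>i\<in>I. cball (c i) (r i))" using \<open>finite I\<close> by auto
    have 1: "{x \<in> space X. \<sigma> j x \<in> G \<longrightarrow> e (\<sigma> j x) \<in> (\<Union>i\<in>I. cball (c i) (r i))} \<in> sets X" for j
    proof -
      have "\<sigma> j -` G \<inter> space X \<in> sets X" using measurable_sets[OF \<sigma> G] .
      moreover have "(\<lambda>x. e (\<sigma> j x)) -` (\<Union>i\<in>I. cball (c i) (r i)) \<inter> space X \<in> sets X"
        by (rule measurable_sets[OF measurable_compose[OF \<sigma> e]]) (use F in simp)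
      ultimately have "(space X - (\<sigma> j -` G \<inter> space X)) \<union>
          ((\<lambda>x. e (\<sigma> j x)) -` (\<Union>i\<in>I. cball (c i) (r i)) \<inter> space X) \<in> sets X"
        by (intro sets.Un sets.compl_sets)
      also have "(space X - (\<sigma> j -` G \<inter> space X)) \<union>
          ((\<lambda>x. e (\<sigma> j x)) -` (\<Union>i\<in>I. cball (c i) (r i)) \<inter> space X)
          = {x \<in> space X. \<sigma> j x \<in> G \<longrightarrow> e (\<sigma> j x) \<in> (\<Union>i\<in>I. cball (c i) (r i))}" by auto
      finally show ?thesis .
    qed
    ultimately show "{x \<in> space X. \<forall>i\<in>I. x \<in> D i} \<inter> {x \<in> space X. \<forall>j. \<sigma> j x \<in> G \<longrightarrow>
        e (\<sigma> j x) \<in> (\<Union>i\<in>I. cball (c i) (r i))} \<in> sets X"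
      using sets.sets_Collect_countable_All[OF 1] by (intro sets.Int)
  qed
  finally show ?thesis .
qed

subsection \<open>Weak coordinates on a Borel field\<close>

lemma tendsto_fun:
  fixes f :: "'c \<Rightarrow> 'i \<Rightarrow> 'b::topological_space"
  assumes "\<And>i. ((\<lambda>k. f k i) \<longlongrightarrow> l i) F"
  shows "(f \<longlongrightarrow> l) F"
proof -
  have "limitin (product_topology (\<lambda>_. euclidean) UNIV) f l F"
    using assms by (simp add: limitin_componentwise extensional_UNIV)
  then show ?thesis by (simp add: euclidean_product_topology)
qed

lemma (in complex_normed_vs) add_diff_cancel:
  assumes "v \<in> carrier V" "w \<in> carrier V" shows "(v \<oplus> w) \<ominus> v = w"
proof -
  have "(v \<oplus> w) \<ominus> v = \<ominus> v \<oplus> (v \<oplus> w)"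
    using assms M.a_comm[of "v \<oplus> w" "\<ominus> v"] by (simp add: a_minus_def)
  then show ?thesis using assms by (simp add: M.r_neg1)
qed

context borel_field
begin

definition borel_section :: "('x \<Rightarrow> 'a) \<Rightarrow> bool" where
  "borel_section s \<longleftrightarrow> (\<lambda>x. (x, s x)) \<in> X \<rightarrow>\<^sub>M M"

lemma normed: "x \<in> space X \<Longrightarrow> complex_normed_vs (V x)"
  using banach complex_banach.axioms(1) by blast

lemma mem_space_M: "p \<in> space M \<longleftrightarrow> fst p \<in> space X \<and> snd p \<in> carrier (V (fst p))"
  by (cases p) (simp add: space_total)

lemma borel_section_carrier: "borel_section s \<Longrightarrow> x \<in> space X \<Longrightarrow> s x \<in> carrier (V x)"
  using measurable_space[of "\<lambda>x. (x, s x)" X M x] by (simp add: borel_section_def space_total)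

lemma measurable_add_section:
  assumes s: "borel_section s"
  shows "(\<lambda>p. (fst p, snd p \<oplus>\<^bsub>V (fst p)\<^esub> s (fst p))) \<in> M \<rightarrow>\<^sub>M M"
proof -
  let ?S = "{(p, q) \<in> space M \<times> space M. fst p = fst q}"
  have "(\<lambda>p. (p, (fst p, s (fst p)))) \<in> M \<rightarrow>\<^sub>M restrict_space (M \<Otimes>\<^sub>M M) ?S"
  proof (rule measurable_restrict_space2)
    show "(\<lambda>p. (p, (fst p, s (fst p)))) \<in> space M \<rightarrow> ?S"
      using borel_section_carrier[OF s] by (auto simp: space_total)
    show "(\<lambda>p. (p, (fst p, s (fst p)))) \<in> M \<rightarrow>\<^sub>M M \<Otimes>\<^sub>M M"
      using s unfolding borel_section_def
      by (intro measurable_Pair measurable_ident_sets refl measurable_compose[OF measurable_proj])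
  qed
  from measurable_compose[OF this measurable_add] show ?thesis by (simp add: case_prod_beta)
qed

lemma measurable_norm: "(\<lambda>p. \<parallel>snd p\<parallel>\<^bsub>V (fst p)\<^esub>) \<in> borel_measurable M"
  using measurable_nrm by (simp add: measurable_restrict_space2_iff case_prod_beta')

lemma measurable_smult_const: "(\<lambda>p. (fst p, c \<odot>\<^bsub>V (fst p)\<^esub> snd p)) \<in> M \<rightarrow>\<^sub>M M"
proof -
  have "(\<lambda>p. (c, p)) \<in> M \<rightarrow>\<^sub>M borel \<Otimes>\<^sub>M M" by measurable
  from measurable_compose[OF this measurable_smult] show ?thesis by (simp add: case_prod_beta)
qed

lemma borel_section_smult: "borel_section s \<Longrightarrow> borel_section (\<lambda>x. c \<odot>\<^bsub>V x\<^esub> s x)"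
  using measurable_compose[OF _ measurable_smult_const, of "\<lambda>x. (x, s x)" X c]
  by (simp add: borel_section_def)

text \<open>The axioms of a field speak of addition and scalars; the difference is written as the
  sum with the multiple by -1.\<close>

lemma measurable_dist_section:
  assumes s: "borel_section s"
  shows "(\<lambda>p. \<parallel>snd p \<ominus>\<^bsub>V (fst p)\<^esub> s (fst p)\<parallel>\<^bsub>V (fst p)\<^esub>) \<in> borel_measurable M"
proof -
  have "(\<lambda>p. \<parallel>snd p \<oplus>\<^bsub>V (fst p)\<^esub> (-1) \<odot>\<^bsub>V (fst p)\<^esub> s (fst p)\<parallel>\<^bsub>V (fst p)\<^esub>) \<in> borel_measurable M"
    using measurable_compose[OF measurable_add_section[OF borel_section_smult[OF s]] measurable_norm] by simp
  moreover have "\<parallel>snd p \<ominus>\<^bsub>V (fst p)\<^esub> s (fst p)\<parallel>\<^bsub>V (fst p)\<^esub>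
      = \<parallel>snd p \<oplus>\<^bsub>V (fst p)\<^esub> (-1) \<odot>\<^bsub>V (fst p)\<^esub> s (fst p)\<parallel>\<^bsub>V (fst p)\<^esub>" if "p \<in> space M" for p
    using that complex_normed_vs.smult_minus_1[OF normed] borel_section_carrier[OF s]
    by (simp add: mem_space_M a_minus_def)
  ultimately show ?thesis using measurable_cong by (metis (no_types, lifting))
qed

text \<open>Each step evaluates the preceding functional at translates by multiples of a Borel
  section and then takes a limit of a sequence; both preserve Borel functions on the total
  space.\<close>

lemma measurable_hb:
  assumes d: "\<And>k. borel_section (d k)"
  shows "(\<lambda>p. hb (V (fst p)) (nrm (V (fst p))) (\<lambda>k. d k (fst p)) (snd p)) \<in> borel_measurable M"
proof -
  have seq: "(\<lambda>p. hb_seq (V (fst p)) (nrm (V (fst p))) (\<lambda>k. d k (fst p)) k (snd p)) \<in> borel_measurable M" for k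
  proof (induction k)
    case 0
    show ?case using measurable_norm by simp
  next
    case (Suc k)
    let ?q = "\<lambda>x. hb_seq (V x) (nrm (V x)) (\<lambda>k. d k x) k"
    have "(\<lambda>p. ?q (fst p) (snd p \<oplus>\<^bsub>V (fst p)\<^esub> (of_nat n \<odot>\<^bsub>V (fst p)\<^esub> d k (fst p)))) \<in> borel_measurable M" for n :: nat
      using measurable_compose[OF measurable_add_section[OF borel_section_smult[OF d]] Suc] by simp
    moreover have "(\<lambda>p. ?q (fst p) (d k (fst p))) \<in> borel_measurable M"
      using measurable_compose[OF measurable_compose[OF measurable_proj d[of k, unfolded borel_section_def]] Suc]
      by simp
    ultimately show ?case
      unfolding hb_seq.simps hb_step_def
      by (intro borel_measurable_lim_metric borel_measurable_diff borel_measurable_times borel_measurable_const)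
  qed
  show ?thesis unfolding hb_def by (intro borel_measurable_lim_metric seq)
qed

text \<open>Through this the compactness theorem for balls in a closed subspace also covers balls of
  the whole fibre.\<close>

lemma closed_subspace_carrier:
  assumes "x \<in> space X" shows "closed_subspace (V x) (carrier (V x))"
proof -
  interpret complex_normed_vs "V x" using normed[OF assms] .
  interpret Metric_space "carrier (V x)" "nrm_dist (V x)" by (rule Metric_space_nrm_dist)
  show ?thesis
    by unfold_locales (use carrier_is_submodule closedin_topspace[of mtopology] in \<open>auto simp: nrm_topology_def\<close>)
qed

end

section \<open>Norming functionals along the dense sections\<close>

locale borel_field_sections = borel_field +
  fixes \<phi> :: "nat \<Rightarrow> 'a \<Rightarrow> 'b"
  assumes dense_\<phi>: "dense_borel_sections X V M \<phi>"
begin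

lemma section_\<phi>: "borel_section (\<phi> n)"
  using dense_\<phi> by (simp add: dense_borel_sections_def borel_section_def)

lemma norm_dense_\<phi>:
  assumes x: "x \<in> space X"
  shows "norm_dense (V x) (\<lambda>n. \<phi> n x)"
  unfolding norm_dense_def
proof (intro conjI ballI allI impI)
  interpret complex_normed_vs "V x" using normed[OF x] .
  interpret Metric_space "carrier (V x)" "nrm_dist (V x)" by (rule Metric_space_nrm_dist)
  show sub: "range (\<lambda>n. \<phi> n x) \<subseteq> carrier (V x)"
    using borel_section_carrier[OF section_\<phi> x] by blast
  fix v and \<epsilon> :: real assume v: "v \<in> carrier (V x)" and "\<epsilon> > 0"
  have "v \<in> Abstract_Topology.closure_of mtopology (range (\<lambda>n. \<phi> n x))"
    using dense_\<phi> x v by (simp add: dense_borel_sections_def nrm_topology_def)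
  then obtain w where "w \<in> range (\<lambda>n. \<phi> n x)" "w \<in> mball v \<epsilon>"
    using \<open>\<epsilon> > 0\<close> unfolding metric_closure_of by blast
  then show "\<exists>k. \<parallel>v \<ominus>\<^bsub>V x\<^esub> \<phi> k x\<parallel>\<^bsub>V x\<^esub> < \<epsilon>"
    using v sub by (auto simp: nrm_dist_def)
qed

text \<open>The section \<open>\<phi> m\<close> is repeated at the front so that the
  \<open>m\<close>-th functional attains the norm there.\<close>

definition dirs :: "nat \<Rightarrow> nat \<Rightarrow> 'a \<Rightarrow> 'b" where
  "dirs m = case_nat (\<phi> m) \<phi>"

definition weak_coord :: "nat \<Rightarrow> 'a \<times> 'b \<Rightarrow> real" where
  "weak_coord m p = hb (V (fst p)) (nrm (V (fst p))) (\<lambda>k. dirs m k (fst p)) (snd p)"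

definition weak_coords :: "'a \<times> 'b \<Rightarrow> nat \<Rightarrow> real" where
  "weak_coords p = (\<lambda>m. weak_coord m p)"

lemma measurable_weak_coords: "weak_coords \<in> borel_measurable M"
  unfolding weak_coords_def weak_coord_def
  by (intro measurable_coordinatewise_then_product measurable_hb)
     (auto simp: dirs_def section_\<phi> split: nat.split)

lemma norm_dense_dirs:
  assumes x: "x \<in> space X"
  shows "norm_dense (V x) (\<lambda>k. dirs m k x)"
  unfolding norm_dense_def
proof (intro conjI ballI allI impI)
  show "range (\<lambda>k. dirs m k x) \<subseteq> carrier (V x)"
    using borel_section_carrier[OF section_\<phi> x] by (auto simp: dirs_def split: nat.splits)
  fix v and \<epsilon> :: real assume "v \<in> carrier (V x)" "\<epsilon> > 0"
  then obtain k where "\<parallel>v \<ominus>\<^bsub>V x\<^esub> \<phi> k x\<parallel>\<^bsub>V x\<^esub> < \<epsilon>" using norm_denseD(1)[OF norm_dense_\<phi>[OF x]] by blast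
  then show "\<exists>k. \<parallel>v \<ominus>\<^bsub>V x\<^esub> dirs m k x\<parallel>\<^bsub>V x\<^esub> < \<epsilon>"
    by (intro exI[of _ "Suc k"]) (simp add: dirs_def)
qed

lemma weak_coord:
  assumes x: "x \<in> space X" and v: "v \<in> carrier (V x)" and w: "w \<in> carrier (V x)"
  shows "weak_coord m (x, v \<oplus>\<^bsub>V x\<^esub> w) = weak_coord m (x, v) + weak_coord m (x, w)"
    "weak_coord m (x, v) \<le> \<parallel>v\<parallel>\<^bsub>V x\<^esub>"
    "\<bar>weak_coord m (x, v) - weak_coord m (x, w)\<bar> \<le> \<parallel>v \<ominus>\<^bsub>V x\<^esub> w\<parallel>\<^bsub>V x\<^esub>"
    "weak_coord m (x, \<phi> m x) = \<parallel>\<phi> m x\<parallel>\<^bsub>V x\<^esub>"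
proof -
  interpret complex_normed_vs "V x" using normed[OF x] .
  note dense = norm_dense_dirs[OF x, of m]
  then have sub: "range (\<lambda>k. dirs m k x) \<subseteq> carrier (V x)" by (simp add: norm_dense_def)
  note hb = sublinear_hb[OF sublinear_nrm sub]
  show "weak_coord m (x, v \<oplus>\<^bsub>V x\<^esub> w) = weak_coord m (x, v) + weak_coord m (x, w)"
    using hb_additive[OF sublinear_nrm dense v w] by (simp add: weak_coord_def)
  show "weak_coord m (x, v) \<le> \<parallel>v\<parallel>\<^bsub>V x\<^esub>"
    using sublinearD(3)[OF hb v] by (simp add: weak_coord_def)
  show "\<bar>weak_coord m (x, v) - weak_coord m (x, w)\<bar> \<le> \<parallel>v \<ominus>\<^bsub>V x\<^esub> w\<parallel>\<^bsub>V x\<^esub>"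
    using sublinear_lipschitz[OF hb v w] by (simp add: weak_coord_def)
  show "weak_coord m (x, \<phi> m x) = \<parallel>\<phi> m x\<parallel>\<^bsub>V x\<^esub>"
    using hb_first_direction[OF sublinear_nrm sub] by (simp add: weak_coord_def dirs_def)
qed

text \<open>Let all coordinates vanish at a difference \<open>u\<close>, and take
  \<open>\<phi> m\<close> nearer to \<open>u\<close> than half the norm of \<open>u\<close>.
  Coordinate \<open>m\<close> attains the norm at \<open>\<phi> m\<close> and is 1-Lipschitz, so
  \<open>\<phi> m\<close> has norm less than half that of \<open>u\<close>, against the triangle
  inequality.\<close>

lemma weak_coords_inject:
  assumes x: "x \<in> space X" and v: "v \<in> carrier (V x)" and w: "w \<in> carrier (V x)"
    and eq: "weak_coords (x, v) = weak_coords (x, w)"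
  shows "v = w"
proof (rule ccontr)
  assume "v \<noteq> w"
  interpret complex_normed_vs "V x" using normed[OF x] .
  let ?u = "v \<ominus>\<^bsub>V x\<^esub> w"
  have u: "?u \<in> carrier (V x)" using v w by simp
  have pos: "\<parallel>?u\<parallel>\<^bsub>V x\<^esub> > 0" using diff_eq_zero_iff[OF v w] nrm_nonneg[OF u] \<open>v \<noteq> w\<close> by linarith
  obtain m where m: "\<parallel>?u \<ominus>\<^bsub>V x\<^esub> \<phi> m x\<parallel>\<^bsub>V x\<^esub> < \<parallel>?u\<parallel>\<^bsub>V x\<^esub> / 2"
    using norm_denseD(1)[OF norm_dense_\<phi>[OF x] u, of "\<parallel>?u\<parallel>\<^bsub>V x\<^esub> / 2"] pos by auto
  have \<phi>m: "\<phi> m x \<in> carrier (V x)" by (rule norm_denseD(2)[OF norm_dense_\<phi>[OF x]])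
  have "weak_coord m (x, v) = weak_coord m (x, w) + weak_coord m (x, ?u)"
    using weak_coord(1)[OF x w u, of m] diff_add_cancel[OF v w] by simp
  then have "weak_coord m (x, ?u) = 0" using eq by (simp add: weak_coords_def fun_eq_iff)
  moreover have "\<parallel>\<phi> m x\<parallel>\<^bsub>V x\<^esub> - weak_coord m (x, ?u) \<le> \<parallel>?u \<ominus>\<^bsub>V x\<^esub> \<phi> m x\<parallel>\<^bsub>V x\<^esub>"
    using weak_coord(3)[OF x u \<phi>m, of m] weak_coord(4)[OF x v w, of m] by linarith
  moreover have "\<parallel>?u\<parallel>\<^bsub>V x\<^esub> \<le> \<parallel>?u \<ominus>\<^bsub>V x\<^esub> \<phi> m x\<parallel>\<^bsub>V x\<^esub> + \<parallel>\<phi> m x\<parallel>\<^bsub>V x\<^esub>"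
    using sublinear_lipschitz[OF sublinear_nrm u \<phi>m] by linarith
  ultimately show False using m by linarith
qed

lemma weak_coord_functional:
  assumes x: "x \<in> space X"
  shows "\<exists>f\<in>bounded_functionals (V x). \<forall>v\<in>carrier (V x). Re (f v) = weak_coord m (x, v)"
proof -
  interpret complex_normed_vs "V x" using normed[OF x] .
  have "\<exists>f\<in>bounded_functionals (V x). \<forall>v\<in>carrier (V x).
      f v = Complex (weak_coord m (x, v)) (- weak_coord m (x, \<i> \<odot>\<^bsub>V x\<^esub> v)) \<and> cmod (f v) \<le> \<parallel>v\<parallel>\<^bsub>V x\<^esub>"
    by (rule real_part_of_bounded_functional) (use weak_coord[OF x] in blast)+
  then obtain f where "f \<in> bounded_functionals (V x)" "\<forall>v\<in>carrier (V x).
      f v = Complex (weak_coord m (x, v)) (- weak_coord m (x, \<i> \<odot>\<^bsub>V x\<^esub> v)) \<and> cmod (f v) \<le> \<parallel>v\<parallel>\<^bsub>V x\<^esub>"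
    by (rule bexE)
  then show ?thesis by (intro bexI[of _ f]) auto
qed

lemma compact_weak_coords:
  assumes x: "x \<in> space X" and refl: "reflexive (V x)" and W: "closed_subspace (V x) W"
    and c: "c \<in> carrier (V x)" and r: "0 \<le> r"
  shows "compact ((\<lambda>v. weak_coords (x, v)) ` {w \<in> W. \<parallel>w \<ominus>\<^bsub>V x\<^esub> c\<parallel>\<^bsub>V x\<^esub> \<le> r})"
proof -
  have "\<forall>m. \<exists>f. f \<in> bounded_functionals (V x) \<and> (\<forall>v\<in>carrier (V x). Re (f v) = weak_coord m (x, v))"
    using weak_coord_functional[OF x] by blast
  then obtain F where F: "\<And>m. F m \<in> bounded_functionals (V x)"
    "\<And>m v. v \<in> carrier (V x) \<Longrightarrow> Re (F m v) = weak_coord m (x, v)"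
    using choice by metis
  have "(\<lambda>v. weak_coords (x, v)) ` {w \<in> W. \<parallel>w \<ominus>\<^bsub>V x\<^esub> c\<parallel>\<^bsub>V x\<^esub> \<le> r}
      = (\<lambda>v m. Re (F m v)) ` {w \<in> W. \<parallel>w \<ominus>\<^bsub>V x\<^esub> c\<parallel>\<^bsub>V x\<^esub> \<le> r}"
    by (rule image_cong) (auto simp: F(2) weak_coords_def closed_subspace.in_carrier[OF W])
  then show ?thesis
    using closed_subspace.compact_functional_image[OF W refl norm_dense_\<phi>[OF x] c r F(1)] by simp
qed

text \<open>A point of the closed ball is first moved slightly towards the centre.\<close>

lemma weak_coords_cball_closure:
  assumes x: "x \<in> space X" and c: "c \<in> carrier (V x)" and r: "0 < r"
    and v: "v \<in> carrier (V x)" "\<parallel>v \<ominus>\<^bsub>V x\<^esub> c\<parallel>\<^bsub>V x\<^esub> \<le> r"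
  shows "weak_coords (x, v) \<in> closure {weak_coords (x, \<phi> j x) |j. \<parallel>\<phi> j x \<ominus>\<^bsub>V x\<^esub> c\<parallel>\<^bsub>V x\<^esub> < r}"
proof -
  interpret complex_normed_vs "V x" using normed[OF x] .
  have \<phi>c: "\<phi> j x \<in> carrier (V x)" for j by (rule norm_denseD(2)[OF norm_dense_\<phi>[OF x]])
  have "\<exists>j. \<parallel>\<phi> j x \<ominus>\<^bsub>V x\<^esub> c\<parallel>\<^bsub>V x\<^esub> < r \<and> \<parallel>\<phi> j x \<ominus>\<^bsub>V x\<^esub> v\<parallel>\<^bsub>V x\<^esub> < 2 * r * (1/2)^k" for k
  proof -
    define t :: real where "t = (1/2)^k"
    have t: "0 < t" "t \<le> 1" by (simp_all add: t_def power_le_one)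
    define u where "u = v \<ominus>\<^bsub>V x\<^esub> c"
    have u: "u \<in> carrier (V x)" using v c by (simp add: u_def)
    \<comment> \<open>The shrunken point lies within \<open>(1 - t) * r\<close> of \<open>c\<close>,
      which leaves room \<open>t * r\<close> for a nearby \<open>\<phi> j\<close>. Moving and
      approximating cost \<open>t * r\<close> each, hence the bound
      \<open>2 * r * t\<close>.\<close>
    define z where "z = c \<oplus>\<^bsub>V x\<^esub> of_real (1 - t) \<odot>\<^bsub>V x\<^esub> u"
    have z: "z \<in> carrier (V x)" using c u by (simp add: z_def)
    have "z \<ominus>\<^bsub>V x\<^esub> c = of_real (1 - t) \<odot>\<^bsub>V x\<^esub> u"
      using c u by (simp add: z_def add_diff_cancel)
    then have zc: "\<parallel>z \<ominus>\<^bsub>V x\<^esub> c\<parallel>\<^bsub>V x\<^esub> \<le> (1 - t) * r"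
      using u t v(2) by (simp add: nrm_smult u_def[symmetric] mult_left_mono norm_of_real[of "1 - t", simplified] del: of_real_diff)
    have "v = z \<oplus>\<^bsub>V x\<^esub> of_real t \<odot>\<^bsub>V x\<^esub> u"
    proof -
      have "z \<oplus>\<^bsub>V x\<^esub> of_real t \<odot>\<^bsub>V x\<^esub> u = c \<oplus>\<^bsub>V x\<^esub> (of_real (1 - t) + of_real t) \<odot>\<^bsub>V x\<^esub> u"
        using c u by (simp only: smult_add_left z_def) (simp add: M.a_assoc)
      also have "\<dots> = v" using u c v(1) by (simp add: u_def diff_add_cancel)
      finally show ?thesis by simp
    qed
    then have "v \<ominus>\<^bsub>V x\<^esub> z = of_real t \<odot>\<^bsub>V x\<^esub> u"
      using z u by (simp add: add_diff_cancel)
    then have zv: "\<parallel>v \<ominus>\<^bsub>V x\<^esub> z\<parallel>\<^bsub>V x\<^esub> \<le> t * r"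
      using u t v(2) by (simp add: nrm_smult u_def[symmetric])
    obtain j where j: "\<parallel>z \<ominus>\<^bsub>V x\<^esub> \<phi> j x\<parallel>\<^bsub>V x\<^esub> < t * r"
      using norm_denseD(1)[OF norm_dense_\<phi>[OF x] z, of "t * r"] t r by auto
    then have j': "\<parallel>\<phi> j x \<ominus>\<^bsub>V x\<^esub> z\<parallel>\<^bsub>V x\<^esub> < t * r" using nrm_minus_commute[OF z \<phi>c] by simp
    have "\<parallel>\<phi> j x \<ominus>\<^bsub>V x\<^esub> c\<parallel>\<^bsub>V x\<^esub> < r"
      using nrm_diff_triangle[OF \<phi>c z c, of j] j' zc by (simp add: algebra_simps)
    moreover have "\<parallel>\<phi> j x \<ominus>\<^bsub>V x\<^esub> v\<parallel>\<^bsub>V x\<^esub> < 2 * r * t"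
      using nrm_diff_triangle[OF \<phi>c z v(1), of j] j' zv nrm_minus_commute[OF z v(1)] by (simp add: algebra_simps)
    ultimately show ?thesis by (auto simp: t_def)
  qed
  then obtain J where J: "\<And>k. \<parallel>\<phi> (J k) x \<ominus>\<^bsub>V x\<^esub> c\<parallel>\<^bsub>V x\<^esub> < r"
    "\<And>k. \<parallel>\<phi> (J k) x \<ominus>\<^bsub>V x\<^esub> v\<parallel>\<^bsub>V x\<^esub> < 2 * r * (1/2)^k" by metis
  have "(\<lambda>k. weak_coords (x, \<phi> (J k) x)) \<longlonglongrightarrow> weak_coords (x, v)"
  proof (rule tendsto_fun)
    fix m
    have "\<bar>weak_coord m (x, \<phi> (J k) x) - weak_coord m (x, v)\<bar> \<le> 2 * r * (1/2)^k" for k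
      using weak_coord(3)[OF x \<phi>c v(1), of m "J k"] J(2)[of k] by linarith
    moreover have "(\<lambda>k. 2 * r * (1/2)^k) \<longlonglongrightarrow> 2 * r * 0"
      by (intro tendsto_mult tendsto_const LIMSEQ_realpow_zero) auto
    ultimately show "(\<lambda>k. weak_coords (x, \<phi> (J k) x) m) \<longlonglongrightarrow> weak_coords (x, v) m"
    proof -
      assume le: "\<And>k. \<bar>weak_coord m (x, \<phi> (J k) x) - weak_coord m (x, v)\<bar> \<le> 2 * r * (1/2)^k"
        and lim: "(\<lambda>k. 2 * r * (1/2)^k) \<longlonglongrightarrow> 2 * r * 0"
      have "(\<lambda>k. weak_coord m (x, \<phi> (J k) x) - weak_coord m (x, v)) \<longlonglongrightarrow> 0"
        by (rule Lim_null_comparison[OF always_eventually lim[simplified]]) (use le in simp)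
      then show ?thesis unfolding weak_coords_def by (rule LIM_zero_cancel)
    qed
  qed
  moreover have "weak_coords (x, \<phi> (J k) x)
      \<in> {weak_coords (x, \<phi> j x) |j. \<parallel>\<phi> j x \<ominus>\<^bsub>V x\<^esub> c\<parallel>\<^bsub>V x\<^esub> < r}" for k
    using J(1)[of k] by blast
  ultimately show ?thesis unfolding closure_sequential
    by (intro exI[of _ "\<lambda>k. weak_coords (x, \<phi> (J k) x)"]) blast
qed

end

section \<open>The distance to the subfield\<close>

locale reflexive_subfield = borel_field_sections +
  fixes W :: "('a \<times> 'b) set"
  assumes reflexive: "x \<in> space X \<Longrightarrow> reflexive (V x)"
    and W_sets: "W \<in> sets M"
    and W_closed_subspace: "x \<in> space X \<Longrightarrow> closed_subspace (V x) (fiber W x)"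
begin

abbreviation setdist :: "nat \<Rightarrow> 'a \<Rightarrow> real" where
  "setdist n x \<equiv> norm_setdist (V x) (fiber W x) (\<phi> n x)"

lemma section_carrier: "x \<in> space X \<Longrightarrow> \<phi> n x \<in> carrier (V x)"
  by (rule borel_section_carrier[OF section_\<phi>])

lemma W_subset: "p \<in> W \<Longrightarrow> p \<in> space M"
  using sets.sets_into_space[OF W_sets] by blast

text \<open>The compact sets \<open>S x\<close> are the images of the closed balls in the whole
  fibre, and \<open>G\<close> is the corresponding open ball, inside which the sections
  \<open>\<phi> j\<close> are dense. At \<open>r = 0\<close> that open ball would be empty while the
  closed one is a point.\<close>

lemma measurable_ball_misses:
  assumes r: "0 < r"
  shows "{x \<in> space X. \<forall>p\<in>{p \<in> W. \<parallel>snd p \<ominus>\<^bsub>V (fst p)\<^esub> \<phi> n (fst p)\<parallel>\<^bsub>V (fst p)\<^esub> \<le> r}. fst p \<noteq> x} \<in> sets X"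
proof (rule compact_fibres_empty_measurable[where e = weak_coords and \<pi> = fst and M = M
      and \<sigma> = "\<lambda>j x. (x, \<phi> j x)"
      and G = "{p \<in> space M. \<parallel>snd p \<ominus>\<^bsub>V (fst p)\<^esub> \<phi> n (fst p)\<parallel>\<^bsub>V (fst p)\<^esub> < r}"
      and S = "\<lambda>x. (\<lambda>v. weak_coords (x, v)) ` {v \<in> carrier (V x). \<parallel>v \<ominus>\<^bsub>V x\<^esub> \<phi> n x\<parallel>\<^bsub>V x\<^esub> \<le> r}"])
  note dist[measurable] = measurable_dist_section[OF section_\<phi>[of n]]
  show "standard_borel X" "standard_borel M" "fst \<in> M \<rightarrow>\<^sub>M X" "weak_coords \<in> borel_measurable M"
    by (rule base total measurable_proj measurable_weak_coords)+
  have "{p \<in> space M. \<parallel>snd p \<ominus>\<^bsub>V (fst p)\<^esub> \<phi> n (fst p)\<parallel>\<^bsub>V (fst p)\<^esub> \<le> r} \<inter> W \<in> sets M"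
    using W_sets by (intro sets.Int) measurable
  also have "{p \<in> space M. \<parallel>snd p \<ominus>\<^bsub>V (fst p)\<^esub> \<phi> n (fst p)\<parallel>\<^bsub>V (fst p)\<^esub> \<le> r} \<inter> W
      = {p \<in> W. \<parallel>snd p \<ominus>\<^bsub>V (fst p)\<^esub> \<phi> n (fst p)\<parallel>\<^bsub>V (fst p)\<^esub> \<le> r}"
    using W_subset by blast
  finally show "{p \<in> W. \<parallel>snd p \<ominus>\<^bsub>V (fst p)\<^esub> \<phi> n (fst p)\<parallel>\<^bsub>V (fst p)\<^esub> \<le> r} \<in> sets M" .
  show "{p \<in> space M. \<parallel>snd p \<ominus>\<^bsub>V (fst p)\<^esub> \<phi> n (fst p)\<parallel>\<^bsub>V (fst p)\<^esub> < r} \<in> sets M"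
    by measurable
  show "(\<lambda>x. (x, \<phi> j x)) \<in> X \<rightarrow>\<^sub>M M" for j using section_\<phi> by (simp add: borel_section_def)
  show "p = q" if "p \<in> space M" "q \<in> space M" "fst p = fst q" "weak_coords p = weak_coords q" for p q
  proof -
    obtain x v w where pq: "p = (x, v)" "q = (x, w)" using \<open>fst p = fst q\<close> by (metis prod.collapse)
    have "v = w"
      by (rule weak_coords_inject[of x]) (use that(1,2,4) in \<open>auto simp: pq mem_space_M\<close>)
    then show ?thesis by (simp add: pq)
  qed
  fix x assume x: "x \<in> space X"
  have "weak_coords ` {p \<in> {p \<in> W. \<parallel>snd p \<ominus>\<^bsub>V (fst p)\<^esub> \<phi> n (fst p)\<parallel>\<^bsub>V (fst p)\<^esub> \<le> r}. fst p = x}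
      = (\<lambda>v. weak_coords (x, v)) ` {w \<in> fiber W x. \<parallel>w \<ominus>\<^bsub>V x\<^esub> \<phi> n x\<parallel>\<^bsub>V x\<^esub> \<le> r}"
  proof -
    have "{p \<in> {p \<in> W. \<parallel>snd p \<ominus>\<^bsub>V (fst p)\<^esub> \<phi> n (fst p)\<parallel>\<^bsub>V (fst p)\<^esub> \<le> r}. fst p = x}
        = Pair x ` {w \<in> fiber W x. \<parallel>w \<ominus>\<^bsub>V x\<^esub> \<phi> n x\<parallel>\<^bsub>V x\<^esub> \<le> r}"
      by (auto simp: fiber_def)
    then show ?thesis by (simp only: image_image)
  qed
  then show "compact (weak_coords ` {p \<in> {p \<in> W. \<parallel>snd p \<ominus>\<^bsub>V (fst p)\<^esub> \<phi> n (fst p)\<parallel>\<^bsub>V (fst p)\<^esub> \<le> r}. fst p = x})"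
    using compact_weak_coords[OF x reflexive[OF x] W_closed_subspace[OF x] section_carrier[OF x], of r n] r
    by simp
  show "compact ((\<lambda>v. weak_coords (x, v)) ` {v \<in> carrier (V x). \<parallel>v \<ominus>\<^bsub>V x\<^esub> \<phi> n x\<parallel>\<^bsub>V x\<^esub> \<le> r})"
    using compact_weak_coords[OF x reflexive[OF x] closed_subspace_carrier[OF x] section_carrier[OF x], of r n] r
    by simp
  show "(\<lambda>v. weak_coords (x, v)) ` {v \<in> carrier (V x). \<parallel>v \<ominus>\<^bsub>V x\<^esub> \<phi> n x\<parallel>\<^bsub>V x\<^esub> \<le> r}
      \<subseteq> weak_coords ` {p \<in> space M. fst p = x}"
  proof (rule image_subsetI)
    fix v assume "v \<in> {v \<in> carrier (V x). \<parallel>v \<ominus>\<^bsub>V x\<^esub> \<phi> n x\<parallel>\<^bsub>V x\<^esub> \<le> r}"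
    then have "(x, v) \<in> {p \<in> space M. fst p = x}" using x by (simp add: mem_space_M)
    then show "weak_coords (x, v) \<in> weak_coords ` {p \<in> space M. fst p = x}" by (rule imageI)
  qed
  show "weak_coords (x, \<phi> j x) \<in> (\<lambda>v. weak_coords (x, v)) ` {v \<in> carrier (V x). \<parallel>v \<ominus>\<^bsub>V x\<^esub> \<phi> n x\<parallel>\<^bsub>V x\<^esub> \<le> r}"
    if "(x, \<phi> j x) \<in> {p \<in> space M. \<parallel>snd p \<ominus>\<^bsub>V (fst p)\<^esub> \<phi> n (fst p)\<parallel>\<^bsub>V (fst p)\<^esub> < r}" for j
    using that section_carrier[OF x] by (intro imageI) simp
  have "{weak_coords (x, \<phi> j x) |j. (x, \<phi> j x) \<in> {p \<in> space M. \<parallel>snd p \<ominus>\<^bsub>V (fst p)\<^esub> \<phi> n (fst p)\<parallel>\<^bsub>V (fst p)\<^esub> < r}}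
      = {weak_coords (x, \<phi> j x) |j. \<parallel>\<phi> j x \<ominus>\<^bsub>V x\<^esub> \<phi> n x\<parallel>\<^bsub>V x\<^esub> < r}"
    using x section_carrier[OF x] by (simp add: mem_space_M)
  then show "(\<lambda>v. weak_coords (x, v)) ` {v \<in> carrier (V x). \<parallel>v \<ominus>\<^bsub>V x\<^esub> \<phi> n x\<parallel>\<^bsub>V x\<^esub> \<le> r}
      \<subseteq> closure {weak_coords (x, \<phi> j x) |j. (x, \<phi> j x) \<in> {p \<in> space M. \<parallel>snd p \<ominus>\<^bsub>V (fst p)\<^esub> \<phi> n (fst p)\<parallel>\<^bsub>V (fst p)\<^esub> < r}}"
    using weak_coords_cball_closure[OF x section_carrier[OF x] r] by auto
next
  fix p assume p: "p \<in> {p \<in> W. \<parallel>snd p \<ominus>\<^bsub>V (fst p)\<^esub> \<phi> n (fst p)\<parallel>\<^bsub>V (fst p)\<^esub> \<le> r}"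
  then have "p \<in> space M" using W_subset by blast
  then show "weak_coords p \<in> (\<lambda>v. weak_coords (fst p, v)) `
      {v \<in> carrier (V (fst p)). \<parallel>v \<ominus>\<^bsub>V (fst p)\<^esub> \<phi> n (fst p)\<parallel>\<^bsub>V (fst p)\<^esub> \<le> r}"
    using p by (intro image_eqI[of _ _ "snd p"]) (simp_all add: mem_space_M)
qed

lemma measurable_setdist: "setdist n \<in> borel_measurable X"
proof (rule borel_measurable_iff_less[THEN iffD2, rule_format])
  fix r
  define N where "N q = {x \<in> space X. \<forall>p\<in>{p \<in> W. \<parallel>snd p \<ominus>\<^bsub>V (fst p)\<^esub> \<phi> n (fst p)\<parallel>\<^bsub>V (fst p)\<^esub> \<le> q}. fst p \<noteq> x}" for q
  \<comment> \<open>A rational radius strictly between an attained distance and \<open>r\<close>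
    leaves countably many sets to consider, and whether the infimum is attained does not
    matter.\<close>
  have "setdist n x < r \<longleftrightarrow> (\<exists>q\<in>\<rat> \<inter> {0<..<r}. x \<notin> N q)" if x: "x \<in> space X" for x
  proof -
    interpret closed_subspace "V x" "fiber W x" by (rule W_closed_subspace[OF x])
    have notN: "x \<notin> N q \<longleftrightarrow> (\<exists>w\<in>fiber W x. \<parallel>w \<ominus>\<^bsub>V x\<^esub> \<phi> n x\<parallel>\<^bsub>V x\<^esub> \<le> q)" for q
      using x by (force simp: N_def fiber_def)
    have comm: "\<parallel>\<phi> n x \<ominus>\<^bsub>V x\<^esub> w\<parallel>\<^bsub>V x\<^esub> = \<parallel>w \<ominus>\<^bsub>V x\<^esub> \<phi> n x\<parallel>\<^bsub>V x\<^esub>" if "w \<in> fiber W x" for w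
      using nrm_minus_commute[OF section_carrier[OF x] in_carrier[OF that]] .
    show ?thesis
    proof
      assume "setdist n x < r"
      then obtain w where w: "w \<in> fiber W x" "\<parallel>\<phi> n x \<ominus>\<^bsub>V x\<^esub> w\<parallel>\<^bsub>V x\<^esub> < r"
        by (rule norm_setdist_lessE[OF section_carrier[OF x]])
      obtain q where q: "q \<in> \<rat>" "\<parallel>\<phi> n x \<ominus>\<^bsub>V x\<^esub> w\<parallel>\<^bsub>V x\<^esub> < q" "q < r" using Rats_dense_in_real[OF w(2)] by blast
      have "0 \<le> \<parallel>\<phi> n x \<ominus>\<^bsub>V x\<^esub> w\<parallel>\<^bsub>V x\<^esub>"
        using section_carrier[OF x] in_carrier[OF w(1)] by (intro nrm_nonneg) simp
      then have "q \<in> \<rat> \<inter> {0<..<r}" using q by simp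
      moreover have "x \<notin> N q" unfolding notN using w(1) q(2) comm[OF w(1)] by (intro bexI[of _ w]) auto
      ultimately show "\<exists>q\<in>\<rat> \<inter> {0<..<r}. x \<notin> N q" by blast
    next
      assume "\<exists>q\<in>\<rat> \<inter> {0<..<r}. x \<notin> N q"
      then obtain q w where "q < r" "w \<in> fiber W x" "\<parallel>w \<ominus>\<^bsub>V x\<^esub> \<phi> n x\<parallel>\<^bsub>V x\<^esub> \<le> q" unfolding notN by auto
      then show "setdist n x < r" using norm_setdist_le[OF section_carrier[OF x], of w n] comm by simp
    qed
  qed
  then have "{x \<in> space X. setdist n x < r} = (\<Union>q\<in>\<rat> \<inter> {0<..<r}. space X - N q)" by auto
  also have "\<dots> \<in> sets X"
  proof (rule sets.countable_UN'')
    show "countable (\<rat> \<inter> {0<..<r})" using countable_rat by (rule countable_Int1)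
    show "space X - N q \<in> sets X" if "q \<in> \<rat> \<inter> {0<..<r}" for q
      unfolding N_def using measurable_ball_misses[of q n] that by (intro sets.compl_sets) auto
  qed
  finally show "{x \<in> space X. setdist n x < r} \<in> sets X" .
qed

end

text \<open>The base point together with the distances to all \<open>\<phi> j\<close> determines a
  vector, as these sections are dense. Each distance function of the limit is a pointwise limit of
  Borel functions, and the test by an injective Borel map concludes.\<close>

lemma (in borel_field_sections) borel_section_limit:
  assumes s: "\<And>k. borel_section (s k)" and l: "\<And>x. x \<in> space X \<Longrightarrow> l x \<in> carrier (V x)"
    and lim: "\<And>x. x \<in> space X \<Longrightarrow> (\<lambda>k. \<parallel>s k x \<ominus>\<^bsub>V x\<^esub> l x\<parallel>\<^bsub>V x\<^esub>) \<longlonglongrightarrow> 0"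
  shows "borel_section l"
proof -
  let ?N = "X \<Otimes>\<^sub>M (borel :: (nat \<Rightarrow> real) measure)"
  let ?e = "\<lambda>p. (fst p, \<lambda>j. \<parallel>snd p \<ominus>\<^bsub>V (fst p)\<^esub> \<phi> j (fst p)\<parallel>\<^bsub>V (fst p)\<^esub>)"
  show ?thesis
    unfolding borel_section_def
  proof (rule measurable_into_standard_borel[OF total, where N = ?N and e = ?e])
    show "countably_separated ?N"
      by (intro countably_separated_pair standard_borel_imp_countably_separated[OF base] countably_separated_borel)
    show "?e \<in> M \<rightarrow>\<^sub>M ?N"
      by (intro measurable_Pair measurable_proj measurable_coordinatewise_then_product
          measurable_dist_section section_\<phi>)
    show "inj_on ?e (space M)"
    proof (rule inj_onI)
      fix p q assume p: "p \<in> space M" and q: "q \<in> space M" and eq: "?e p = ?e q"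
      obtain x v w where pq: "p = (x, v)" "q = (x, w)" using eq by (cases p, cases q) auto
      have x: "x \<in> space X" and v: "v \<in> carrier (V x)" and w: "w \<in> carrier (V x)"
        using p q by (auto simp: pq mem_space_M)
      have eq': "\<parallel>v \<ominus>\<^bsub>V x\<^esub> \<phi> j x\<parallel>\<^bsub>V x\<^esub> = \<parallel>w \<ominus>\<^bsub>V x\<^esub> \<phi> j x\<parallel>\<^bsub>V x\<^esub>" for j
        using eq by (simp add: pq fun_eq_iff)
      interpret complex_normed_vs "V x" using normed[OF x] .
      have "\<parallel>v \<ominus>\<^bsub>V x\<^esub> w\<parallel>\<^bsub>V x\<^esub> \<le> 0 + \<epsilon>" if "\<epsilon> > 0" for \<epsilon>
      proof -
        obtain j where "\<parallel>v \<ominus>\<^bsub>V x\<^esub> \<phi> j x\<parallel>\<^bsub>V x\<^esub> < \<epsilon> / 2"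
          using norm_denseD(1)[OF norm_dense_\<phi>[OF x] v, of "\<epsilon> / 2"] \<open>\<epsilon> > 0\<close> by auto
        moreover have "\<phi> j x \<in> carrier (V x)" by (rule borel_section_carrier[OF section_\<phi> x])
        ultimately show ?thesis
          using nrm_diff_triangle[OF v _ w, of "\<phi> j x"] nrm_minus_commute[OF w, of "\<phi> j x"] eq'[of j] by simp
      qed
      then have "\<parallel>v \<ominus>\<^bsub>V x\<^esub> w\<parallel>\<^bsub>V x\<^esub> \<le> 0" by (rule field_le_epsilon)
      then have "v = w" using diff_eq_zero_iff[OF v w] nrm_nonneg[of "v \<ominus>\<^bsub>V x\<^esub> w"] v w by simp
      then show "p = q" by (simp add: pq)
    qed
    show "(\<lambda>x. (x, l x)) \<in> space X \<rightarrow> space M" using l by (auto simp: mem_space_M)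
    have "(\<lambda>x. \<parallel>l x \<ominus>\<^bsub>V x\<^esub> \<phi> j x\<parallel>\<^bsub>V x\<^esub>) \<in> borel_measurable X" for j
    proof (rule borel_measurable_LIMSEQ_real)
      show "(\<lambda>x. \<parallel>s k x \<ominus>\<^bsub>V x\<^esub> \<phi> j x\<parallel>\<^bsub>V x\<^esub>) \<in> borel_measurable X" for k
        using measurable_compose[OF s[of k, unfolded borel_section_def] measurable_dist_section[OF section_\<phi>[of j]]]
        by simp
      fix x assume x: "x \<in> space X"
      interpret complex_normed_vs "V x" using normed[OF x] .
      have \<phi>: "\<phi> j x \<in> carrier (V x)" by (rule borel_section_carrier[OF section_\<phi> x])
      have sx: "s k x \<in> carrier (V x)" for k by (rule borel_section_carrier[OF s x])
      have "\<bar>\<parallel>s k x \<ominus>\<^bsub>V x\<^esub> \<phi> j x\<parallel>\<^bsub>V x\<^esub> - \<parallel>l x \<ominus>\<^bsub>V x\<^esub> \<phi> j x\<parallel>\<^bsub>V x\<^esub>\<bar> \<le> \<parallel>s k x \<ominus>\<^bsub>V x\<^esub> l x\<parallel>\<^bsub>V x\<^esub>" for k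
        using nrm_diff_triangle[OF sx l[OF x] \<phi>, of k] nrm_diff_triangle[OF l[OF x] sx \<phi>, of k]
          nrm_minus_commute[OF sx l[OF x], of k] by linarith
      then have "(\<lambda>k. \<parallel>s k x \<ominus>\<^bsub>V x\<^esub> \<phi> j x\<parallel>\<^bsub>V x\<^esub> - \<parallel>l x \<ominus>\<^bsub>V x\<^esub> \<phi> j x\<parallel>\<^bsub>V x\<^esub>) \<longlonglongrightarrow> 0"
        by (intro Lim_null_comparison[OF always_eventually lim[OF x]]) simp
      then show "(\<lambda>k. \<parallel>s k x \<ominus>\<^bsub>V x\<^esub> \<phi> j x\<parallel>\<^bsub>V x\<^esub>) \<longlonglongrightarrow> \<parallel>l x \<ominus>\<^bsub>V x\<^esub> \<phi> j x\<parallel>\<^bsub>V x\<^esub>"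
        by (rule LIM_zero_cancel)
    qed
    then have "(\<lambda>x. \<lambda>j. \<parallel>l x \<ominus>\<^bsub>V x\<^esub> \<phi> j x\<parallel>\<^bsub>V x\<^esub>) \<in> borel_measurable X"
      by (rule measurable_coordinatewise_then_product)
    then show "(\<lambda>x. ?e (x, l x)) \<in> X \<rightarrow>\<^sub>M ?N"
      by (simp add: measurable_Pair)
  qed
qed

subsection \<open>Selection of dense sections\<close>

context reflexive_subfield
begin

text \<open>The indices are chosen so that \<open>\<phi> (index n c k x) x\<close> converges to a point of the fibre
  of \<open>W\<close> whose distance to \<open>\<phi> n x\<close> exceeds the minimal one by at most \<open>3 * c\<close>.\<close>

definition next_index :: "real \<Rightarrow> nat \<Rightarrow> 'a \<Rightarrow> nat" where
  "next_index \<epsilon> i x = (LEAST j. setdist j x < \<epsilon> \<and> \<parallel>\<phi> j x \<ominus>\<^bsub>V x\<^esub> \<phi> i x\<parallel>\<^bsub>V x\<^esub> < setdist i x + \<epsilon>)"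

primrec index :: "nat \<Rightarrow> real \<Rightarrow> nat \<Rightarrow> 'a \<Rightarrow> nat" where
  "index n c 0 x = n"
| "index n c (Suc k) x = next_index (c * (1/2)^(Suc k)) (index n c k x) x"

text \<open>A witness for the least index is any \<open>\<phi> j\<close> within
  \<open>\<epsilon> / 2\<close> of a point of the fibre of \<open>W\<close> that is itself within
  \<open>\<epsilon> / 2\<close> of realizing the distance from \<open>\<phi> i x\<close>.\<close>

lemma next_index:
  assumes x: "x \<in> space X" and \<epsilon>: "0 < \<epsilon>"
  shows "setdist (next_index \<epsilon> i x) x < \<epsilon>"
    "\<parallel>\<phi> (next_index \<epsilon> i x) x \<ominus>\<^bsub>V x\<^esub> \<phi> i x\<parallel>\<^bsub>V x\<^esub> < setdist i x + \<epsilon>"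
proof -
  interpret closed_subspace "V x" "fiber W x" by (rule W_closed_subspace[OF x])
  note c = section_carrier[OF x]
  obtain w where w: "w \<in> fiber W x" "\<parallel>\<phi> i x \<ominus>\<^bsub>V x\<^esub> w\<parallel>\<^bsub>V x\<^esub> < setdist i x + \<epsilon> / 2"
    using norm_setdist_lessE[OF c, of i "setdist i x + \<epsilon> / 2"] \<epsilon> by auto
  have wc: "w \<in> carrier (V x)" by (rule in_carrier[OF w(1)])
  obtain j where j: "\<parallel>w \<ominus>\<^bsub>V x\<^esub> \<phi> j x\<parallel>\<^bsub>V x\<^esub> < \<epsilon> / 2"
    using norm_denseD(1)[OF norm_dense_\<phi>[OF x] wc, of "\<epsilon> / 2"] \<epsilon> by auto
  have "setdist j x < \<epsilon>"
    using norm_setdist_le[OF c w(1), of j] j \<epsilon> nrm_minus_commute[OF wc c, of j] by simp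
  moreover have "\<parallel>\<phi> j x \<ominus>\<^bsub>V x\<^esub> \<phi> i x\<parallel>\<^bsub>V x\<^esub> < setdist i x + \<epsilon>"
    using nrm_diff_triangle[OF c wc c, of j i] j w(2) nrm_minus_commute[OF wc c, of j]
      nrm_minus_commute[OF wc c, of i] by simp
  ultimately have "\<exists>j. setdist j x < \<epsilon> \<and> \<parallel>\<phi> j x \<ominus>\<^bsub>V x\<^esub> \<phi> i x\<parallel>\<^bsub>V x\<^esub> < setdist i x + \<epsilon>" by blast
  from LeastI_ex[OF this] show "setdist (next_index \<epsilon> i x) x < \<epsilon>"
    "\<parallel>\<phi> (next_index \<epsilon> i x) x \<ominus>\<^bsub>V x\<^esub> \<phi> i x\<parallel>\<^bsub>V x\<^esub> < setdist i x + \<epsilon>"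
    unfolding next_index_def by blast+
qed

lemma measurable_section_dist: "(\<lambda>x. \<parallel>\<phi> j x \<ominus>\<^bsub>V x\<^esub> \<phi> i x\<parallel>\<^bsub>V x\<^esub>) \<in> borel_measurable X"
  using measurable_compose[OF section_\<phi>[of j, unfolded borel_section_def] measurable_dist_section[OF section_\<phi>[of i]]]
  by simp

lemma measurable_next_index: "next_index \<epsilon> i \<in> X \<rightarrow>\<^sub>M count_space UNIV"
proof -
  note [measurable] = measurable_section_dist measurable_setdist
  show ?thesis unfolding next_index_def by measurable
qed

lemma measurable_index: "index n c k \<in> X \<rightarrow>\<^sub>M count_space UNIV"
proof (induction k)
  case (Suc k)
  have "(\<lambda>x. next_index (c * (1/2)^(Suc k)) (index n c k x) x) \<in> X \<rightarrow>\<^sub>M count_space UNIV"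
    by (rule measurable_compose_countable[OF measurable_next_index Suc])
  then show ?case by (simp cong: measurable_cong)
qed simp

lemma borel_section_index: "borel_section (\<lambda>x. \<phi> (index n c k x) x)"
  unfolding borel_section_def
  by (rule measurable_compose_countable[OF section_\<phi>[unfolded borel_section_def] measurable_index])

text \<open>After the first step the distance to \<open>W\<close> is below
  \<open>c * (1/2)^k\<close> at step \<open>k\<close>, so the further jumps are dominated by a
  geometric series of sum \<open>2 * c\<close>. The first jump costs \<open>setdist n x\<close> plus
  at most \<open>c / 2\<close>; the total excess \<open>5/2 * c\<close> is rounded up to
  \<open>3 * c\<close>.\<close>

lemma near_section_pointwise:
  assumes c: "0 < c" and x: "x \<in> space X"
  shows "\<exists>l\<in>fiber W x. (\<lambda>k. \<parallel>\<phi> (index n c k x) x \<ominus>\<^bsub>V x\<^esub> l\<parallel>\<^bsub>V x\<^esub>) \<longlonglongrightarrow> 0 \<and>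
    \<parallel>l \<ominus>\<^bsub>V x\<^esub> \<phi> n x\<parallel>\<^bsub>V x\<^esub> \<le> setdist n x + 3 * c"
proof -
  interpret closed_subspace "V x" "fiber W x" by (rule W_closed_subspace[OF x])
  interpret MS: Metric_space "carrier (V x)" "nrm_dist (V x)" by (rule Metric_space_nrm_dist)
  let ?i = "\<lambda>k. index n c k x"
  define s where "s k = \<phi> (?i k) x" for k
  have s: "s k \<in> carrier (V x)" for k using section_carrier[OF x] by (simp add: s_def)
  have near: "setdist (?i (Suc k)) x < c * (1/2)^(Suc k)" for k
    using next_index(1)[OF x, of "c * (1/2)^(Suc k)" "?i k"] c by simp
  have jump: "\<parallel>s (Suc k) \<ominus>\<^bsub>V x\<^esub> s k\<parallel>\<^bsub>V x\<^esub> < setdist (?i k) x + c * (1/2)^(Suc k)" for k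
    using next_index(2)[OF x, of "c * (1/2)^(Suc k)" "?i k"] c by (simp add: s_def)
  have "nrm_dist (V x) (s (Suc (Suc k))) (s (Suc k)) \<le> c * (1/2)^k" for k
  proof -
    have "0 < c * (1/2)^k" using c by simp
    then show ?thesis using jump[of "Suc k"] near[of k] s by (simp add: nrm_dist_def)
  qed
  then obtain l where l: "l \<in> carrier (V x)"
    and ld: "\<And>k. nrm_dist (V x) l (s (Suc k)) \<le> 2 * c * (1/2)^k"
    using MS.geometric_limit[of "\<lambda>k. s (Suc k)" c] s banach[OF x] complex_banach.complete by blast
  have ld': "\<parallel>l \<ominus>\<^bsub>V x\<^esub> s (Suc k)\<parallel>\<^bsub>V x\<^esub> \<le> 2 * c * (1/2)^k" for k
    using ld[of k] l s by (simp add: nrm_dist_def)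
  have null: "(\<lambda>k. C * (1/2)^k) \<longlonglongrightarrow> 0" for C :: real
    using tendsto_mult[OF tendsto_const[of C] LIMSEQ_realpow_zero[of "1/2::real"]] by simp
  have "l \<in> fiber W x"
  proof (rule ccontr)
    assume "l \<notin> fiber W x"
    then have pos: "0 < norm_setdist (V x) (fiber W x) l" by (rule norm_setdist_pos[OF l])
    \<comment> \<open>Here \<open>2 * c\<close> comes from the distance of \<open>l\<close> to the
      sequence and one more \<open>c\<close> from the distance of the sequence to
      \<open>W\<close>.\<close>
    have "norm_setdist (V x) (fiber W x) l \<le> 3 * c * (1/2)^k" for k
    proof -
      have "norm_setdist (V x) (fiber W x) l - setdist (?i (Suc k)) x \<le> \<parallel>l \<ominus>\<^bsub>V x\<^esub> s (Suc k)\<parallel>\<^bsub>V x\<^esub>"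
        using sublinear_lipschitz[OF sublinear_norm_setdist l s[of "Suc k"]] unfolding s_def by (rule abs_le_D1)
      moreover have "c * (1/2)^(Suc k) \<le> c * (1/2)^k" using c by simp
      ultimately show ?thesis using ld'[of k] near[of k] by (simp only: power_Suc)
    qed
    then have "norm_setdist (V x) (fiber W x) l \<le> 0"
      by (intro LIMSEQ_le_const[OF null[of "3 * c"]]) auto
    then show False using pos by simp
  qed
  moreover have "(\<lambda>k. \<parallel>s k \<ominus>\<^bsub>V x\<^esub> l\<parallel>\<^bsub>V x\<^esub>) \<longlonglongrightarrow> 0"
  proof (rule LIMSEQ_imp_Suc, rule Lim_null_comparison[OF always_eventually null[of "2 * c"]], rule allI)
    fix k
    have "0 \<le> \<parallel>s (Suc k) \<ominus>\<^bsub>V x\<^esub> l\<parallel>\<^bsub>V x\<^esub>" using s l by (simp add: nrm_nonneg)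
    then show "norm \<parallel>s (Suc k) \<ominus>\<^bsub>V x\<^esub> l\<parallel>\<^bsub>V x\<^esub> \<le> 2 * c * (1/2)^k"
      using ld'[of k] nrm_minus_commute[OF s l, of "Suc k"] by simp
  qed
  moreover have "\<parallel>l \<ominus>\<^bsub>V x\<^esub> \<phi> n x\<parallel>\<^bsub>V x\<^esub> \<le> setdist n x + 3 * c"
    using nrm_diff_triangle[OF l s[of 1] s[of 0]] ld'[of 0] jump[of 0] c by (simp add: s_def)
  ultimately show ?thesis unfolding s_def by blast
qed

text \<open>The pointwise choice costs no measurability: the chosen value is the norm limit of Borel
  sections.\<close>

lemma near_section:
  assumes c: "0 < c"
  shows "\<exists>l. borel_section l \<and>
    (\<forall>x\<in>space X. l x \<in> fiber W x \<and> \<parallel>l x \<ominus>\<^bsub>V x\<^esub> \<phi> n x\<parallel>\<^bsub>V x\<^esub> \<le> setdist n x + 3 * c)"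
proof -
  obtain l where l: "\<forall>x\<in>space X. l x \<in> fiber W x \<and>
      (\<lambda>k. \<parallel>\<phi> (index n c k x) x \<ominus>\<^bsub>V x\<^esub> l x\<parallel>\<^bsub>V x\<^esub>) \<longlonglongrightarrow> 0 \<and>
      \<parallel>l x \<ominus>\<^bsub>V x\<^esub> \<phi> n x\<parallel>\<^bsub>V x\<^esub> \<le> setdist n x + 3 * c"
    using bchoice[of "space X" "\<lambda>x l. l \<in> fiber W x \<and>
      (\<lambda>k. \<parallel>\<phi> (index n c k x) x \<ominus>\<^bsub>V x\<^esub> l\<parallel>\<^bsub>V x\<^esub>) \<longlonglongrightarrow> 0 \<and>
      \<parallel>l \<ominus>\<^bsub>V x\<^esub> \<phi> n x\<parallel>\<^bsub>V x\<^esub> \<le> setdist n x + 3 * c"] near_section_pointwise[OF c, of _ n] by blast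
  have "borel_section l"
    by (rule borel_section_limit[OF borel_section_index[of n c]])
       (use l closed_subspace.in_carrier[OF W_closed_subspace] in auto)
  then show ?thesis using l by blast
qed

lemma dense_sections_of_subfield:
  "\<exists>\<psi> :: nat \<Rightarrow> 'a \<Rightarrow> 'b. (\<forall>k. borel_section (\<psi> k)) \<and> (\<forall>x\<in>space X. \<forall>k. \<psi> k x \<in> fiber W x) \<and>
    (\<forall>x\<in>space X. \<forall>w\<in>fiber W x. \<forall>\<epsilon>>0. \<exists>k. \<parallel>w \<ominus>\<^bsub>V x\<^esub> \<psi> k x\<parallel>\<^bsub>V x\<^esub> < \<epsilon>)"
proof -
  have "\<forall>k. \<exists>l. borel_section l \<and> (\<forall>x\<in>space X. l x \<in> fiber W x \<and>
      \<parallel>l x \<ominus>\<^bsub>V x\<^esub> \<phi> (fst (prod_decode k)) x\<parallel>\<^bsub>V x\<^esub>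
        \<le> setdist (fst (prod_decode k)) x + 3 * (1 / real (Suc (snd (prod_decode k)))))"
    by (intro allI near_section) simp
  from choice[OF this] obtain \<psi> where \<psi>: "\<forall>k. borel_section (\<psi> k) \<and> (\<forall>x\<in>space X. \<psi> k x \<in> fiber W x \<and>
      \<parallel>\<psi> k x \<ominus>\<^bsub>V x\<^esub> \<phi> (fst (prod_decode k)) x\<parallel>\<^bsub>V x\<^esub>
        \<le> setdist (fst (prod_decode k)) x + 3 * (1 / real (Suc (snd (prod_decode k)))))" ..
  have "\<exists>k. \<parallel>w \<ominus>\<^bsub>V x\<^esub> \<psi> k x\<parallel>\<^bsub>V x\<^esub> < \<epsilon>" if x: "x \<in> space X" and w: "w \<in> fiber W x" and \<epsilon>: "0 < \<epsilon>" for x w \<epsilon>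
  proof -
    interpret closed_subspace "V x" "fiber W x" by (rule W_closed_subspace[OF x])
    note c = section_carrier[OF x] and wc = in_carrier[OF w]
    obtain n where n: "\<parallel>w \<ominus>\<^bsub>V x\<^esub> \<phi> n x\<parallel>\<^bsub>V x\<^esub> < \<epsilon> / 3"
      using norm_denseD(1)[OF norm_dense_\<phi>[OF x] wc, of "\<epsilon> / 3"] \<epsilon> by auto
    \<comment> \<open>The three thirds of \<open>\<epsilon>\<close> are the distance from
      \<open>w\<close> to \<open>\<phi> n x\<close>, the distance from \<open>\<phi> n x\<close> to
      \<open>W\<close>, which \<open>w\<close> itself bounds, and the excess of three times
      \<open>1 / real (Suc m)\<close>.\<close>
    obtain m where m: "1 / real (Suc m) < \<epsilon> / 9" using nat_approx_posE[of "\<epsilon> / 9"] \<epsilon> by auto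
    let ?k = "prod_encode (n, m)"
    have \<psi>k: "\<psi> ?k x \<in> fiber W x" "\<parallel>\<psi> ?k x \<ominus>\<^bsub>V x\<^esub> \<phi> n x\<parallel>\<^bsub>V x\<^esub> \<le> setdist n x + 3 * (1 / real (Suc m))"
      using \<psi>[rule_format, of ?k] x by auto
    note \<psi>c = in_carrier[OF \<psi>k(1)]
    have "setdist n x < \<epsilon> / 3"
      using norm_setdist_le[OF c w, of n] nrm_minus_commute[OF c wc, of n] n by simp
    then have "\<parallel>w \<ominus>\<^bsub>V x\<^esub> \<psi> ?k x\<parallel>\<^bsub>V x\<^esub> < \<epsilon>"
      using nrm_diff_triangle[OF wc c \<psi>c, of n] n \<psi>k(2) m nrm_minus_commute[OF c \<psi>c, of n] by linarith
    then show ?thesis by blast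
  qed
  then show ?thesis using \<psi> by (intro exI[of _ \<psi>]) blast
qed

end

section \<open>Closed subspaces as Banach spaces and the restricted field\<close>

lemma (in closed_subspace) subspace_normed: "complex_normed_vs (V\<lparr>carrier := W\<rparr>)"
proof -
  have "module complex_ring (V\<lparr>carrier := W\<rparr>)"
    by (rule submodule.submodule_is_module[OF submodule module_axioms])
  then show ?thesis
    unfolding complex_normed_vs_def complex_normed_vs_axioms_def
    using in_carrier by (simp add: nrm_nonneg nrm_eq_0_iff nrm_smult nrm_triangle)
qed

text \<open>The additive inverse is defined by a search in the carrier and so changes formally with
  it. Scalar multiplication is untouched by the restriction, and the multiple by -1 identifies the
  two inverses.\<close>

lemma (in closed_subspace) subspace_dist:
  assumes v: "v \<in> W" and w: "w \<in> W"
  shows "nrm_dist (V\<lparr>carrier := W\<rparr>) v w = nrm_dist V v w"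
proof -
  interpret N: complex_normed_vs "V\<lparr>carrier := W\<rparr>" by (rule subspace_normed)
  have "\<ominus>\<^bsub>V\<lparr>carrier := W\<rparr>\<^esub> w = \<ominus> w"
    using N.smult_minus_1[of w] smult_minus_1[of w] w in_carrier by simp
  then show ?thesis using v w in_carrier by (simp add: nrm_dist_def a_minus_def)
qed

text \<open>A Cauchy sequence in \<open>W\<close> has a limit in \<open>V\<close>; were the limit
  outside \<open>W\<close>, its distance to \<open>W\<close> would be positive, yet the sequence
  comes closer.\<close>

lemma (in closed_subspace) subspace_banach:
  assumes complete: "Metric_space.mcomplete (carrier V) (nrm_dist V)"
  shows "complex_banach (V\<lparr>carrier := W\<rparr>)"
proof -
  interpret N: complex_normed_vs "V\<lparr>carrier := W\<rparr>" by (rule subspace_normed)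
  interpret MV: Metric_space "carrier V" "nrm_dist V" by (rule Metric_space_nrm_dist)
  interpret MW: Metric_space W "nrm_dist (V\<lparr>carrier := W\<rparr>)" using N.Metric_space_nrm_dist by simp
  have "MW.mcomplete"
    unfolding MW.mcomplete_def
  proof (intro allI impI)
    fix \<sigma> assume \<sigma>: "MW.MCauchy \<sigma>"
    then have \<sigma>W: "\<sigma> n \<in> W" for n by (auto simp: MW.MCauchy_def)
    then have "MV.MCauchy \<sigma>"
      using \<sigma> in_carrier by (auto simp: MW.MCauchy_def MV.MCauchy_def subspace_dist)
    then obtain l where l: "limitin MV.mtopology \<sigma> l sequentially"
      using complete unfolding MV.mcomplete_def by blast
    then have lV: "l \<in> carrier V" and ev: "\<And>\<epsilon>. \<epsilon> > 0 \<Longrightarrow> \<forall>\<^sub>F n in sequentially. nrm_dist V (\<sigma> n) l < \<epsilon>"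
      by (auto simp: MV.limitin_metric elim: eventually_mono)
    have "l \<in> W"
    proof (rule ccontr)
      assume "l \<notin> W"
      then have "0 < norm_setdist V W l" by (rule norm_setdist_pos[OF lV])
      then obtain n where n: "nrm_dist V (\<sigma> n) l < norm_setdist V W l"
        using ev by (meson eventually_sequentially le_refl)
      have "norm_setdist V W l \<le> nrm_dist V l (\<sigma> n)"
        using norm_setdist_le[OF lV \<sigma>W[of n]] lV in_carrier[OF \<sigma>W[of n]] by (simp add: nrm_dist_def)
      then show False using n MV.commute[of l "\<sigma> n"] by simp
    qed
    then have "limitin MW.mtopology \<sigma> l sequentially"
      using \<sigma>W ev by (simp add: MW.limitin_metric subspace_dist)
    then show "\<exists>x. limitin MW.mtopology \<sigma> x sequentially" by blast
  qed
  then show ?thesis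
    unfolding complex_banach_def complex_banach_axioms_def using subspace_normed by simp
qed

theorem proposition5p5:
  fixes X :: "'x measure"
    and V :: "'x \<Rightarrow> 'a normed_vs"
    and M :: "('x \<times> 'a) measure"
    and W :: "('x \<times> 'a) set"
  assumes "borel_field X V M"
    and "\<And>x. x \<in> space X \<Longrightarrow> reflexive (V x)"
    and "W \<in> sets M"
    and "\<And>x. x \<in> space X \<Longrightarrow> submodule (fiber W x) complex_ring (V x)"
    and "\<And>x. x \<in> space X \<Longrightarrow> closedin (nrm_topology (V x)) (fiber W x)"
  shows "borel_field X (subfamily V W) (restrict_space M W)"
proof -
  interpret borel_field X V M by fact
  obtain \<phi> where "dense_borel_sections X V M \<phi>" using dense_sections by blast
  then interpret borel_field_sections X V M \<phi> by unfold_locales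
  have closed: "closed_subspace (V x) (fiber W x)" if "x \<in> space X" for x
    using assms(4,5)[OF that] normed[OF that]
    by (simp add: closed_subspace_def closed_subspace_axioms_def)
  interpret reflexive_subfield X V M \<phi> W
    by (intro reflexive_subfield.intro reflexive_subfield_axioms.intro
        borel_field_sections_axioms assms(2,3) closed)
  let ?V = "subfamily V W" and ?M = "restrict_space M W"
  have WM: "W \<subseteq> space M" by (rule sets.sets_into_space[OF assms(3)])
  have spaceM: "space ?M = W" using WM by (auto simp: space_restrict_space)
  have M_sub: "id \<in> ?M \<rightarrow>\<^sub>M M" by (rule measurable_restrict_space1) (simp add: id_def)
  have fst_W: "fst p \<in> space X" "snd p \<in> fiber W (fst p)" if "p \<in> W" for p
    using that WM by (auto simp: mem_space_M fiber_def)
  obtain \<psi> :: "nat \<Rightarrow> 'x \<Rightarrow> 'a" where \<psi>: "\<And>k. borel_section (\<psi> k)"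
    "\<And>x k. x \<in> space X \<Longrightarrow> \<psi> k x \<in> fiber W x"
    "\<And>x w \<epsilon>. x \<in> space X \<Longrightarrow> w \<in> fiber W x \<Longrightarrow> 0 < \<epsilon> \<Longrightarrow> \<exists>k. \<parallel>w \<ominus>\<^bsub>V x\<^esub> \<psi> k x\<parallel>\<^bsub>V x\<^esub> < \<epsilon>"
    using dense_sections_of_subfield by blast
  have dense: "nrm_topology (?V x) closure_of range (\<lambda>k. \<psi> k x) = carrier (?V x)" if x: "x \<in> space X" for x
  proof -
    interpret closed_subspace "V x" "fiber W x" by (rule W_closed_subspace[OF x])
    interpret N: complex_normed_vs "?V x" unfolding subfamily_def by (rule subspace_normed)
    interpret MN: Metric_space "fiber W x" "nrm_dist (?V x)"
      using N.Metric_space_nrm_dist by (simp add: subfamily_def)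
    have "\<exists>y\<in>range (\<lambda>k. \<psi> k x). y \<in> MN.mball w \<epsilon>" if "w \<in> fiber W x" "0 < \<epsilon>" for w \<epsilon>
    proof -
      obtain k where "\<parallel>w \<ominus>\<^bsub>V x\<^esub> \<psi> k x\<parallel>\<^bsub>V x\<^esub> < \<epsilon>" using \<psi>(3)[OF x \<open>w \<in> fiber W x\<close> \<open>0 < \<epsilon>\<close>] by blast
      then have "nrm_dist (?V x) w (\<psi> k x) < \<epsilon>"
        unfolding subfamily_def using \<open>w \<in> fiber W x\<close> \<psi>(2)[OF x] in_carrier
        by (simp add: subspace_dist) (simp add: nrm_dist_def)
      then show ?thesis using \<open>w \<in> fiber W x\<close> \<psi>(2)[OF x] by (intro bexI[of _ "\<psi> k x"]) auto
    qed
    then have "Abstract_Topology.closure_of MN.mtopology (range (\<lambda>k. \<psi> k x)) = fiber W x"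
      unfolding MN.metric_closure_of by blast
    then show ?thesis by (simp add: subfamily_def nrm_topology_def)
  qed
  show ?thesis
  proof (rule borel_field.intro)
    show "standard_borel X" by (rule base)
    show "complex_banach (?V x)" if x: "x \<in> space X" for x
      unfolding subfamily_def
      by (rule closed_subspace.subspace_banach[OF closed[OF x] complex_banach.complete[OF banach[OF x]]])
    show "separable_space (nrm_topology (?V x))" if x: "x \<in> space X" for x
    proof -
      interpret closed_subspace "V x" "fiber W x" by (rule W_closed_subspace[OF x])
      interpret N: complex_normed_vs "?V x" unfolding subfamily_def by (rule subspace_normed)
      interpret MN: Metric_space "carrier (?V x)" "nrm_dist (?V x)"
        by (rule N.Metric_space_nrm_dist)
      have "topspace (nrm_topology (?V x)) = carrier (?V x)" by (simp add: nrm_topology_def)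
      moreover have "range (\<lambda>k. \<psi> k x) \<subseteq> carrier (?V x)" using \<psi>(2)[OF x] by (auto simp: subfamily_def)
      ultimately show ?thesis
        unfolding separable_space_def using dense[OF x] by (intro exI[of _ "range (\<lambda>k. \<psi> k x)"]) simp
    qed
    show "space ?M = (SIGMA x:space X. carrier (?V x))"
      using fst_W by (auto simp: spaceM subfamily_def fiber_def)
    show "standard_borel ?M" by (rule standard_borel_restrict_space[OF total assms(3)])
    show "fst \<in> ?M \<rightarrow>\<^sub>M X" by (rule measurable_restrict_space1[OF measurable_proj])
    show "(\<lambda>(x, v). \<parallel>v\<parallel>\<^bsub>?V x\<^esub>) \<in> ?M \<rightarrow>\<^sub>M restrict_space borel {0..}"
      using measurable_restrict_space1[OF measurable_nrm, of W] by (simp add: subfamily_def)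
    show "(\<lambda>((x, v), (y, w)). (x, v \<oplus>\<^bsub>?V x\<^esub> w))
        \<in> restrict_space (?M \<Otimes>\<^sub>M ?M) {(p, q) \<in> space ?M \<times> space ?M. fst p = fst q} \<rightarrow>\<^sub>M ?M"
    proof (rule measurable_restrict_space2)
      show "(\<lambda>((x, v), (y, w)). (x, v \<oplus>\<^bsub>?V x\<^esub> w))
        \<in> space (restrict_space (?M \<Otimes>\<^sub>M ?M) {(p, q) \<in> space ?M \<times> space ?M. fst p = fst q}) \<rightarrow> W"
      proof
        fix z assume "z \<in> space (restrict_space (?M \<Otimes>\<^sub>M ?M) {(p, q) \<in> space ?M \<times> space ?M. fst p = fst q})"
        then obtain x v w where z: "z = ((x, v), (x, w))" "(x, v) \<in> W" "(x, w) \<in> W"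
          by (auto simp: space_restrict_space spaceM)
        then have "x \<in> space X" "v \<in> fiber W x" "w \<in> fiber W x" using fst_W(1) by (auto simp: fiber_def)
        then show "(\<lambda>((x, v), (y, w)). (x, v \<oplus>\<^bsub>?V x\<^esub> w)) z \<in> W"
          using closed_subspace.add_mem[OF closed] z(1) by (simp add: subfamily_def fiber_def)
      qed
      \<comment> \<open>The inclusion is Borel on both factors, hence on the product, and takes
        pairs over a common base point to such pairs. The restricted addition is the original one
        composed with it.\<close>
      have "(\<lambda>z. (id (fst z), id (snd z))) \<in> ?M \<Otimes>\<^sub>M ?M \<rightarrow>\<^sub>M M \<Otimes>\<^sub>M M"
        by (intro measurable_Pair measurable_compose[OF measurable_fst M_sub] measurable_compose[OF measurable_snd M_sub])
      then have "(\<lambda>z. z) \<in> ?M \<Otimes>\<^sub>M ?M \<rightarrow>\<^sub>M M \<Otimes>\<^sub>M M" by simp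
      then have "(\<lambda>z. z) \<in> restrict_space (?M \<Otimes>\<^sub>M ?M) {(p, q) \<in> space ?M \<times> space ?M. fst p = fst q}
          \<rightarrow>\<^sub>M restrict_space (M \<Otimes>\<^sub>M M) {(p, q) \<in> space M \<times> space M. fst p = fst q}"
        by (rule measurable_restrict_space3) (use WM in \<open>auto simp: spaceM\<close>)
      from measurable_compose[OF this measurable_add]
      show "(\<lambda>((x, v), (y, w)). (x, v \<oplus>\<^bsub>?V x\<^esub> w))
        \<in> restrict_space (?M \<Otimes>\<^sub>M ?M) {(p, q) \<in> space ?M \<times> space ?M. fst p = fst q} \<rightarrow>\<^sub>M M"
        by (simp add: subfamily_def)
    qed
    show "(\<lambda>(c, (x, v)). (x, c \<odot>\<^bsub>?V x\<^esub> v)) \<in> (borel :: complex measure) \<Otimes>\<^sub>M ?M \<rightarrow>\<^sub>M ?M"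
    proof (rule measurable_restrict_space2)
      show "(\<lambda>(c, (x, v)). (x, c \<odot>\<^bsub>?V x\<^esub> v)) \<in> space ((borel :: complex measure) \<Otimes>\<^sub>M ?M) \<rightarrow> W"
      proof
        fix z assume "z \<in> space ((borel :: complex measure) \<Otimes>\<^sub>M ?M)"
        then obtain c x v where z: "z = (c, (x, v))" "(x, v) \<in> W"
          by (auto simp: space_pair_measure spaceM)
        then have "x \<in> space X" "v \<in> fiber W x" using fst_W(1) by (auto simp: fiber_def)
        then show "(\<lambda>(c, (x, v)). (x, c \<odot>\<^bsub>?V x\<^esub> v)) z \<in> W"
          using closed_subspace.smult_mem[OF closed] z(1) by (simp add: subfamily_def fiber_def)
      qed
      have "(\<lambda>z. (fst z, id (snd z))) \<in> (borel :: complex measure) \<Otimes>\<^sub>M ?M \<rightarrow>\<^sub>M borel \<Otimes>\<^sub>M M"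
        by (intro measurable_Pair measurable_fst measurable_compose[OF measurable_snd M_sub])
      then have "(\<lambda>z. z) \<in> (borel :: complex measure) \<Otimes>\<^sub>M ?M \<rightarrow>\<^sub>M borel \<Otimes>\<^sub>M M" by simp
      from measurable_compose[OF this measurable_smult]
      show "(\<lambda>(c, (x, v)). (x, c \<odot>\<^bsub>?V x\<^esub> v)) \<in> (borel :: complex measure) \<Otimes>\<^sub>M ?M \<rightarrow>\<^sub>M M"
        by (simp add: subfamily_def)
    qed
    have "(\<lambda>x. (x, \<psi> k x)) \<in> X \<rightarrow>\<^sub>M ?M" for k
      by (rule measurable_restrict_space2) (use \<psi>(1,2) in \<open>auto simp: borel_section_def fiber_def\<close>)
    then show "\<exists>\<psi>. dense_borel_sections X ?V ?M \<psi>"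
      unfolding dense_borel_sections_def using dense by blast
  qed
qed

end
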